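(* Let $M$ be a compact $n$-dimensional manifold and let $g_{ij}(t)$, $t\in[0,T)$, be a solution of the Ricci flow $\partial_t g_{ij}=-2R_{ij}$ on $M$. Let $R=R(x,t)$ denote the scalar curvature of $g(t)$ and let $R_1$ be a positive constant. Suppose $-1\le R\le R_1$ on $M\times[0,T)$, and let $u$ be a positive solution of the heat equation $(\Delta-\partial_t)u=0$ on $M\times[0,T)$, where $\Delta=\Delta_{g(t)}$. Then for any $\delta\in[\frac12,1)$, $$\delta\frac{|\nabla u|^2}{u^2}-\frac{\partial_t u}{u}\ \le\ \delta\frac{|\nabla u|^2}{u^2}-\frac{\partial_t u}{u}-\alpha R+\frac{\beta}{R+2}\ \le\ \frac1t\left(\frac{n}{2\delta}+\frac{4n\beta T}{\delta(1-\delta)}\right)$$ on $M$ for all $t\in(0,T)$, where $\alpha=\dfrac{n}{2\delta(1-\delta)^2}$ and $\beta=\alpha(R_1+2)^2$.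
   Context: $R_{ij}(t)$ is the Ricci curvature tensor of $g(t)$. All geometric quantities ($\nabla$, $|\cdot|$, $\Delta$, $R$) at time $t$ are taken with respect to $g(t)$. *)

theory Defs
  imports "HOL-Analysis.Analysis"
begin

section \<open>Smooth functions\<close>

text \<open>
  The derivative is taken within \<open>S\<close>, so that \<open>S\<close> need not be open. Below, \<open>S\<close> is
  an open set or \<open>[0,T) \<times> V\<close> with \<open>V\<close> open; on such sets the derivative within \<open>S\<close>
  is unique, and at time 0 it is the one-sided derivative.
\<close>

primrec Ck_on :: "nat \<Rightarrow> 'a::real_normed_vector set \<Rightarrow> ('a \<Rightarrow> 'b::real_normed_vector) \<Rightarrow> bool" where
  "Ck_on 0 S f \<longleftrightarrow> continuous_on S f"
| "Ck_on (Suc k) S f \<longleftrightarrow>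
    (\<exists>f'. (\<forall>x\<in>S. (f has_derivative f' x) (at x within S)) \<and> (\<forall>v. Ck_on k S (\<lambda>x. f' x v)))"

definition smooth_on :: "'a::real_normed_vector set \<Rightarrow> ('a \<Rightarrow> 'b::real_normed_vector) \<Rightarrow> bool" where
  "smooth_on S f \<longleftrightarrow> (\<forall>k. Ck_on k S f)"

section \<open>Smooth manifolds\<close>

text \<open>
  The manifold is the whole of the type \<open>'m\<close>; its dimension is \<open>CARD('n)\<close>.
  A chart is a pair of its domain and its coordinate map.
\<close>

type_synonym ('m, 'n) chart = "'m set \<times> ('m \<Rightarrow> real^'n)"

abbreviation chart_inv :: "('m, 'n) chart \<Rightarrow> real^'n \<Rightarrow> 'm" where
  "chart_inv c \<equiv> inv_into (fst c) (snd c)"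

abbreviation chart_image :: "('m, 'n) chart \<Rightarrow> (real^'n) set" where
  "chart_image c \<equiv> snd c ` fst c"

definition is_chart :: "('m::topological_space, 'n::finite) chart \<Rightarrow> bool" where
  "is_chart c \<longleftrightarrow> open (fst c) \<and> open (chart_image c) \<and>
    homeomorphism (fst c) (chart_image c) (snd c) (chart_inv c)"

definition smooth_atlas :: "('m::topological_space, 'n::finite) chart set \<Rightarrow> bool" where
  "smooth_atlas A \<longleftrightarrow>
    (\<forall>c\<in>A. is_chart c) \<and> (\<Union>c\<in>A. fst c) = UNIV \<and>
    (\<forall>c\<in>A. \<forall>d\<in>A. smooth_on (snd c ` (fst c \<inter> fst d)) (snd d \<circ> chart_inv c))"

definition chart_at :: "('m, 'n) chart set \<Rightarrow> 'm \<Rightarrow> ('m, 'n) chart" where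
  "chart_at A p = (SOME c. c \<in> A \<and> p \<in> fst c)"

text \<open>The coordinate derivative \<open>\<partial>f/\<partial>x\<^sup>i\<close> of a function on the manifold, as a function on the chart domain.\<close>

definition chart_partial ::
  "('m, 'n::finite) chart \<Rightarrow> 'n \<Rightarrow> ('m \<Rightarrow> real) \<Rightarrow> 'm \<Rightarrow> real" where
  "chart_partial c i f p = frechet_derivative (f \<circ> chart_inv c) (at (snd c p)) (axis i 1)"

definition transition_jacobian ::
  "('m, 'n::finite) chart \<Rightarrow> ('m, 'n) chart \<Rightarrow> 'm \<Rightarrow> real^'n^'n" where
  "transition_jacobian c d p =
    (\<chi> k i. chart_partial c i (\<lambda>q. snd d q $ k) p)"

section \<open>Riemannian metrics and their curvature\<close>

text \<open>
  A symmetric 2-tensor field is given by its component matrix \<open>g c p = (g\<^sub>i\<^sub>j(p))\<close> in every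
  chart \<open>c\<close> of the atlas around \<open>p\<close>; the components in different charts are related by the
  tensor transformation law.
\<close>

type_synonym ('m, 'n) metric = "('m, 'n) chart \<Rightarrow> 'm \<Rightarrow> real^'n^'n"

definition riemannian_metric ::
  "('m, 'n::finite) chart set \<Rightarrow> ('m, 'n) metric \<Rightarrow> bool" where
  "riemannian_metric A g \<longleftrightarrow>
    (\<forall>c\<in>A. smooth_on (chart_image c) (g c \<circ> chart_inv c)) \<and>
    (\<forall>c\<in>A. \<forall>p\<in>fst c. transpose (g c p) = g c p \<and> (\<forall>v. v \<noteq> 0 \<longrightarrow> 0 < v \<bullet> (g c p *v v))) \<and>
    (\<forall>c\<in>A. \<forall>d\<in>A. \<forall>p\<in>fst c \<inter> fst d.
      g c p = transpose (transition_jacobian c d p) ** g d p ** transition_jacobian c d p)"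

abbreviation metric_inv :: "('m, 'n::finite) metric \<Rightarrow> ('m, 'n) chart \<Rightarrow> 'm \<Rightarrow> real^'n^'n" where
  "metric_inv g c p \<equiv> matrix_inv (g c p)"

text \<open>The Christoffel symbol \<open>\<Gamma>\<^sup>k\<^sub>i\<^sub>j\<close> of the Levi-Civita connection.\<close>

definition christoffel ::
  "('m, 'n::finite) metric \<Rightarrow> ('m, 'n) chart \<Rightarrow> 'n \<Rightarrow> 'n \<Rightarrow> 'n \<Rightarrow> 'm \<Rightarrow> real" where
  "christoffel g c k i j p =
    (\<Sum>l\<in>UNIV. metric_inv g c p $ k $ l *
      (chart_partial c i (\<lambda>q. g c q $ j $ l) p + chart_partial c j (\<lambda>q. g c q $ i $ l) p
        - chart_partial c l (\<lambda>q. g c q $ i $ j) p)) / 2"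

text \<open>Sign convention: the round sphere has positive Ricci curvature.\<close>

definition ricci ::
  "('m, 'n::finite) metric \<Rightarrow> ('m, 'n) chart \<Rightarrow> 'n \<Rightarrow> 'n \<Rightarrow> 'm \<Rightarrow> real" where
  "ricci g c i j p =
    (\<Sum>k\<in>UNIV. chart_partial c k (christoffel g c k i j) p - chart_partial c j (christoffel g c k i k) p)
    + (\<Sum>k\<in>UNIV. \<Sum>l\<in>UNIV. christoffel g c k k l p * christoffel g c l i j p
        - christoffel g c k j l p * christoffel g c l i k p)"

text \<open>
  The scalar invariants below are computed in the chart \<open>chart_at A p\<close>; for a Riemannian metric
  and a smooth function their values do not depend on the choice of the chart around \<open>p\<close>.
\<close>

definition scalar_curvature ::
  "('m, 'n::finite) chart set \<Rightarrow> ('m, 'n) metric \<Rightarrow> 'm \<Rightarrow> real" where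
  "scalar_curvature A g p =
    (let c = chart_at A p in \<Sum>i\<in>UNIV. \<Sum>j\<in>UNIV. metric_inv g c p $ i $ j * ricci g c i j p)"

definition grad_norm_sq ::
  "('m, 'n::finite) chart set \<Rightarrow> ('m, 'n) metric \<Rightarrow> ('m \<Rightarrow> real) \<Rightarrow> 'm \<Rightarrow> real" where
  "grad_norm_sq A g f p =
    (let c = chart_at A p in
      \<Sum>i\<in>UNIV. \<Sum>j\<in>UNIV. metric_inv g c p $ i $ j * chart_partial c i f p * chart_partial c j f p)"

text \<open>The trace of the Hessian, \<open>g\<^sup>i\<^sup>j \<nabla>\<^sub>i \<nabla>\<^sub>j f\<close>.\<close>

definition laplacian ::
  "('m, 'n::finite) chart set \<Rightarrow> ('m, 'n) metric \<Rightarrow> ('m \<Rightarrow> real) \<Rightarrow> 'm \<Rightarrow> real" where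
  "laplacian A g f p =
    (let c = chart_at A p in
      \<Sum>i\<in>UNIV. \<Sum>j\<in>UNIV. metric_inv g c p $ i $ j *
        (chart_partial c i (chart_partial c j f) p
          - (\<Sum>k\<in>UNIV. christoffel g c k i j p * chart_partial c k f p)))"

section \<open>The Ricci flow and the heat equation on \<open>[0,T)\<close>\<close>

definition ricci_flow ::
  "('m, 'n::finite) chart set \<Rightarrow> real \<Rightarrow> (real \<Rightarrow> ('m, 'n) metric) \<Rightarrow> bool" where
  "ricci_flow A T g \<longleftrightarrow>
    (\<forall>t\<in>{0..<T}. riemannian_metric A (g t)) \<and>
    (\<forall>c\<in>A. smooth_on ({0..<T} \<times> chart_image c) (\<lambda>(t, x). g t c (chart_inv c x))) \<and>
    (\<forall>c\<in>A. \<forall>p\<in>fst c. \<forall>t\<in>{0..<T}. \<forall>i j.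
      ((\<lambda>s. g s c p $ i $ j) has_real_derivative - 2 * ricci (g t) c i j p) (at t within {0..<T}))"

definition heat_solution ::
  "('m, 'n::finite) chart set \<Rightarrow> real \<Rightarrow> (real \<Rightarrow> ('m, 'n) metric) \<Rightarrow> (real \<Rightarrow> 'm \<Rightarrow> real) \<Rightarrow> bool" where
  "heat_solution A T g u \<longleftrightarrow>
    (\<forall>c\<in>A. smooth_on ({0..<T} \<times> chart_image c) (\<lambda>(t, x). u t (chart_inv c x))) \<and>
    (\<forall>p. \<forall>t\<in>{0..<T}.
      ((\<lambda>s. u s p) has_real_derivative laplacian A (g t) (u t) p) (at t within {0..<T}))"

abbreviation time_deriv :: "(real \<Rightarrow> 'm \<Rightarrow> real) \<Rightarrow> real \<Rightarrow> 'm \<Rightarrow> real" where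
  "time_deriv u t p \<equiv> deriv (\<lambda>s. u s p) t"

end

(*
  Write f = ln u. The function F = \<delta>|\<nabla>f|^2 - \<partial>_t f - \<alpha>R + \<beta>/(R+2) satisfies

    (\<partial>_t - \<Delta>)F = 2<\<nabla>f,\<nabla>F> + 2(\<alpha> + \<beta>/(R+2)^2)<\<nabla>f,\<nabla>R> - 2\<delta>|\<nabla>^2 f|^2 - 2Ric(\<nabla>f,\<nabla>f)
      - 2<Ric,\<nabla>^2 f> - 2\<alpha>|Ric|^2 - 2\<beta>|Ric|^2/(R+2)^2 - 2\<beta>|\<nabla>R|^2/(R+2)^3,

  by the Bochner formula, the evolution of R and of \<Delta>f along the flow, and the heat equation.
  The good terms in |Ric|^2 and |\<nabla>R|^2 absorb the curvature terms of indefinite sign, and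
  completing the square |\<nabla>^2 f + Ric/(2\<delta>)|^2 leaves at most -(2\<delta>/n)(F - 2\<beta>)^2 wherever F is large.
  The maximum principle for (t - \<epsilon>)F on [\<epsilon>,t], followed by \<epsilon> -> 0, gives the bound; with \<epsilon> > 0
  only interior times matter. The contracted second Bianchi identity enters as
  g^ij \<partial>_t \<Gamma>^k_ij = 0. That R does not depend on the chart is read off the flow itself: Ric is
  -1/2 \<partial>_t g, so its components transform like those of g.
*)

theory Submission
  imports Defs
begin

section \<open>Calculus of smooth functions\<close>

text \<open>The constants fit together as follows. As R \<le> R1, \<beta>/(R+2)^2 \<ge> \<alpha>, so
  4\<alpha>|Ric|^2 is available: 3\<alpha> of it pays for Ric(\<nabla>f,\<nabla>f) at the price
  |\<nabla>f|^4/(3\<alpha>), the rest for completing the square, as \<alpha> \<ge> 1/(2\<delta>).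
  The squared trace contains |\<nabla>f|^4 with the coefficient (2\<delta>/n)(1-\<delta>)^2, which
  is 1/\<alpha>. The term in <\<nabla>f,\<nabla>R> leaves 2\<beta>|\<nabla>f|^2, absorbed by the
  cross term of that square; this is where F has to be large. The obstacle is that the scalar
  invariants are computed in a chart chosen separately at each point, so that regularity in the
  point is invisible until independence of the chart is proved. The geometry is therefore done on an
  open set of space-time with an abstract matrix and its inverse; time is one more coordinate, and
  tensor identities become identities between finite sums of products of ordinary derivatives.
  Orthonormal frames are replaced by a factorization w w^T of the inverse metric.\<close>

lemma Ck_on_subset: "Ck_on k S f \<Longrightarrow> T \<subseteq> S \<Longrightarrow> Ck_on k T f"
proof (induction k arbitrary: f)
  case 0
  then show ?case by (auto intro: continuous_on_subset)
next
  case (Suc k)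
  then obtain f' where "\<forall>x\<in>S. (f has_derivative f' x) (at x within S)" "\<forall>v. Ck_on k S (\<lambda>x. f' x v)"
    by auto
  with Suc show ?case
    by (auto intro!: exI[of _ f'] intro: has_derivative_subset)
qed

lemma Ck_on_cong:
  assumes "\<And>x. x \<in> S \<Longrightarrow> f x = g x"
  shows "Ck_on k S f \<longleftrightarrow> Ck_on k S g"
proof (cases k)
  case 0
  then show ?thesis using assms by (auto cong: continuous_on_cong)
next
  case (Suc j)
  have "(\<forall>x\<in>S. (f has_derivative f' x) (at x within S)) \<longleftrightarrow>
      (\<forall>x\<in>S. (g has_derivative f' x) (at x within S))" for f'
    using assms by (metis has_derivative_transform)
  then show ?thesis using Suc by simp
qed

lemma Ck_on_Suc_imp: "Ck_on (Suc k) S f \<Longrightarrow> Ck_on k S f"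
proof (induction k arbitrary: f)
  case 0
  then show ?case
    by (auto simp: continuous_on_eq_continuous_within intro: has_derivative_continuous)
next
  case (Suc k)
  then obtain f' where "\<forall>x\<in>S. (f has_derivative f' x) (at x within S)"
      "\<forall>v. Ck_on (Suc k) S (\<lambda>x. f' x v)"
    by auto
  with Suc.IH show ?case by auto
qed

lemma Ck_on_const [simp]: "Ck_on k S (\<lambda>x. c)"
proof (induction k arbitrary: c)
  case 0
  then show ?case by simp
next
  case (Suc k)
  then show ?case by (auto intro!: exI[of _ "\<lambda>x h. 0"])
qed

lemma Ck_on_add: "Ck_on k S f \<Longrightarrow> Ck_on k S g \<Longrightarrow> Ck_on k S (\<lambda>x. f x + g x)"
proof (induction k arbitrary: f g)
  case 0
  then show ?case by (auto intro: continuous_intros)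
next
  case (Suc k)
  then obtain f' g' where
    "\<forall>x\<in>S. (f has_derivative f' x) (at x within S)" "\<forall>v. Ck_on k S (\<lambda>x. f' x v)"
    "\<forall>x\<in>S. (g has_derivative g' x) (at x within S)" "\<forall>v. Ck_on k S (\<lambda>x. g' x v)"
    by auto
  with Suc.IH show ?case
    by (auto intro!: exI[of _ "\<lambda>x h. f' x h + g' x h"] derivative_intros)
qed

text \<open>The product rule puts \<open>f\<close> and \<open>g\<close> themselves next to the
  derivatives, so the induction uses both at order \<open>k\<close> as well;
  \<open>Ck_on_Suc_imp\<close> supplies this.\<close>

lemma Ck_on_mult:
  fixes f g :: "'a::real_normed_vector \<Rightarrow> real"
  shows "Ck_on k S f \<Longrightarrow> Ck_on k S g \<Longrightarrow> Ck_on k S (\<lambda>x. f x * g x)"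
proof (induction k arbitrary: f g)
  case 0
  then show ?case by (auto intro: continuous_intros)
next
  case (Suc k)
  then obtain f' g' where *:
    "\<forall>x\<in>S. (f has_derivative f' x) (at x within S)" "\<forall>v. Ck_on k S (\<lambda>x. f' x v)"
    "\<forall>x\<in>S. (g has_derivative g' x) (at x within S)" "\<forall>v. Ck_on k S (\<lambda>x. g' x v)"
    by auto
  have "Ck_on k S (\<lambda>x. f x * g' x v + f' x v * g x)" for v
    using * Suc.prems[THEN Ck_on_Suc_imp] by (intro Ck_on_add Suc.IH) auto
  with * show ?case
    by (auto intro!: exI[of _ "\<lambda>x h. f x * g' x h + f' x h * g x"] has_derivative_mult)
qed

lemma Ck_on_bounded_linear:
  assumes "bounded_linear L"
  shows "Ck_on k S f \<Longrightarrow> Ck_on k S (\<lambda>x. L (f x))"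
proof (induction k arbitrary: f)
  case 0
  then show ?case using bounded_linear.continuous_on[OF assms] by simp
next
  case (Suc k)
  then obtain f' where "\<forall>x\<in>S. (f has_derivative f' x) (at x within S)" "\<forall>v. Ck_on k S (\<lambda>x. f' x v)"
    by auto
  with Suc.IH show ?case
    by (auto intro!: exI[of _ "\<lambda>x h. L (f' x h)"] bounded_linear.has_derivative[OF assms])
qed

lemma Ck_on_inverse:
  fixes f :: "'a::real_normed_vector \<Rightarrow> real"
  assumes "\<And>x. x \<in> S \<Longrightarrow> f x \<noteq> 0"
  shows "Ck_on k S f \<Longrightarrow> Ck_on k S (\<lambda>x. inverse (f x))"
proof (induction k)
  case 0
  then show ?case using assms by (auto intro: continuous_intros)
next
  case (Suc k)
  then obtain f' where *:
    "\<forall>x\<in>S. (f has_derivative f' x) (at x within S)" "\<forall>v. Ck_on k S (\<lambda>x. f' x v)"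
    by auto
  have "Ck_on k S (\<lambda>x. inverse (f x))"
    by (rule Suc.IH[OF Ck_on_Suc_imp[OF Suc.prems]])
  then have "Ck_on k S (\<lambda>x. - 1 * (inverse (f x) * f' x v * inverse (f x)))" for v
    using * by (intro Ck_on_mult) auto
  with * assms show ?case
    by (auto intro!: exI[of _ "\<lambda>x h. - (inverse (f x) * f' x h * inverse (f x))"] Deriv.has_derivative_inverse)
qed

text \<open>No induction: the derivative is \<open>f' / f\<close>, so one order lower the rules for
  products and inverses apply.\<close>

lemma Ck_on_ln:
  fixes f :: "'a::real_normed_vector \<Rightarrow> real"
  assumes "\<And>x. x \<in> S \<Longrightarrow> f x > 0"
  shows "Ck_on k S f \<Longrightarrow> Ck_on k S (\<lambda>x. ln (f x))"
proof (cases k)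
  case 0
  assume "Ck_on k S f"
  with 0 show ?thesis using assms by (force intro!: continuous_intros)
next
  case (Suc j)
  assume f: "Ck_on k S f"
  with Suc obtain f' where *:
    "\<forall>x\<in>S. (f has_derivative f' x) (at x within S)" "\<forall>v. Ck_on j S (\<lambda>x. f' x v)"
    by auto
  have "Ck_on j S (\<lambda>x. inverse (f x))"
    using Ck_on_Suc_imp[of j S f] f Suc assms by (intro Ck_on_inverse) (auto dest: less_imp_neq[symmetric])
  then have 1: "Ck_on j S (\<lambda>x. inverse (f x) * f' x v)" for v
    using * by (intro Ck_on_mult) auto
  have 2: "((\<lambda>x. ln (f x)) has_derivative (\<lambda>h. inverse (f x) * f' x h)) (at x within S)" if "x \<in> S" for x
    using assms[OF that] * that
    by (auto intro!: derivative_eq_intros simp: divide_inverse)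
  show ?thesis unfolding Suc using 1 2
    by (auto intro!: exI[of _ "\<lambda>x h. inverse (f x) * f' x h"])
qed

text \<open>A total operator for all directions, so that derivatives can be iterated as functions,
  and time and coordinate derivatives are instances of one notion. Its value is meaningful where
  \<open>f\<close> is differentiable, hence the smoothness premises of the rules below.\<close>

definition dir_deriv :: "'a::real_normed_vector \<Rightarrow> ('a \<Rightarrow> real) \<Rightarrow> 'a \<Rightarrow> real" where
  "dir_deriv v f z = frechet_derivative f (at z) v"

lemma smooth_on_subset: "smooth_on S f \<Longrightarrow> T \<subseteq> S \<Longrightarrow> smooth_on T f"
  by (auto simp: smooth_on_def intro: Ck_on_subset)

lemma smooth_on_cong: "(\<And>x. x \<in> S \<Longrightarrow> f x = g x) \<Longrightarrow> smooth_on S f \<longleftrightarrow> smooth_on S g"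
  unfolding smooth_on_def using Ck_on_cong by metis

named_theorems smooth_intros

lemma smooth_on_const [smooth_intros, simp]: "smooth_on S (\<lambda>x. c)"
  by (simp add: smooth_on_def)

lemma smooth_on_add [smooth_intros]:
  "smooth_on S f \<Longrightarrow> smooth_on S g \<Longrightarrow> smooth_on S (\<lambda>x. f x + g x)"
  by (simp add: smooth_on_def Ck_on_add)

lemma smooth_on_mult [smooth_intros]:
  fixes f g :: "'a::real_normed_vector \<Rightarrow> real"
  shows "smooth_on S f \<Longrightarrow> smooth_on S g \<Longrightarrow> smooth_on S (\<lambda>x. f x * g x)"
  by (simp add: smooth_on_def Ck_on_mult)

lemma smooth_on_minus [smooth_intros]:
  fixes f :: "'a::real_normed_vector \<Rightarrow> real"
  shows "smooth_on S f \<Longrightarrow> smooth_on S (\<lambda>x. - f x)"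
  using smooth_on_mult[of S "\<lambda>x. -1" f] by simp

lemma smooth_on_diff [smooth_intros]:
  fixes f :: "'a::real_normed_vector \<Rightarrow> real"
  shows "smooth_on S f \<Longrightarrow> smooth_on S g \<Longrightarrow> smooth_on S (\<lambda>x. f x - g x)"
  using smooth_on_add[of S f "\<lambda>x. - g x"] by (simp add: smooth_on_minus)

lemma smooth_on_inverse [smooth_intros]:
  fixes f :: "'a::real_normed_vector \<Rightarrow> real"
  shows "smooth_on S f \<Longrightarrow> (\<And>x. x \<in> S \<Longrightarrow> f x \<noteq> 0) \<Longrightarrow> smooth_on S (\<lambda>x. inverse (f x))"
  by (simp add: smooth_on_def Ck_on_inverse)

lemma smooth_on_divide [smooth_intros]:
  fixes f :: "'a::real_normed_vector \<Rightarrow> real"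
  shows "smooth_on S f \<Longrightarrow> smooth_on S g \<Longrightarrow> (\<And>x. x \<in> S \<Longrightarrow> g x \<noteq> 0) \<Longrightarrow>
    smooth_on S (\<lambda>x. f x / g x)"
  unfolding divide_inverse by (intro smooth_intros)

lemma smooth_on_ln [smooth_intros]:
  fixes f :: "'a::real_normed_vector \<Rightarrow> real"
  shows "smooth_on S f \<Longrightarrow> (\<And>x. x \<in> S \<Longrightarrow> f x > 0) \<Longrightarrow> smooth_on S (\<lambda>x. ln (f x))"
  by (simp add: smooth_on_def Ck_on_ln)

lemma smooth_on_bounded_linear:
  "bounded_linear L \<Longrightarrow> smooth_on S f \<Longrightarrow> smooth_on S (\<lambda>x. L (f x))"
  by (simp add: smooth_on_def Ck_on_bounded_linear)

lemma smooth_on_sum [smooth_intros]: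
  fixes f :: "'i \<Rightarrow> 'a::real_normed_vector \<Rightarrow> real"
  shows "(\<And>i. i \<in> I \<Longrightarrow> smooth_on S (f i)) \<Longrightarrow> smooth_on S (\<lambda>x. \<Sum>i\<in>I. f i x)"
  by (induction I rule: infinite_finite_induct) (auto intro: smooth_intros)

lemma smooth_on_prod [smooth_intros]:
  fixes f :: "'i \<Rightarrow> 'a::real_normed_vector \<Rightarrow> real"
  shows "(\<And>i. i \<in> I \<Longrightarrow> smooth_on S (f i)) \<Longrightarrow> smooth_on S (\<lambda>x. \<Prod>i\<in>I. f i x)"
  by (induction I rule: infinite_finite_induct) (auto intro: smooth_intros)

lemma smooth_on_imp_continuous_on: "smooth_on S f \<Longrightarrow> continuous_on S f"
  unfolding smooth_on_def by (metis Ck_on.simps(1))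

lemma smooth_on_imp_differentiable:
  assumes "open S" "smooth_on S f" "z \<in> S"
  shows "f differentiable at z"
proof -
  have "Ck_on (Suc 0) S f" using assms by (simp add: smooth_on_def)
  then show ?thesis using assms at_within_open[of z S] unfolding differentiable_def by fastforce
qed

lemma smooth_on_has_derivative:
  assumes "open S" "smooth_on S f" "z \<in> S"
  shows "(f has_derivative (\<lambda>v. dir_deriv v f z)) (at z)"
  using smooth_on_imp_differentiable[OF assms]
  by (simp add: dir_deriv_def frechet_derivative_works)

lemma dir_derivI: "(f has_derivative f') (at z) \<Longrightarrow> dir_deriv v f z = f' v"
  by (metis dir_deriv_def frechet_derivative_at)

text \<open>\<open>Ck_on\<close> only asserts that some derivative within \<open>S\<close> has
  components of the next lower order. Openness of \<open>S\<close> makes it the full derivative,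
  which is unique and hence equal to \<open>dir_deriv\<close>.\<close>

lemma smooth_on_dir_deriv [smooth_intros]:
  assumes "open S" "smooth_on S f"
  shows "smooth_on S (dir_deriv v f)"
  unfolding smooth_on_def
proof
  fix k
  have "Ck_on (Suc k) S f" using assms by (simp add: smooth_on_def)
  then obtain f' where f': "\<forall>x\<in>S. (f has_derivative f' x) (at x within S)"
      "\<forall>v. Ck_on k S (\<lambda>x. f' x v)"
    by auto
  have "dir_deriv v f x = f' x v" if "x \<in> S" for x
    using f' that assms(1) dir_derivI[of f "f' x" x v] by (metis at_within_open)
  with f' show "Ck_on k S (dir_deriv v f)"
    using Ck_on_cong[of S "dir_deriv v f" "\<lambda>x. f' x v" k] by blast
qed

text \<open>A derivative depends on the germ only. This is what allows an identity valid on all of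
  an open set, such as the flow equation, to be differentiated.\<close>

lemma dir_deriv_cong_open:
  assumes "open S" "z \<in> S" "\<And>x. x \<in> S \<Longrightarrow> f x = g x"
  shows "dir_deriv v f z = dir_deriv v g z"
proof -
  have "(f has_derivative f') (at z) \<longleftrightarrow> (g has_derivative f') (at z)" for f'
    using assms has_derivative_transform_within_open[of f f' z UNIV S g]
      has_derivative_transform_within_open[of g f' z UNIV S f] by auto
  then show ?thesis by (simp add: dir_deriv_def frechet_derivative_def)
qed

lemma dir_deriv_const [simp]: "dir_deriv v (\<lambda>x. c) z = 0"
  by (simp add: dir_deriv_def)

lemma dir_deriv_scaleR:
  assumes "open S" "smooth_on S f" "z \<in> S"
  shows "dir_deriv (c *\<^sub>R v) f z = c * dir_deriv v f z"
  using linear_frechet_derivative[OF smooth_on_imp_differentiable[OF assms]]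
  by (simp add: dir_deriv_def linear_cmul)

lemma dir_deriv_sum_dir:
  assumes "open S" "smooth_on S f" "z \<in> S"
  shows "dir_deriv (\<Sum>i\<in>I. v i) f z = (\<Sum>i\<in>I. dir_deriv (v i) f z)"
  using linear_frechet_derivative[OF smooth_on_imp_differentiable[OF assms]]
  by (simp add: dir_deriv_def linear_sum)

lemma has_real_derivative_dir_deriv:
  assumes "open S" "smooth_on S f" "p + x *\<^sub>R v \<in> S"
  shows "((\<lambda>s. f (p + s *\<^sub>R v)) has_real_derivative dir_deriv v f (p + x *\<^sub>R v)) (at x)"
proof -
  have "((\<lambda>s. f (p + s *\<^sub>R v)) has_derivative (\<lambda>s. dir_deriv (s *\<^sub>R v) f (p + x *\<^sub>R v))) (at x)"
    by (rule has_derivative_compose[of "\<lambda>s. p + s *\<^sub>R v", OF _ smooth_on_has_derivative[OF assms]])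
       (auto intro!: derivative_eq_intros)
  then show ?thesis
    by (simp add: has_field_derivative_def dir_deriv_scaleR[OF assms] mult_commute_abs)
qed

section \<open>Symmetry of mixed derivatives\<close>

lemma second_difference_mean_value:
  assumes S: "open S" "smooth_on S f" and s: "s > 0"
    and ball: "\<And>a b. a \<in> {0..s} \<Longrightarrow> b \<in> {0..s} \<Longrightarrow> z + a *\<^sub>R v + b *\<^sub>R w \<in> S"
  shows "\<exists>a\<in>{0..s}. \<exists>b\<in>{0..s}.
    f (z + s *\<^sub>R v + s *\<^sub>R w) - f (z + s *\<^sub>R v) - f (z + s *\<^sub>R w) + f z
      = s * s * dir_deriv w (dir_deriv v f) (z + a *\<^sub>R v + b *\<^sub>R w)"
proof -
  have "((\<lambda>a. f ((z + s *\<^sub>R w) + a *\<^sub>R v) - f (z + a *\<^sub>R v)) has_real_derivative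
      dir_deriv v f ((z + s *\<^sub>R w) + a *\<^sub>R v) - dir_deriv v f (z + a *\<^sub>R v)) (at a)"
    if "0 \<le> a" "a \<le> s" for a
    using that s ball[of a s] ball[of a 0]
    by (intro derivative_intros has_real_derivative_dir_deriv[OF S]) (auto simp: add_ac)
  from MVT2[OF s, of "\<lambda>a. f ((z + s *\<^sub>R w) + a *\<^sub>R v) - f (z + a *\<^sub>R v)", OF this]
  obtain a where a: "0 < a" "a < s" and
    eq1: "f (z + s *\<^sub>R v + s *\<^sub>R w) - f (z + s *\<^sub>R v) - f (z + s *\<^sub>R w) + f z
      = s * (dir_deriv v f (z + a *\<^sub>R v + s *\<^sub>R w) - dir_deriv v f (z + a *\<^sub>R v))"
    by (auto simp: add_ac algebra_simps)
  have "((\<lambda>b. dir_deriv v f ((z + a *\<^sub>R v) + b *\<^sub>R w)) has_real_derivative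
      dir_deriv w (dir_deriv v f) ((z + a *\<^sub>R v) + b *\<^sub>R w)) (at b)" if "0 \<le> b" "b \<le> s" for b
    using that a ball[of a b] S
    by (intro derivative_intros has_real_derivative_dir_deriv[OF S(1)] smooth_on_dir_deriv) auto
  from MVT2[OF s, of "\<lambda>b. dir_deriv v f ((z + a *\<^sub>R v) + b *\<^sub>R w)", OF this]
  obtain b where "0 < b" "b < s"
    "dir_deriv v f (z + a *\<^sub>R v + s *\<^sub>R w) - dir_deriv v f (z + a *\<^sub>R v)
      = s * dir_deriv w (dir_deriv v f) (z + a *\<^sub>R v + b *\<^sub>R w)"
    by auto
  with eq1 a show ?thesis
    by (intro bexI[of _ a] bexI[of _ b]) auto
qed

text \<open>The second difference of \<open>f\<close> over a small parallelogram is symmetric in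
  \<open>v\<close> and \<open>w\<close>, and by the mean value lemma it equals \<open>s * s\<close>
  times either mixed derivative at some nearby point. Continuity of both mixed derivatives then
  makes them agree at \<open>z\<close> up to any \<open>e\<close>.\<close>

lemma dir_deriv_commute:
  assumes S: "open S" "smooth_on S f" and z: "z \<in> S"
  shows "dir_deriv v (dir_deriv w f) z = dir_deriv w (dir_deriv v f) z"
proof (rule dense_eq0_I[of "_ - _ :: real", simplified])
  fix e :: real assume e: "0 < e"
  have "continuous (at z) (dir_deriv v (dir_deriv w f))" "continuous (at z) (dir_deriv w (dir_deriv v f))"
    by (intro differentiable_imp_continuous_within smooth_on_imp_differentiable[OF S(1) _ z]
        smooth_on_dir_deriv S)+
  then obtain d1 d2 where d12: "d1 > 0" "d2 > 0"
    "\<And>x. dist x z < d1 \<Longrightarrow> dist (dir_deriv v (dir_deriv w f) x) (dir_deriv v (dir_deriv w f) z) < e/2"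
    "\<And>x. dist x z < d2 \<Longrightarrow> dist (dir_deriv w (dir_deriv v f) x) (dir_deriv w (dir_deriv v f) z) < e/2"
    unfolding continuous_at_eps_delta using e half_gt_zero by metis
  obtain d3 where d3: "d3 > 0" "ball z d3 \<subseteq> S"
    using S(1) z open_contains_ball by blast
  define d where "d = min d1 (min d2 d3)"
  have d: "d > 0" using d12 d3 by (simp add: d_def)
  \<comment> \<open>The parallelogram with sides \<open>s *\<^sub>R v\<close> and
    \<open>s *\<^sub>R w\<close> stays within distance \<open>d / 2\<close> of \<open>z\<close>; the
    summand 1 keeps the denominator positive when both directions vanish.\<close>
  define s where "s = d / (norm v + norm w + 1) / 2"
  have s: "s > 0" using d by (simp add: s_def add_nonneg_pos)
  have near: "dist (z + a *\<^sub>R v' + b *\<^sub>R w') z < d"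
    if "a \<in> {0..s}" "b \<in> {0..s}" "norm v' + norm w' = norm v + norm w" for a b v' w'
  proof -
    have "norm (a *\<^sub>R v' + b *\<^sub>R w') \<le> a * norm v' + b * norm w'"
      using that norm_triangle_ineq[of "a *\<^sub>R v'" "b *\<^sub>R w'"] by simp
    also have "\<dots> \<le> s * norm v' + s * norm w'"
      using that by (intro add_mono mult_right_mono) auto
    also have "\<dots> \<le> s * (norm v + norm w + 1)"
      using s that(3) by (simp add: distrib_left[symmetric])
    also have "\<dots> = d / 2"
    proof -
      have "norm v + norm w + 1 > 0"
        by (simp add: add_nonneg_pos)
      then show ?thesis by (simp add: s_def field_simps)
    qed
    finally show ?thesis using d by (simp add: dist_norm add.assoc)
  qed
  have inS: "dist x z < d \<Longrightarrow> x \<in> S" for x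
    using d3 by (auto simp: d_def dist_commute subset_iff)
  obtain a b where ab: "a \<in> {0..s}" "b \<in> {0..s}" and 1:
    "f (z + s *\<^sub>R v + s *\<^sub>R w) - f (z + s *\<^sub>R v) - f (z + s *\<^sub>R w) + f z
      = s * s * dir_deriv w (dir_deriv v f) (z + a *\<^sub>R v + b *\<^sub>R w)"
    using second_difference_mean_value[OF S s, of z v w] near[of _ _ v w] inS by blast
  obtain a' b' where ab': "a' \<in> {0..s}" "b' \<in> {0..s}" and 2:
    "f (z + s *\<^sub>R w + s *\<^sub>R v) - f (z + s *\<^sub>R w) - f (z + s *\<^sub>R v) + f z
      = s * s * dir_deriv v (dir_deriv w f) (z + a' *\<^sub>R w + b' *\<^sub>R v)"
    using second_difference_mean_value[OF S s, of z w v] near[of _ _ w v] inS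
    by (metis add.commute)
  have "s * s * dir_deriv w (dir_deriv v f) (z + a *\<^sub>R v + b *\<^sub>R w)
      = s * s * dir_deriv v (dir_deriv w f) (z + a' *\<^sub>R w + b' *\<^sub>R v)"
    using 1 2 unfolding add.assoc[of z] add.commute[of "s *\<^sub>R v" "s *\<^sub>R w"] by linarith
  then have "dir_deriv w (dir_deriv v f) (z + a *\<^sub>R v + b *\<^sub>R w)
      = dir_deriv v (dir_deriv w f) (z + a' *\<^sub>R w + b' *\<^sub>R v)"
    using s by simp
  moreover have "dist (z + a *\<^sub>R v + b *\<^sub>R w) z < d2" "dist (z + a' *\<^sub>R w + b' *\<^sub>R v) z < d1"
    using near[OF ab, of v w] near[OF ab', of w v] by (auto simp: d_def)
  ultimately show "\<bar>dir_deriv v (dir_deriv w f) z - dir_deriv w (dir_deriv v f) z\<bar> \<le> e"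
    using d12(3,4) by (fastforce simp: dist_real_def abs_if split: if_splits)
qed

text \<open>The differentiation rules are stated with smoothness premises only, so that the simplifier
  can discharge them with the structural rules for smoothness.\<close>

locale smooth_calculus =
  fixes W :: "'a::real_normed_vector set"
  assumes open_W [simp]: "open W"
begin

lemmas has_deriv = smooth_on_has_derivative[OF open_W]

lemma dir_deriv_rules:
  fixes f g :: "'a \<Rightarrow> real"
  assumes "smooth_on W f" "smooth_on W g" "z \<in> W"
  shows "dir_deriv v (\<lambda>x. f x + g x) z = dir_deriv v f z + dir_deriv v g z"
    and "dir_deriv v (\<lambda>x. f x - g x) z = dir_deriv v f z - dir_deriv v g z"
    and "dir_deriv v (\<lambda>x. f x * g x) z = dir_deriv v f z * g z + f z * dir_deriv v g z"
proof -
  note d = has_deriv[OF assms(1,3)] has_deriv[OF assms(2,3)]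
  show "dir_deriv v (\<lambda>x. f x + g x) z = dir_deriv v f z + dir_deriv v g z"
    by (rule dir_derivI[OF has_derivative_add[OF d]])
  show "dir_deriv v (\<lambda>x. f x - g x) z = dir_deriv v f z - dir_deriv v g z"
    by (rule dir_derivI[OF has_derivative_diff[OF d]])
  show "dir_deriv v (\<lambda>x. f x * g x) z = dir_deriv v f z * g z + f z * dir_deriv v g z"
    using dir_derivI[OF has_derivative_mult[OF d]] by simp
qed

lemma dir_deriv_minus:
  "smooth_on W f \<Longrightarrow> z \<in> W \<Longrightarrow> dir_deriv v (\<lambda>x. - f x) z = - dir_deriv v f z"
  using dir_deriv_rules(2)[of "\<lambda>x. 0" f z v] by simp

lemma dir_deriv_sum:
  "(\<And>i. i \<in> I \<Longrightarrow> smooth_on W (f i)) \<Longrightarrow> z \<in> W \<Longrightarrow>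
    dir_deriv v (\<lambda>x. \<Sum>i\<in>I. f i x) z = (\<Sum>i\<in>I. dir_deriv v (f i) z)"
  by (rule dir_derivI, rule has_derivative_sum, rule has_deriv) auto

lemma dir_deriv_ln:
  assumes "smooth_on W f" "z \<in> W" "f z > 0"
  shows "dir_deriv v (\<lambda>x. ln (f x)) z = dir_deriv v f z / f z"
  using dir_derivI[OF has_derivative_ln[OF assms(3) has_deriv[OF assms(1,2)]]] by (simp add: field_simps)

lemma dir_deriv_inverse:
  assumes "smooth_on W f" "z \<in> W" "f z \<noteq> 0"
  shows "dir_deriv v (\<lambda>x. inverse (f x)) z = - (dir_deriv v f z / (f z)\<^sup>2)"
  using dir_derivI[OF Deriv.has_derivative_inverse[OF assms(3) has_deriv[OF assms(1,2)]]]
  by (simp add: field_simps power2_eq_square)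

lemma dir_deriv_commute': "smooth_on W f \<Longrightarrow> z \<in> W \<Longrightarrow>
    dir_deriv v (dir_deriv w f) z = dir_deriv w (dir_deriv v f) z"
  using dir_deriv_commute[OF open_W] by auto

lemma smooth_dir_deriv [smooth_intros]: "smooth_on W f \<Longrightarrow> smooth_on W (dir_deriv v f)"
  by (rule smooth_on_dir_deriv[OF open_W])

end

section \<open>Riemannian geometry in a chart\<close>

lemma sum_swap3: "(\<Sum>i\<in>A. \<Sum>j\<in>B. \<Sum>k\<in>C. f i j k) = (\<Sum>k\<in>C. \<Sum>i\<in>A. \<Sum>j\<in>B. f i j k)"
  by (rule trans[OF sum.cong[OF refl sum.swap] sum.swap])

lemma sum_swap4:
  "(\<Sum>i\<in>A. \<Sum>j\<in>B. \<Sum>k\<in>C. \<Sum>l\<in>D. f i j k l) = (\<Sum>l\<in>D. \<Sum>i\<in>A. \<Sum>j\<in>B. \<Sum>k\<in>C. f i j k l)"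
  by (rule trans[OF sum.cong[OF refl sum_swap3] sum.swap])

lemma sum_swap5:
  "(\<Sum>i\<in>A. \<Sum>j\<in>B. \<Sum>k\<in>C. \<Sum>l\<in>D. \<Sum>m\<in>E. f i j k l m) =
   (\<Sum>m\<in>E. \<Sum>i\<in>A. \<Sum>j\<in>B. \<Sum>k\<in>C. \<Sum>l\<in>D. f i j k l m)"
  by (rule trans[OF sum.cong[OF refl sum_swap4] sum.swap])

text \<open>With backtracking over these rules, \<open>(rule sum_pull, rule sum.cong[OF refl])+\<close> reorders
  nested sums to match the order on the right-hand side of an equation.\<close>

lemmas sum_pull = trans[OF refl] trans[OF sum.swap] trans[OF sum_swap3] trans[OF sum_swap4]
  trans[OF sum_swap5]

lemmas sum_distribs = sum_distrib_left sum_distrib_right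

text \<open>With \<open>S\<close> a Christoffel symbol and \<open>B\<close> a curvature component,
  this disposes of connection terms in the traces of the Bianchi identity.\<close>

lemma sum_sym_antisym:
  fixes S B :: "'n::finite \<Rightarrow> 'n \<Rightarrow> real"
  assumes "\<And>i j. S i j = S j i" "\<And>i j. B i j = - B j i"
  shows "(\<Sum>i\<in>UNIV. \<Sum>j\<in>UNIV. S i j * B i j) = 0"
proof -
  have "(\<Sum>i\<in>UNIV. \<Sum>j\<in>UNIV. S i j * B i j) = (\<Sum>i\<in>UNIV. \<Sum>j\<in>UNIV. S j i * B j i)"
    by (rule sum.swap)
  also have "\<dots> = (\<Sum>i\<in>UNIV. \<Sum>j\<in>UNIV. - (S i j * B i j))"
    using assms by (intro sum.cong refl) (metis mult_minus_right)
  finally show ?thesis by (simp add: sum_negf)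
qed

text \<open>The inverse \<open>H\<close> is a second field tied to \<open>G\<close> by
  \<open>G_H\<close> instead of a matrix inverse. Curvature identities and evolution equations are
  then algebra with smooth functions, and positivity enters only in \<open>heat_chart\<close>.
  Space-time is a single domain, so time derivatives commute with space derivatives by the general
  rule.\<close>

locale metric_chart = smooth_calculus W
  for W :: "(real \<times> (real^'n::finite)) set" +
  fixes G H :: "'n \<Rightarrow> 'n \<Rightarrow> real \<times> (real^'n) \<Rightarrow> real"
  assumes smooth_G [smooth_intros]: "smooth_on W (G i j)"
    and smooth_H [smooth_intros]: "smooth_on W (H i j)"
    and G_sym: "z \<in> W \<Longrightarrow> G i j z = G j i z"
    and H_sym: "z \<in> W \<Longrightarrow> H i j z = H j i z"
    and G_H: "z \<in> W \<Longrightarrow> (\<Sum>l\<in>UNIV. G i l z * H l j z) = (if i = j then 1 else 0)"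
begin

lemmas smooths [simp] = smooth_on_const smooth_on_add smooth_on_mult smooth_on_minus smooth_on_diff
  smooth_on_sum smooth_dir_deriv smooth_G smooth_H

lemmas dds = dir_deriv_rules dir_deriv_sum dir_deriv_minus

abbreviation D :: "'n \<Rightarrow> (real \<times> (real^'n) \<Rightarrow> real) \<Rightarrow> real \<times> (real^'n) \<Rightarrow> real" where
  "D i \<equiv> dir_deriv (0, axis i 1)"

abbreviation Dt :: "(real \<times> (real^'n) \<Rightarrow> real) \<Rightarrow> real \<times> (real^'n) \<Rightarrow> real" where
  "Dt \<equiv> dir_deriv (1, 0)"

text \<open>\<open>Gam k i j\<close> is \<open>\<Gamma>\<^sup>k\<^sub>i\<^sub>j\<close>, \<open>Rc\<close> and \<open>Rs\<close> are the Ricci and the scalar curvature, and the matrix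
  \<open>Kc i j\<close> with entries \<open>Kc i j a b\<close> (row \<open>a\<close>, column \<open>b\<close>) is the curvature
  \<open>\<partial>\<^sub>i \<Gamma>\<^sub>j - \<partial>\<^sub>j \<Gamma>\<^sub>i + [\<Gamma>\<^sub>i, \<Gamma>\<^sub>j]\<close>, where \<open>\<Gamma>\<^sub>i\<close> is the matrix \<open>(\<Gamma>\<^sup>a\<^sub>i\<^sub>b)\<close>. In \<open>KH\<close> the index \<open>b\<close> is raised.\<close>

definition Gam :: "'n \<Rightarrow> 'n \<Rightarrow> 'n \<Rightarrow> real \<times> (real^'n) \<Rightarrow> real" where
  "Gam k i j z = (\<Sum>l\<in>UNIV. H k l z * (D i (G j l) z + D j (G i l) z - D l (G i j) z)) / 2"

definition Rc :: "'n \<Rightarrow> 'n \<Rightarrow> real \<times> (real^'n) \<Rightarrow> real" where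
  "Rc i j z = (\<Sum>k\<in>UNIV. D k (Gam k i j) z - D j (Gam k i k) z)
    + (\<Sum>k\<in>UNIV. \<Sum>l\<in>UNIV. Gam k k l z * Gam l i j z - Gam k j l z * Gam l i k z)"

definition Rs :: "real \<times> (real^'n) \<Rightarrow> real" where
  "Rs z = (\<Sum>i\<in>UNIV. \<Sum>j\<in>UNIV. H i j z * Rc i j z)"

definition Kc :: "'n \<Rightarrow> 'n \<Rightarrow> 'n \<Rightarrow> 'n \<Rightarrow> real \<times> (real^'n) \<Rightarrow> real" where
  "Kc i j a b z = D i (Gam a j b) z - D j (Gam a i b) z
    + (\<Sum>c\<in>UNIV. Gam a i c z * Gam c j b z - Gam a j c z * Gam c i b z)"

definition KH :: "'n \<Rightarrow> 'n \<Rightarrow> 'n \<Rightarrow> 'n \<Rightarrow> real \<times> (real^'n) \<Rightarrow> real" where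
  "KH i j a m z = (\<Sum>b\<in>UNIV. Kc i j a b z * H b m z)"

lemma smooth_Gam [smooth_intros, simp]: "smooth_on W (Gam k i j)"
  unfolding Gam_def[abs_def] by (intro smooth_intros) auto

lemma smooth_Rc [smooth_intros, simp]: "smooth_on W (Rc i j)"
  unfolding Rc_def[abs_def] by (intro smooth_intros)

lemma smooth_Rs [smooth_intros, simp]: "smooth_on W Rs"
  unfolding Rs_def[abs_def] by (intro smooth_intros)

lemma smooth_Kc [smooth_intros, simp]: "smooth_on W (Kc i j a b)"
  unfolding Kc_def[abs_def] by (intro smooth_intros)

lemma smooth_KH [smooth_intros, simp]: "smooth_on W (KH i j a b)"
  unfolding KH_def[abs_def] by (intro smooth_intros)

lemma dir_deriv_cong:
  assumes "z \<in> W" "\<And>x. x \<in> W \<Longrightarrow> f x = g x"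
  shows "dir_deriv v f z = dir_deriv v g z"
  by (rule dir_deriv_cong_open[OF open_W]) (use assms in auto)

lemma dir_deriv_G_sym: "z \<in> W \<Longrightarrow> dir_deriv v (G i j) z = dir_deriv v (G j i) z"
  by (rule dir_deriv_cong) (auto simp: G_sym)

lemma Gam_sym: "z \<in> W \<Longrightarrow> Gam k i j z = Gam k j i z"
  unfolding Gam_def using dir_deriv_G_sym[of z _ i j] by (simp add: add.commute)

lemma dir_deriv_Gam_sym: "z \<in> W \<Longrightarrow> dir_deriv v (Gam k i j) z = dir_deriv v (Gam k j i) z"
  by (rule dir_deriv_cong) (auto simp: Gam_sym)

lemma H_G: "z \<in> W \<Longrightarrow> (\<Sum>l\<in>UNIV. H i l z * G l j z) = (if i = j then 1 else 0)"
  using G_H[of z j i] by (simp add: H_sym[of z i] G_sym[of z j] mult.commute eq_commute)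

lemma G_H_contract: "z \<in> W \<Longrightarrow> (\<Sum>k\<in>UNIV. G i k z * (\<Sum>l\<in>UNIV. H k l z * c l)) = c i"
proof -
  assume z: "z \<in> W"
  have "(\<Sum>k\<in>UNIV. G i k z * (\<Sum>l\<in>UNIV. H k l z * c l)) =
      (\<Sum>l\<in>UNIV. (\<Sum>k\<in>UNIV. G i k z * H k l z) * c l)"
    unfolding sum_distribs by ((rule sum_pull, rule sum.cong[OF refl])+, simp only: mult_ac)
  then show ?thesis by (simp add: G_H[OF z] if_distrib[of "\<lambda>x. x * _"] cong: if_cong)
qed

lemma H_G_contract: "z \<in> W \<Longrightarrow> (\<Sum>k\<in>UNIV. H i k z * (\<Sum>l\<in>UNIV. G k l z * c l)) = c i"
proof -
  assume z: "z \<in> W"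
  have "(\<Sum>k\<in>UNIV. H i k z * (\<Sum>l\<in>UNIV. G k l z * c l)) =
      (\<Sum>l\<in>UNIV. (\<Sum>k\<in>UNIV. H i k z * G k l z) * c l)"
    unfolding sum_distribs by ((rule sum_pull, rule sum.cong[OF refl])+, simp only: mult_ac)
  then show ?thesis by (simp add: H_G[OF z] if_distrib[of "\<lambda>x. x * _"] cong: if_cong)
qed

lemma G_Gam:
  assumes z: "z \<in> W"
  shows "(\<Sum>k\<in>UNIV. G m k z * Gam k i j z) = (D i (G j m) z + D j (G i m) z - D m (G i j) z) / 2"
  using G_H_contract[OF z, of m "\<lambda>l. D i (G j l) z + D j (G i l) z - D l (G i j) z"]
  by (simp add: Gam_def sum_divide_distrib[symmetric])

text \<open>Adding the two lowered Christoffel symbols cancels every derivative of \<open>G\<close>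
  except the one on the left: this is the compatibility \<nabla>g = 0 of the Levi-Civita
  connection.\<close>

lemma D_G:
  assumes z: "z \<in> W"
  shows "D k (G i j) z = (\<Sum>l\<in>UNIV. G j l z * Gam l k i z) + (\<Sum>l\<in>UNIV. G i l z * Gam l k j z)"
  using dir_deriv_G_sym[OF z, of _ i j] dir_deriv_G_sym[OF z, of _ k i] dir_deriv_G_sym[OF z, of _ k j]
  unfolding G_Gam[OF z] by (simp add: field_simps)

text \<open>Differentiating \<open>G H = 1\<close> gives \<open>G H' = - G' H\<close>; multiplying
  by \<open>H\<close> from the left isolates \<open>H'\<close>.\<close>

lemma dir_deriv_H:
  assumes z: "z \<in> W"
  shows "dir_deriv v (H i j) z = - (\<Sum>a\<in>UNIV. \<Sum>b\<in>UNIV. H i a z * dir_deriv v (G a b) z * H b j z)"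
proof -
  have "(\<Sum>l\<in>UNIV. G a l z * dir_deriv v (H l j) z) = - (\<Sum>l\<in>UNIV. dir_deriv v (G a l) z * H l j z)" for a
  proof -
    have "dir_deriv v (\<lambda>z. \<Sum>l\<in>UNIV. G a l z * H l j z) z = dir_deriv v (\<lambda>z. if a = j then 1 else 0) z"
      using z by (intro dir_deriv_cong G_H)
    then show ?thesis using z by (simp add: dds sum.distrib)
  qed
  then have "(\<Sum>a\<in>UNIV. H i a z * - (\<Sum>l\<in>UNIV. dir_deriv v (G a l) z * H l j z)) = dir_deriv v (H i j) z"
    using H_G_contract[OF z, of i "\<lambda>l. dir_deriv v (H l j) z"] by simp
  then show ?thesis
    by (simp add: sum_distribs sum_negf mult.assoc)
qed

text \<open>The derivative of the inverse combined with \<open>D_G\<close>. It expresses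
  \<nabla>g^{-1} = 0 and is the rule by which inverse metrics are differentiated in space.\<close>

lemma D_H:
  assumes z: "z \<in> W"
  shows "D k (H i j) z = - (\<Sum>l\<in>UNIV. Gam i k l z * H l j z) - (\<Sum>l\<in>UNIV. Gam j k l z * H l i z)"
proof -
  have 1: "(\<Sum>a\<in>UNIV. \<Sum>b\<in>UNIV. H i a z * (\<Sum>l\<in>UNIV. G b l z * Gam l k a z) * H b j z) =
      (\<Sum>a\<in>UNIV. H i a z * (\<Sum>b\<in>UNIV. H j b z * (\<Sum>l\<in>UNIV. G b l z * Gam l k a z)))"
    by (simp add: sum_distribs H_sym[OF z, of _ j] mult_ac)
  have 2: "(\<Sum>a\<in>UNIV. \<Sum>b\<in>UNIV. H i a z * (\<Sum>l\<in>UNIV. G a l z * Gam l k b z) * H b j z) =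
      (\<Sum>b\<in>UNIV. (\<Sum>a\<in>UNIV. H i a z * (\<Sum>l\<in>UNIV. G a l z * Gam l k b z)) * H b j z)"
    unfolding sum_distribs by ((rule sum_pull, rule sum.cong[OF refl])+, simp only: mult_ac)
  show ?thesis
    unfolding dir_deriv_H[OF z] D_G[OF z]
    using 1 2 by (simp add: distrib_left distrib_right sum.distrib H_G_contract[OF z]
        H_sym[OF z, of _ i] mult.commute)
qed

section \<open>The curvature tensor: its symmetries and the second Bianchi identity\<close>

lemma Rc_Kc:
  assumes z: "z \<in> W"
  shows "Rc i j z = (\<Sum>k\<in>UNIV. Kc k j k i z)"
  unfolding Rc_def Kc_def
  using Gam_sym[OF z, of _ i] dir_deriv_Gam_sym[OF z, of _ _ i]
  by (simp add: sum.distrib sum_subtractf)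

lemma Kc_antisym: "Kc i j a b z = - Kc j i a b z"
  by (simp add: Kc_def sum_subtractf)

lemma KH_antisym1: "KH i j a m z = - KH j i a m z"
  unfolding KH_def using Kc_antisym[of i j] by (simp add: sum_negf)

text \<open>Antisymmetry of the curvature in its last two indices, from \<open>\<partial>\<^sub>i \<partial>\<^sub>j H = \<partial>\<^sub>j \<partial>\<^sub>i H\<close> and
  \<open>\<partial>\<^sub>i H = - \<Gamma>\<^sub>i H - (\<Gamma>\<^sub>i H)\<^sup>T\<close>.\<close>

lemma KH_antisym2:
  assumes z: "z \<in> W"
  shows "KH i j a m z = - KH i j m a z"
proof -
  define E where "E i a m z = (\<Sum>l\<in>UNIV. Gam a i l z * H l m z)" for i a m z
  define M where "M i j a m = (\<Sum>l\<in>UNIV. \<Sum>p\<in>UNIV. Gam a i l z * (Gam m j p z * H p l z))" for i j a m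
  define N where "N i j a m = (\<Sum>l\<in>UNIV. \<Sum>p\<in>UNIV. Gam a i l z * (Gam l j p z * H p m z))" for i j a m
  define P where "P j i a m = (\<Sum>l\<in>UNIV. D j (Gam a i l) z * H l m z)" for j i a m
  have sE [simp]: "smooth_on W (E i a m)" for i a m unfolding E_def[abs_def] by simp
  have DE: "D j (E i a m) z = P j i a m - N i j a m - M i j a m" for i j a m
    unfolding E_def[abs_def] P_def N_def M_def using z
    by (simp add: dds D_H[OF z] sum.distrib sum_subtractf sum_negf right_diff_distrib sum_distrib_left)
  have DH: "D i (H a m) z = - E i a m z - E i m a z" if "z \<in> W" for i a m z
    using D_H[OF that] by (simp add: E_def)
  have "D j (D i (H a m)) z = D j (\<lambda>z. - E i a m z - E i m a z) z" for i j a m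
    using z by (intro dir_deriv_cong DH)
  then have DDH: "D j (D i (H a m)) z = - D j (E i a m) z - D j (E i m a) z" for i j a m
    using z by (simp add: dds)
  have M: "M j i a m = M i j m a" for a m
    unfolding M_def H_sym[OF z]
    by ((rule sum_pull, rule sum.cong[OF refl])+, use H_sym[OF z] in \<open>simp add: mult_ac\<close>)
  have KH: "KH i j a m z = P i j a m - P j i a m + N i j a m - N j i a m" for a m
  proof -
    have "(\<Sum>b\<in>UNIV. \<Sum>c\<in>UNIV. Gam a i c z * Gam c j b z * H b m z) = N i j a m" for i j
      unfolding N_def by ((rule sum_pull, rule sum.cong[OF refl])+, simp only: mult_ac)
    then show ?thesis
      unfolding KH_def Kc_def P_def
      by (simp add: algebra_simps sum.distrib sum_subtractf sum_distribs)
  qed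
  have "D j (D i (H a m)) z = D i (D j (H a m)) z"
    using z by (intro dir_deriv_commute') auto
  then show ?thesis
    unfolding KH DDH DE using M[of a m] M[of m a] by simp
qed

text \<open>\<open>B m i j\<close> is the matrix \<open>D m K + [\<Gamma>_m, K]\<close> with
  \<open>K = Kc i j\<close>. Expanded in Christoffel symbols and their derivatives, everything
  cancels in the cyclic sum: second derivatives because they commute, the cubic terms
  \<open>T\<close> as in the Jacobi identity. Connection terms acting on \<open>m\<close>,
  \<open>i\<close>, \<open>j\<close> are left out of \<open>B\<close>, as they would cancel in the
  sum by the symmetry of the Christoffel symbols.\<close>

lemma second_bianchi:
  assumes z: "z \<in> W"
  defines "B \<equiv> \<lambda>m i j a b. D m (Kc i j a b) z
    + (\<Sum>c\<in>UNIV. Gam a m c z * Kc i j c b z) - (\<Sum>c\<in>UNIV. Kc i j a c z * Gam c m b z)"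
  shows "B m i j a b + B i j m a b + B j m i a b = 0"
proof -
  define T where "T m i j = (\<Sum>c\<in>UNIV. \<Sum>e\<in>UNIV. Gam a m c z * (Gam c i e z * Gam e j b z))" for m i j
  define Q where "Q m i j = (\<Sum>c\<in>UNIV. Gam a i c z * D m (Gam c j b) z)" for m i j
  define R where "R m i j = (\<Sum>c\<in>UNIV. D m (Gam a i c) z * Gam c j b z)" for m i j
  have 1: "D m (Kc i j a b) z = D m (D i (Gam a j b)) z - D m (D j (Gam a i b)) z
      + (R m i j + Q m i j - R m j i - Q m j i)" for m i j
    unfolding Kc_def[abs_def] R_def Q_def using z
    by (simp add: dds sum.distrib sum_subtractf)
  have 2: "(\<Sum>c\<in>UNIV. Gam a m c z * Kc i j c b z) = Q i m j - Q j m i + T m i j - T m j i" for m i j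
    unfolding Kc_def T_def Q_def
    by (simp add: algebra_simps sum.distrib sum_subtractf sum_distrib_left)
  have "(\<Sum>c\<in>UNIV. (\<Sum>e\<in>UNIV. Gam a i e z * Gam e j c z) * Gam c m b z) = T i j m" for m i j
    unfolding T_def sum_distribs by ((rule sum_pull, rule sum.cong[OF refl])+, simp only: mult_ac)
  then have 3: "(\<Sum>c\<in>UNIV. Kc i j a c z * Gam c m b z) = R i j m - R j i m + T i j m - T j i m" for m i j
    unfolding Kc_def R_def
    by (simp add: algebra_simps sum.distrib sum_subtractf)
  have 4: "D m (D i (Gam a j b)) z = D i (D m (Gam a j b)) z" for m i j
    using z by (intro dir_deriv_commute') auto
  show ?thesis
    unfolding B_def 1 2 3 using 4[of m i j] 4[of i j m] 4[of j m i] by simp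
qed

end

text \<open>Symmetry of the Ricci tensor is assumed at this stage and costs nothing in the end:
  under the flow it is inherited from the time derivative of the symmetric matrix
  \<open>G\<close>.\<close>

locale ricci_symmetric_chart = metric_chart W G H
  for W :: "(real \<times> (real^'n::finite)) set" and G H +
  assumes Rc_sym: "z \<in> W \<Longrightarrow> Rc i j z = Rc j i z"
begin

definition Rup :: "'n \<Rightarrow> 'n \<Rightarrow> real \<times> (real^'n) \<Rightarrow> real" where
  "Rup j i z = (\<Sum>b\<in>UNIV. Rc b j z * H b i z)"

section \<open>Contractions of the curvature and the contracted Bianchi identity\<close>

lemma KH_trace1:
  assumes z: "z \<in> W"
  shows "(\<Sum>a\<in>UNIV. KH a j a m z) = Rup j m z"
proof -
  have "(\<Sum>a\<in>UNIV. KH a j a m z) = (\<Sum>b\<in>UNIV. (\<Sum>a\<in>UNIV. Kc a j a b z) * H b m z)"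
    unfolding KH_def sum_distribs by (rule sum.swap)
  then show ?thesis by (simp add: Rup_def Rc_Kc[OF z])
qed

text \<open>Exchanging the indices within both pairs costs two signs and turns this contraction into
  the one of \<open>KH_trace1\<close>.\<close>

lemma KH_trace2:
  assumes z: "z \<in> W"
  shows "(\<Sum>m\<in>UNIV. KH j m i m z) = Rup j i z"
  unfolding KH_trace1[OF z, symmetric]
  using KH_antisym1 KH_antisym2[OF z] by (intro sum.cong refl) (metis minus_minus)

text \<open>The next three lemmas trace the three terms of the cyclic sum. The first two traces agree and
  the third is \<open>- H\<^sup>l\<^sup>m \<partial>\<^sub>j Ric\<^sub>l\<^sub>m\<close>; the terms with a Christoffel symbol either cancel or contract a
  symmetric with an antisymmetric pair of indices.\<close>

lemma bianchi_trace1: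
  assumes z: "z \<in> W"
  shows "(\<Sum>l\<in>UNIV. \<Sum>m\<in>UNIV. H l m z * (\<Sum>i\<in>UNIV. D m (Kc i j i l) z
      + (\<Sum>c\<in>UNIV. Gam i m c z * Kc i j c l z) - (\<Sum>c\<in>UNIV. Kc i j i c z * Gam c m l z)))
    = (\<Sum>l\<in>UNIV. \<Sum>m\<in>UNIV. H l m z * D m (Rc l j) z)
      - (\<Sum>l\<in>UNIV. \<Sum>m\<in>UNIV. \<Sum>b\<in>UNIV. H l m z * (Gam b m l z * Rc b j z))"
proof -
  have 1: "(\<Sum>i\<in>UNIV. D m (Kc i j i l) z) = D m (Rc l j) z" for m l
  proof -
    have "D m (Rc l j) z = D m (\<lambda>z. \<Sum>k\<in>UNIV. Kc k j k l z) z"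
      by (rule dir_deriv_cong[OF z Rc_Kc])
    then show ?thesis using z by (simp add: dds)
  qed
  have 2: "(\<Sum>i\<in>UNIV. \<Sum>c\<in>UNIV. Kc i j i c z * Gam c m l z) = (\<Sum>b\<in>UNIV. Gam b m l z * Rc b j z)" for m l
    unfolding Rc_Kc[OF z] sum_distribs by ((rule sum_pull, rule sum.cong[OF refl])+, simp only: mult_ac)
  have "(\<Sum>l\<in>UNIV. \<Sum>m\<in>UNIV. \<Sum>i\<in>UNIV. \<Sum>c\<in>UNIV. H l m z * (Gam i m c z * Kc i j c l z))
     = (\<Sum>i\<in>UNIV. \<Sum>m\<in>UNIV. \<Sum>c\<in>UNIV. Gam i m c z * KH i j c m z)"
    unfolding KH_def sum_distribs by ((rule sum_pull, rule sum.cong[OF refl])+, simp only: mult_ac)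
  also have "\<dots> = 0"
    using sum_sym_antisym[of "\<lambda>m c. Gam i m c z" "\<lambda>m c. KH i j c m z" for i, OF Gam_sym[OF z] KH_antisym2[OF z]]
    by simp
  finally have 3: "(\<Sum>l\<in>UNIV. \<Sum>m\<in>UNIV. \<Sum>i\<in>UNIV. \<Sum>c\<in>UNIV. H l m z * (Gam i m c z * Kc i j c l z)) = 0"
    by simp
  then show ?thesis
    using 2 by (simp add: sum.distrib sum_subtractf 1 distrib_left right_diff_distrib sum_distrib_left)
qed

lemma bianchi_trace3:
  assumes z: "z \<in> W"
  shows "(\<Sum>l\<in>UNIV. \<Sum>m\<in>UNIV. H l m z * (\<Sum>i\<in>UNIV. D j (Kc m i i l) z
      + (\<Sum>c\<in>UNIV. Gam i j c z * Kc m i c l z) - (\<Sum>c\<in>UNIV. Kc m i i c z * Gam c j l z)))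
    = - (\<Sum>l\<in>UNIV. \<Sum>m\<in>UNIV. H l m z * D j (Rc l m) z)"
proof -
  have K: "(\<Sum>i\<in>UNIV. Kc m i i l x) = - Rc l m x" if "x \<in> W" for m l x
    unfolding Rc_Kc[OF that] using Kc_antisym[of m] by (simp add: sum_negf)
  have 1: "(\<Sum>i\<in>UNIV. D j (Kc m i i l) z) = - D j (Rc l m) z" for m l
  proof -
    have "D j (\<lambda>z. \<Sum>k\<in>UNIV. Kc m k k l z) z = D j (\<lambda>z. - Rc l m z) z"
      by (rule dir_deriv_cong[OF z K])
    then show ?thesis using z by (simp add: dds)
  qed
  have 2: "(\<Sum>i\<in>UNIV. \<Sum>c\<in>UNIV. Kc m i i c z * Gam c j l z) = - (\<Sum>c\<in>UNIV. Rc c m z * Gam c j l z)" for m l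
  proof -
    have "(\<Sum>i\<in>UNIV. \<Sum>c\<in>UNIV. Kc m i i c z * Gam c j l z)
        = (\<Sum>c\<in>UNIV. (\<Sum>i\<in>UNIV. Kc m i i c z) * Gam c j l z)"
      unfolding sum_distribs by (rule sum.swap)
    then show ?thesis by (simp add: K[OF z] sum_negf)
  qed
  have "(\<Sum>l\<in>UNIV. \<Sum>m\<in>UNIV. \<Sum>i\<in>UNIV. \<Sum>c\<in>UNIV. H l m z * (Gam i j c z * Kc m i c l z))
     = (\<Sum>i\<in>UNIV. \<Sum>c\<in>UNIV. Gam i j c z * (\<Sum>m\<in>UNIV. KH m i c m z))"
    unfolding KH_def sum_distribs by ((rule sum_pull, rule sum.cong[OF refl])+, simp only: mult_ac)
  also have "\<dots> = (\<Sum>i\<in>UNIV. \<Sum>c\<in>UNIV. Gam i j c z * - (\<Sum>m\<in>UNIV. KH i m c m z))"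
    unfolding sum_negf[symmetric] using KH_antisym1 by (intro sum.cong refl arg_cong2[of _ _ _ _ "(*)"]) metis
  also have "\<dots> = - (\<Sum>i\<in>UNIV. \<Sum>c\<in>UNIV. Gam i j c z * (\<Sum>b\<in>UNIV. Rc b i z * H b c z))"
    unfolding KH_trace2[OF z] Rup_def by (simp add: sum_negf)
  also have "(\<Sum>i\<in>UNIV. \<Sum>c\<in>UNIV. Gam i j c z * (\<Sum>b\<in>UNIV. Rc b i z * H b c z)) =
      (\<Sum>l\<in>UNIV. \<Sum>m\<in>UNIV. H l m z * (\<Sum>c\<in>UNIV. Rc c m z * Gam c j l z))"
    unfolding sum_distribs
    by ((rule sum_pull, rule sum.cong[OF refl])+, use H_sym[OF z] Rc_sym[OF z] in \<open>simp add: mult_ac\<close>)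
  finally show ?thesis
    by (simp add: sum.distrib sum_subtractf 1 2 distrib_left right_diff_distrib sum_distrib_left sum_negf)
qed

lemma bianchi_trace2:
  assumes z: "z \<in> W"
  shows "(\<Sum>l\<in>UNIV. \<Sum>m\<in>UNIV. H l m z * (\<Sum>i\<in>UNIV. D i (Kc j m i l) z
      + (\<Sum>c\<in>UNIV. Gam i i c z * Kc j m c l z) - (\<Sum>c\<in>UNIV. Kc j m i c z * Gam c i l z)))
    = (\<Sum>l\<in>UNIV. \<Sum>m\<in>UNIV. H l m z * D m (Rc l j) z)
      - (\<Sum>l\<in>UNIV. \<Sum>m\<in>UNIV. \<Sum>b\<in>UNIV. H l m z * (Gam b m l z * Rc b j z))"
proof -
  \<comment> \<open>The divergence of \<open>Rup\<close> is expanded twice, here through the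
    contraction of \<open>KH\<close> and in fact 6 from the definition of \<open>Rup\<close>;
    equating the two converts the trace of derivatives of \<open>Kc\<close> into one of derivatives
    of \<open>Rc\<close>.\<close>
  have "D i (Rup j i) z = D i (\<lambda>z. \<Sum>m\<in>UNIV. KH j m i m z) z" for i
    by (rule dir_deriv_cong[OF z]) (simp add: KH_trace2)
  also have "D i (\<lambda>z. \<Sum>m\<in>UNIV. KH j m i m z) z =
      (\<Sum>m\<in>UNIV. \<Sum>b\<in>UNIV. D i (Kc j m i b) z * H b m z)
      - (\<Sum>m\<in>UNIV. \<Sum>b\<in>UNIV. \<Sum>l\<in>UNIV. Kc j m i b z * (Gam b i l z * H l m z))
      - (\<Sum>m\<in>UNIV. \<Sum>b\<in>UNIV. \<Sum>l\<in>UNIV. Kc j m i b z * (Gam m i l z * H l b z))" for i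
    unfolding KH_def[abs_def] using z
    by (simp add: dds D_H[OF z] sum.distrib sum_subtractf right_diff_distrib sum_distrib_left sum_negf)
  finally have 1: "(\<Sum>i\<in>UNIV. D i (Rup j i) z) =
      (\<Sum>i\<in>UNIV. \<Sum>m\<in>UNIV. \<Sum>b\<in>UNIV. D i (Kc j m i b) z * H b m z)
      - (\<Sum>i\<in>UNIV. \<Sum>m\<in>UNIV. \<Sum>b\<in>UNIV. \<Sum>l\<in>UNIV. Kc j m i b z * (Gam b i l z * H l m z))
      - (\<Sum>i\<in>UNIV. \<Sum>m\<in>UNIV. \<Sum>b\<in>UNIV. \<Sum>l\<in>UNIV. Kc j m i b z * (Gam m i l z * H l b z))"
    by (simp add: sum_subtractf)
  have "(\<Sum>i\<in>UNIV. \<Sum>m\<in>UNIV. \<Sum>b\<in>UNIV. \<Sum>l\<in>UNIV. Kc j m i b z * (Gam m i l z * H l b z))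
      = (\<Sum>m\<in>UNIV. \<Sum>i\<in>UNIV. \<Sum>l\<in>UNIV. Gam m i l z * KH j m i l z)"
    unfolding KH_def sum_distribs
    by ((rule sum_pull, rule sum.cong[OF refl])+, use H_sym[OF z] in \<open>simp add: mult_ac\<close>)
  also have "\<dots> = 0"
    using sum_sym_antisym[of "\<lambda>i l. Gam m i l z" "\<lambda>i l. KH j m i l z" for m, OF Gam_sym[OF z] KH_antisym2[OF z]]
    by simp
  finally have 2: "(\<Sum>i\<in>UNIV. \<Sum>m\<in>UNIV. \<Sum>b\<in>UNIV. \<Sum>l\<in>UNIV. Kc j m i b z * (Gam m i l z * H l b z)) = 0"
    by simp
  have 3: "(\<Sum>l\<in>UNIV. \<Sum>m\<in>UNIV. \<Sum>i\<in>UNIV. \<Sum>c\<in>UNIV. H l m z * (Gam i i c z * Kc j m c l z))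
      = (\<Sum>i\<in>UNIV. \<Sum>c\<in>UNIV. Gam i i c z * (\<Sum>m\<in>UNIV. KH j m c m z))"
    unfolding KH_def sum_distribs by ((rule sum_pull, rule sum.cong[OF refl])+, simp only: mult_ac)
  have 4: "(\<Sum>l\<in>UNIV. \<Sum>m\<in>UNIV. \<Sum>i\<in>UNIV. H l m z * D i (Kc j m i l) z) =
      (\<Sum>i\<in>UNIV. \<Sum>m\<in>UNIV. \<Sum>b\<in>UNIV. D i (Kc j m i b) z * H b m z)"
    by ((rule sum_pull, rule sum.cong[OF refl])+, simp only: mult_ac)
  have 5: "(\<Sum>l\<in>UNIV. \<Sum>m\<in>UNIV. \<Sum>i\<in>UNIV. \<Sum>c\<in>UNIV. H l m z * (Kc j m i c z * Gam c i l z))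
      = (\<Sum>i\<in>UNIV. \<Sum>m\<in>UNIV. \<Sum>b\<in>UNIV. \<Sum>l\<in>UNIV. Kc j m i b z * (Gam b i l z * H l m z))"
    by ((rule sum_pull, rule sum.cong[OF refl])+, simp only: mult_ac)
  have 6: "(\<Sum>i\<in>UNIV. D i (Rup j i) z) = (\<Sum>i\<in>UNIV. \<Sum>b\<in>UNIV. D i (Rc b j) z * H b i z)
      - (\<Sum>i\<in>UNIV. \<Sum>b\<in>UNIV. \<Sum>l\<in>UNIV. Rc b j z * (Gam b i l z * H l i z))
      - (\<Sum>i\<in>UNIV. \<Sum>b\<in>UNIV. \<Sum>l\<in>UNIV. Rc b j z * (Gam i i l z * H l b z))"
    unfolding Rup_def[abs_def] using z
    by (simp add: dds D_H[OF z] sum.distrib sum_subtractf right_diff_distrib sum_distrib_left sum_negf)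
  have 7: "(\<Sum>i\<in>UNIV. \<Sum>b\<in>UNIV. \<Sum>l\<in>UNIV. Rc b j z * (Gam i i l z * H l b z))
      = (\<Sum>i\<in>UNIV. \<Sum>c\<in>UNIV. Gam i i c z * Rup j c z)"
    unfolding Rup_def sum_distribs
    by ((rule sum_pull, rule sum.cong[OF refl])+, use H_sym[OF z] in \<open>simp add: mult_ac\<close>)
  have 8: "(\<Sum>i\<in>UNIV. \<Sum>b\<in>UNIV. \<Sum>l\<in>UNIV. Rc b j z * (Gam b i l z * H l i z))
      = (\<Sum>l\<in>UNIV. \<Sum>m\<in>UNIV. \<Sum>b\<in>UNIV. H l m z * (Gam b m l z * Rc b j z))"
    by ((rule sum_pull, rule sum.cong[OF refl])+, simp only: mult_ac)
  have 9: "(\<Sum>i\<in>UNIV. \<Sum>b\<in>UNIV. D i (Rc b j) z * H b i z) = (\<Sum>l\<in>UNIV. \<Sum>m\<in>UNIV. H l m z * D m (Rc l j) z)"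
    by ((rule sum_pull, rule sum.cong[OF refl])+, simp only: mult_ac)
  have "(\<Sum>l\<in>UNIV. \<Sum>m\<in>UNIV. H l m z * (\<Sum>i\<in>UNIV. D i (Kc j m i l) z
      + (\<Sum>c\<in>UNIV. Gam i i c z * Kc j m c l z) - (\<Sum>c\<in>UNIV. Kc j m i c z * Gam c i l z)))
    = (\<Sum>i\<in>UNIV. D i (Rup j i) z) + (\<Sum>i\<in>UNIV. \<Sum>c\<in>UNIV. Gam i i c z * Rup j c z)"
    unfolding 1 2 using 3 4 5
    by (simp add: sum.distrib sum_subtractf distrib_left right_diff_distrib sum_distrib_left KH_trace2[OF z])
  then show ?thesis unfolding 6 7 8 9 by simp
qed

text \<open>This is dR = 2 div Ric freed of covariant derivatives: the Christoffel symbols with the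
  lower index \<open>j\<close> contribute the same amount to both sides and have been dropped. It
  results from the cyclic sum \<open>second_bianchi\<close> by setting the upper index equal to
  \<open>i\<close> and contracting \<open>l\<close> and \<open>m\<close> with
  \<open>H\<close>.\<close>

lemma contracted_bianchi:
  assumes z: "z \<in> W"
  shows "(\<Sum>l\<in>UNIV. \<Sum>m\<in>UNIV. H l m z * D j (Rc l m) z)
    = 2 * ((\<Sum>l\<in>UNIV. \<Sum>m\<in>UNIV. H l m z * D m (Rc l j) z)
      - (\<Sum>l\<in>UNIV. \<Sum>m\<in>UNIV. \<Sum>b\<in>UNIV. H l m z * (Gam b m l z * Rc b j z)))"
proof -
  define B where "B m i j a b = D m (Kc i j a b) z
    + (\<Sum>c\<in>UNIV. Gam a m c z * Kc i j c b z) - (\<Sum>c\<in>UNIV. Kc i j a c z * Gam c m b z)" for m i j a b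
  have "B m i j i l + B i j m i l + B j m i i l = 0" for m i l
    unfolding B_def by (rule second_bianchi[OF z])
  then have "0 = (\<Sum>l\<in>UNIV. \<Sum>m\<in>UNIV. H l m z * (\<Sum>i\<in>UNIV. B m i j i l + B i j m i l + B j m i i l))"
    by simp
  also have "\<dots> = (\<Sum>l\<in>UNIV. \<Sum>m\<in>UNIV. H l m z * (\<Sum>i\<in>UNIV. B m i j i l))
      + (\<Sum>l\<in>UNIV. \<Sum>m\<in>UNIV. H l m z * (\<Sum>i\<in>UNIV. B i j m i l))
      + (\<Sum>l\<in>UNIV. \<Sum>m\<in>UNIV. H l m z * (\<Sum>i\<in>UNIV. B j m i i l))"
    by (simp add: sum.distrib distrib_left)
  finally show ?thesis
    unfolding B_def bianchi_trace1[OF z] bianchi_trace2[OF z] bianchi_trace3[OF z] by simp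
qed

end

section \<open>Evolution equations under the Ricci flow\<close>

locale ricci_flow_chart = metric_chart W G H
  for W :: "(real \<times> (real^'n::finite)) set" and G H +
  assumes flow: "z \<in> W \<Longrightarrow> Dt (G i j) z = - 2 * Rc i j z"

sublocale ricci_flow_chart \<subseteq> ricci_symmetric_chart
proof unfold_locales
  fix z i j assume z: "z \<in> W"
  show "Rc i j z = Rc j i z"
    using dir_deriv_G_sym[OF z, of "(1, 0)" i j] by (simp add: flow[OF z])
qed

section \<open>Hessian, third covariant derivatives and the Bochner formula\<close>

context metric_chart
begin

text \<open>\<open>Hs\<close> is the Hessian, \<open>vup\<close> the gradient with its index raised, \<open>gsq\<close> its squared norm and
  \<open>inner2\<close> the inner product of 2-tensors.\<close>

definition Hs :: "(real \<times> (real^'n) \<Rightarrow> real) \<Rightarrow> 'n \<Rightarrow> 'n \<Rightarrow> real \<times> (real^'n) \<Rightarrow> real" where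
  "Hs f i j z = D i (D j f) z - (\<Sum>k\<in>UNIV. Gam k i j z * D k f z)"

definition Lap :: "(real \<times> (real^'n) \<Rightarrow> real) \<Rightarrow> real \<times> (real^'n) \<Rightarrow> real" where
  "Lap f z = (\<Sum>i\<in>UNIV. \<Sum>j\<in>UNIV. H i j z * Hs f i j z)"

definition vup :: "(real \<times> (real^'n) \<Rightarrow> real) \<Rightarrow> 'n \<Rightarrow> real \<times> (real^'n) \<Rightarrow> real" where
  "vup f i z = (\<Sum>j\<in>UNIV. H i j z * D j f z)"

definition gsq :: "(real \<times> (real^'n) \<Rightarrow> real) \<Rightarrow> real \<times> (real^'n) \<Rightarrow> real" where
  "gsq f z = (\<Sum>i\<in>UNIV. vup f i z * D i f z)"

definition inner2 :: "real \<times> (real^'n) \<Rightarrow> ('n \<Rightarrow> 'n \<Rightarrow> real) \<Rightarrow> ('n \<Rightarrow> 'n \<Rightarrow> real) \<Rightarrow> real" where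
  "inner2 z S T = (\<Sum>i\<in>UNIV. \<Sum>j\<in>UNIV. \<Sum>a\<in>UNIV. \<Sum>b\<in>UNIV. H i a z * (H j b z * (S i j * T a b)))"

lemma smooth_Hs [smooth_intros, simp]: "smooth_on W f \<Longrightarrow> smooth_on W (Hs f i j)"
  unfolding Hs_def[abs_def] by (intro smooth_intros)

lemma smooth_Lap [smooth_intros, simp]: "smooth_on W f \<Longrightarrow> smooth_on W (Lap f)"
  unfolding Lap_def[abs_def] by (intro smooth_intros)

lemma smooth_vup [smooth_intros, simp]: "smooth_on W f \<Longrightarrow> smooth_on W (vup f i)"
  unfolding vup_def[abs_def] by (intro smooth_intros)

lemma smooth_gsq [smooth_intros, simp]: "smooth_on W f \<Longrightarrow> smooth_on W (gsq f)"
  unfolding gsq_def[abs_def] by (intro smooth_intros)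

lemma Hs_sym: "smooth_on W f \<Longrightarrow> z \<in> W \<Longrightarrow> Hs f i j z = Hs f j i z"
  unfolding Hs_def using dir_deriv_commute' Gam_sym by simp

lemma dir_deriv_Hs_sym: "smooth_on W f \<Longrightarrow> z \<in> W \<Longrightarrow> dir_deriv v (Hs f i j) z = dir_deriv v (Hs f j i) z"
  by (rule dir_deriv_cong) (auto simp: Hs_sym)

text \<open>Up to the connection term, moved to the right, this is \<nabla>_k \<nabla>^i f = g^{ij}
  \<nabla>_k \<nabla>_j f: raising an index commutes with covariant differentiation by
  \<open>D_H\<close>.\<close>

lemma D_vup:
  assumes f: "smooth_on W f" and z: "z \<in> W"
  shows "D k (vup f i) z = (\<Sum>j\<in>UNIV. H i j z * Hs f k j z) - (\<Sum>l\<in>UNIV. Gam i k l z * vup f l z)"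
proof -
  have 1: "(\<Sum>j\<in>UNIV. \<Sum>l\<in>UNIV. Gam i k l z * H l j z * D j f z) = (\<Sum>l\<in>UNIV. Gam i k l z * vup f l z)"
    unfolding vup_def sum_distribs by ((rule sum_pull, rule sum.cong[OF refl])+, simp only: mult_ac)
  have 2: "(\<Sum>j\<in>UNIV. \<Sum>l\<in>UNIV. Gam j k l z * H l i z * D j f z) =
      (\<Sum>j\<in>UNIV. \<Sum>l\<in>UNIV. H i j z * (Gam l k j z * D l f z))"
    by ((rule sum_pull, rule sum.cong[OF refl])+, use H_sym[OF z] in \<open>simp add: mult_ac\<close>)
  have "D k (vup f i) z = (\<Sum>j\<in>UNIV. D k (H i j) z * D j f z + H i j z * D k (D j f) z)"
    unfolding vup_def[abs_def] using f z by (simp add: dds)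
  also have "\<dots> = - (\<Sum>j\<in>UNIV. \<Sum>l\<in>UNIV. Gam i k l z * H l j z * D j f z)
      - (\<Sum>j\<in>UNIV. \<Sum>l\<in>UNIV. Gam j k l z * H l i z * D j f z)
      + (\<Sum>j\<in>UNIV. H i j z * D k (D j f) z)"
    unfolding D_H[OF z]
    by (simp add: sum.distrib sum_subtractf left_diff_distrib distrib_right sum_distrib_right sum_negf)
  finally show ?thesis
    unfolding 1 2 Hs_def by (simp add: sum_subtractf right_diff_distrib sum_distrib_left)
qed

lemma D_gsq:
  assumes f: "smooth_on W f" and z: "z \<in> W"
  shows "D k (gsq f) z = 2 * (\<Sum>i\<in>UNIV. Hs f k i z * vup f i z)"
proof -
  have 1: "(\<Sum>i\<in>UNIV. \<Sum>j\<in>UNIV. H i j z * Hs f k j z * D i f z) = (\<Sum>i\<in>UNIV. Hs f k i z * vup f i z)"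
    unfolding vup_def sum_distribs
    by ((rule sum_pull, rule sum.cong[OF refl])+, use H_sym[OF z] in \<open>simp add: mult_ac\<close>)
  have 2: "(\<Sum>i\<in>UNIV. \<Sum>l\<in>UNIV. Gam i k l z * vup f l z * D i f z) =
      (\<Sum>i\<in>UNIV. (\<Sum>l\<in>UNIV. Gam l k i z * D l f z) * vup f i z)"
    unfolding sum_distribs by ((rule sum_pull, rule sum.cong[OF refl])+, simp only: mult_ac)
  have "D k (gsq f) z = (\<Sum>i\<in>UNIV. D k (vup f i) z * D i f z + vup f i z * D k (D i f) z)"
    unfolding gsq_def[abs_def] using f z by (simp add: dds)
  also have "\<dots> = (\<Sum>i\<in>UNIV. \<Sum>j\<in>UNIV. H i j z * Hs f k j z * D i f z)
      - (\<Sum>i\<in>UNIV. \<Sum>l\<in>UNIV. Gam i k l z * vup f l z * D i f z)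
      + (\<Sum>i\<in>UNIV. D k (D i f) z * vup f i z)"
    unfolding D_vup[OF f z]
    by (simp add: sum.distrib sum_subtractf right_diff_distrib sum_distrib_left mult_ac)
  also have "\<dots> = 2 * (\<Sum>i\<in>UNIV. Hs f k i z * vup f i z)"
    unfolding 1 2 by (simp add: Hs_def sum_subtractf left_diff_distrib)
  finally show ?thesis .
qed

text \<open>\<open>N f l k i\<close> is the third covariant derivative \<open>\<nabla>\<^sub>l\<nabla>\<^sub>k\<nabla>\<^sub>i f\<close>.\<close>

definition N :: "(real \<times> (real^'n) \<Rightarrow> real) \<Rightarrow> 'n \<Rightarrow> 'n \<Rightarrow> 'n \<Rightarrow> real \<times> (real^'n) \<Rightarrow> real" where
  "N f l k i z = D l (Hs f k i) z - (\<Sum>m\<in>UNIV. Gam m l k z * Hs f m i z)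
    - (\<Sum>p\<in>UNIV. Gam p l i z * Hs f k p z)"

lemma N_sym: "smooth_on W f \<Longrightarrow> z \<in> W \<Longrightarrow> N f l k i z = N f l i k z"
  unfolding N_def using Hs_sym[of f z] dir_deriv_Hs_sym[of f z _ k i] by simp

text \<open>Third and second derivatives of \<open>f\<close> cancel in the commutator, because
  partial derivatives commute and the Christoffel symbols are symmetric; the coefficients left in
  front of \<open>D m f\<close> are those that define \<open>Kc\<close>.\<close>

lemma ricci_identity:
  assumes f: "smooth_on W f" and z: "z \<in> W"
  shows "N f l i k z - N f i l k z = - (\<Sum>m\<in>UNIV. Kc l i m k z * D m f z)"
proof -
  have 1: "D l (Hs f i k) z = D l (D i (D k f)) z
      - (\<Sum>m\<in>UNIV. D l (Gam m i k) z * D m f z) - (\<Sum>m\<in>UNIV. Gam m i k z * D l (D m f) z)" for l i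
    unfolding Hs_def[abs_def] using f z by (simp add: dds sum.distrib)
  have 2: "(\<Sum>p\<in>UNIV. Gam p l k z * Hs f i p z) = (\<Sum>m\<in>UNIV. Gam m l k z * D i (D m f) z)
      - (\<Sum>m\<in>UNIV. \<Sum>p\<in>UNIV. Gam m i p z * Gam p l k z * D m f z)" for l i
  proof -
    have "(\<Sum>p\<in>UNIV. \<Sum>m\<in>UNIV. Gam p l k z * (Gam m i p z * D m f z)) =
       (\<Sum>m\<in>UNIV. \<Sum>p\<in>UNIV. Gam m i p z * Gam p l k z * D m f z)"
      by ((rule sum_pull, rule sum.cong[OF refl])+, simp only: mult_ac)
    then show ?thesis
      by (simp add: Hs_def right_diff_distrib sum_subtractf sum_distrib_left)
  qed
  have 3: "D l (D i (D k f)) z = D i (D l (D k f)) z"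
    using f z by (intro dir_deriv_commute') auto
  have "(\<Sum>m\<in>UNIV. Gam m l i z * Hs f m k z) = (\<Sum>m\<in>UNIV. Gam m i l z * Hs f m k z)"
    using Gam_sym[OF z] by simp
  then show ?thesis
    unfolding N_def 1 2 3 Kc_def
    by (simp add: left_diff_distrib distrib_right sum.distrib sum_subtractf sum_distrib_right)
qed

text \<open>As \<nabla>g^{-1} = 0, the trace over the last two indices passes through the
  differentiation in \<open>i\<close>. The Bochner formula calls for the trace over the first two,
  which is \<open>H_N'\<close>.\<close>

lemma H_N:
  assumes f: "smooth_on W f" and z: "z \<in> W"
  shows "(\<Sum>l\<in>UNIV. \<Sum>k\<in>UNIV. H l k z * N f i l k z) = D i (Lap f) z"
proof -
  have 1: "(\<Sum>l\<in>UNIV. \<Sum>k\<in>UNIV. \<Sum>p\<in>UNIV. Gam l i p z * H p k z * Hs f l k z) =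
      (\<Sum>l\<in>UNIV. \<Sum>k\<in>UNIV. \<Sum>m\<in>UNIV. H l k z * (Gam m i l z * Hs f m k z))"
    by ((rule sum_pull, rule sum.cong[OF refl])+, simp only: mult_ac)
  have 2: "(\<Sum>l\<in>UNIV. \<Sum>k\<in>UNIV. \<Sum>p\<in>UNIV. Gam k i p z * H p l z * Hs f l k z) =
      (\<Sum>l\<in>UNIV. \<Sum>k\<in>UNIV. \<Sum>p\<in>UNIV. H l k z * (Gam p i k z * Hs f l p z))"
    by ((rule sum_pull, rule sum.cong[OF refl])+, use H_sym[OF z] in \<open>simp add: mult_ac\<close>)
  have "D i (Lap f) z = (\<Sum>l\<in>UNIV. \<Sum>k\<in>UNIV. D i (H l k) z * Hs f l k z + H l k z * D i (Hs f l k) z)"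
    unfolding Lap_def[abs_def] using f z by (simp add: dds)
  also have "\<dots> = (\<Sum>l\<in>UNIV. \<Sum>k\<in>UNIV. H l k z * D i (Hs f l k) z)
      - (\<Sum>l\<in>UNIV. \<Sum>k\<in>UNIV. \<Sum>p\<in>UNIV. Gam l i p z * H p k z * Hs f l k z)
      - (\<Sum>l\<in>UNIV. \<Sum>k\<in>UNIV. \<Sum>p\<in>UNIV. Gam k i p z * H p l z * Hs f l k z)"
    unfolding D_H[OF z]
    by (simp add: sum.distrib sum_subtractf left_diff_distrib distrib_right sum_distrib_right sum_negf)
  also have "\<dots> = (\<Sum>l\<in>UNIV. \<Sum>k\<in>UNIV. H l k z * N f i l k z)"
    unfolding 1 2 N_def
    by (simp add: sum_subtractf right_diff_distrib sum_distrib_left)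
  finally show ?thesis by simp
qed

lemma Hs_gsq:
  assumes f: "smooth_on W f" and z: "z \<in> W"
  shows "Hs (gsq f) l k z = 2 * (\<Sum>i\<in>UNIV. vup f i z * N f l k i z)
    + 2 * (\<Sum>i\<in>UNIV. \<Sum>j\<in>UNIV. Hs f k i z * (H i j z * Hs f l j z))"
proof -
  have "D l (D k (gsq f)) z = D l (\<lambda>z. 2 * (\<Sum>i\<in>UNIV. Hs f k i z * vup f i z)) z"
    by (rule dir_deriv_cong[OF z D_gsq[OF f]])
  also have "\<dots> = 2 * (\<Sum>i\<in>UNIV. vup f i z * D l (Hs f k i) z)
      + 2 * (\<Sum>i\<in>UNIV. \<Sum>j\<in>UNIV. Hs f k i z * (H i j z * Hs f l j z))
      - 2 * (\<Sum>i\<in>UNIV. \<Sum>p\<in>UNIV. Hs f k i z * (Gam i l p z * vup f p z))"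
    using f z
    by (simp add: dds D_vup right_diff_distrib sum.distrib sum_subtractf sum_distrib_left mult_ac)
  also have "(\<Sum>i\<in>UNIV. \<Sum>p\<in>UNIV. Hs f k i z * (Gam i l p z * vup f p z)) =
      (\<Sum>i\<in>UNIV. \<Sum>p\<in>UNIV. vup f i z * (Gam p l i z * Hs f k p z))"
    by ((rule sum_pull, rule sum.cong[OF refl])+, simp only: mult_ac)
  finally have 1: "D l (D k (gsq f)) z = 2 * (\<Sum>i\<in>UNIV. vup f i z * D l (Hs f k i) z)
      + 2 * (\<Sum>i\<in>UNIV. \<Sum>j\<in>UNIV. Hs f k i z * (H i j z * Hs f l j z))
      - 2 * (\<Sum>i\<in>UNIV. \<Sum>p\<in>UNIV. vup f i z * (Gam p l i z * Hs f k p z))" .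
  have 2: "(\<Sum>m\<in>UNIV. Gam m l k z * D m (gsq f) z) =
      2 * (\<Sum>i\<in>UNIV. \<Sum>m\<in>UNIV. vup f i z * (Gam m l k z * Hs f m i z))"
    unfolding D_gsq[OF f z] sum_distribs by ((rule sum_pull, rule sum.cong[OF refl])+, simp only: mult_ac)
  show ?thesis
    unfolding Hs_def[of "gsq f"] 1 2 N_def
    by (simp add: right_diff_distrib sum_subtractf sum_distrib_left)
qed

end

context ricci_symmetric_chart
begin

text \<open>Symmetry in the last pair and the Ricci identity move the differentiation in
  \<open>i\<close> to the front, where \<open>H_N\<close> applies; the traced curvature that this
  costs is the Ricci tensor.\<close>

lemma H_N':
  assumes f: "smooth_on W f" and z: "z \<in> W"
  shows "(\<Sum>l\<in>UNIV. \<Sum>k\<in>UNIV. H l k z * N f l k i z) =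
    D i (Lap f) z + (\<Sum>b\<in>UNIV. Rc b i z * vup f b z)"
proof -
  have 1: "N f l k i z = N f i l k z - (\<Sum>m\<in>UNIV. Kc l i m k z * D m f z)" for l k
    using ricci_identity[OF f z, of l i k] N_sym[OF f z, of l k i] by simp
  have "(\<Sum>l\<in>UNIV. \<Sum>k\<in>UNIV. \<Sum>m\<in>UNIV. H l k z * (Kc l i m k z * D m f z)) =
      (\<Sum>m\<in>UNIV. (\<Sum>l\<in>UNIV. KH l i m l z) * D m f z)"
    unfolding KH_def sum_distribs
    by ((rule sum_pull, rule sum.cong[OF refl])+, use H_sym[OF z] in \<open>simp add: mult_ac\<close>)
  also have "\<dots> = (\<Sum>m\<in>UNIV. - (\<Sum>l\<in>UNIV. KH i l m l z) * D m f z)"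
    unfolding sum_negf[symmetric] using KH_antisym1 by (intro sum.cong refl arg_cong2[of _ _ _ _ "(*)"]) metis
  also have "\<dots> = - (\<Sum>m\<in>UNIV. (\<Sum>b\<in>UNIV. Rc b i z * H b m z) * D m f z)"
    unfolding KH_trace2[OF z] Rup_def by (simp add: sum_negf)
  also have "(\<Sum>m\<in>UNIV. (\<Sum>b\<in>UNIV. Rc b i z * H b m z) * D m f z) = (\<Sum>b\<in>UNIV. Rc b i z * vup f b z)"
    unfolding vup_def sum_distribs by ((rule sum_pull, rule sum.cong[OF refl])+, simp only: mult_ac)
  finally show ?thesis
    unfolding 1 H_N[OF f z, symmetric]
    by (simp add: right_diff_distrib sum_subtractf sum_distrib_left)
qed

theorem bochner:
  assumes f: "smooth_on W f" and z: "z \<in> W"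
  shows "Lap (gsq f) z = 2 * inner2 z (\<lambda>i j. Hs f i j z) (\<lambda>i j. Hs f i j z)
    + 2 * (\<Sum>i\<in>UNIV. vup f i z * D i (Lap f) z)
    + 2 * (\<Sum>i\<in>UNIV. \<Sum>j\<in>UNIV. Rc i j z * (vup f i z * vup f j z))"
proof -
  have 1: "(\<Sum>l\<in>UNIV. \<Sum>k\<in>UNIV. \<Sum>i\<in>UNIV. H l k z * (vup f i z * N f l k i z)) =
      (\<Sum>i\<in>UNIV. vup f i z * (\<Sum>l\<in>UNIV. \<Sum>k\<in>UNIV. H l k z * N f l k i z))"
    unfolding sum_distribs by ((rule sum_pull, rule sum.cong[OF refl])+, simp only: mult_ac)
  have 2: "(\<Sum>l\<in>UNIV. \<Sum>k\<in>UNIV. \<Sum>i\<in>UNIV. \<Sum>j\<in>UNIV. H l k z * (Hs f k i z * (H i j z * Hs f l j z))) =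
      inner2 z (\<lambda>i j. Hs f i j z) (\<lambda>i j. Hs f i j z)"
    unfolding inner2_def by ((rule sum_pull, rule sum.cong[OF refl])+, use H_sym[OF z] in \<open>simp add: mult_ac\<close>)
  have 3: "(\<Sum>i\<in>UNIV. \<Sum>b\<in>UNIV. vup f i z * (Rc b i z * vup f b z)) =
      (\<Sum>i\<in>UNIV. \<Sum>j\<in>UNIV. Rc i j z * (vup f i z * vup f j z))"
    by ((rule sum_pull, rule sum.cong[OF refl])+, simp only: mult_ac)
  have "Lap (gsq f) z = 2 * (\<Sum>l\<in>UNIV. \<Sum>k\<in>UNIV. \<Sum>i\<in>UNIV. H l k z * (vup f i z * N f l k i z))
    + 2 * (\<Sum>l\<in>UNIV. \<Sum>k\<in>UNIV. \<Sum>i\<in>UNIV. \<Sum>j\<in>UNIV. H l k z * (Hs f k i z * (H i j z * Hs f l j z)))"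
    unfolding Lap_def[of "gsq f"] Hs_gsq[OF f z]
    by (simp add: distrib_left sum.distrib sum_distrib_left mult_ac)
  then show ?thesis
    unfolding 1 2 H_N'[OF f z] by (simp add: distrib_left sum.distrib sum_distrib_left 3 flip: 3)
qed

end

section \<open>Time derivatives of the inverse metric, the connection, the Laplacian and R\<close>

context ricci_flow_chart
begin

lemma Dt_D_G:
  assumes z: "z \<in> W"
  shows "Dt (D i (G j l)) z = - 2 * D i (Rc j l) z"
proof -
  have "Dt (D i (G j l)) z = D i (Dt (G j l)) z"
    using z by (intro dir_deriv_commute') auto
  also have "\<dots> = D i (\<lambda>z. - 2 * Rc j l z) z"
    by (rule dir_deriv_cong[OF z flow])
  also have "\<dots> = - 2 * D i (Rc j l) z"
    using z by (simp add: dds)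
  finally show ?thesis .
qed

lemma Dt_H:
  assumes z: "z \<in> W"
  shows "Dt (H i j) z = 2 * (\<Sum>a\<in>UNIV. \<Sum>b\<in>UNIV. H i a z * (Rc a b z * H b j z))"
  unfolding dir_deriv_H[OF z] flow[OF z] by (simp add: sum_distrib_left sum_negf mult_ac)

text \<open>The right-hand side is - g^{kl} (\<nabla>_i R_jl + \<nabla>_j R_il - \<nabla>_l R_ij),
  the variation of the connection for \<partial>_t g = -2 Ric. When the covariant derivatives are
  expanded, only the Christoffel terms in \<open>Gam b i j\<close> survive; in the proof they come
  from the time derivative of \<open>H\<close>.\<close>

lemma Dt_Gam:
  assumes z: "z \<in> W"
  shows "Dt (Gam k i j) z = (\<Sum>l\<in>UNIV. H k l z * (2 * (\<Sum>b\<in>UNIV. Rc l b z * Gam b i j z)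
    - D i (Rc j l) z - D j (Rc i l) z + D l (Rc i j) z))"
proof -
  \<comment> \<open>Twice the lowered Christoffel symbol; differentiating \<open>2 * Gam\<close>
    keeps the factor 1/2 out of the computation.\<close>
  define c where "c l z = D i (G j l) z + D j (G i l) z - D l (G i j) z" for l z
  have c: "smooth_on W (c l)" for l unfolding c_def[abs_def] by simp
  have G2: "(\<Sum>l\<in>UNIV. H b l z * c l z) = 2 * Gam b i j z" for b z
    by (simp add: Gam_def c_def)
  have "2 * Dt (Gam k i j) z = Dt (\<lambda>z. 2 * Gam k i j z) z"
    using z by (simp add: dds)
  also have "\<dots> = Dt (\<lambda>z. \<Sum>l\<in>UNIV. H k l z * c l z) z"
    by (rule dir_deriv_cong[OF z]) (simp add: G2)
  also have "\<dots> = (\<Sum>l\<in>UNIV. Dt (H k l) z * c l z) + (\<Sum>l\<in>UNIV. H k l z * Dt (c l) z)"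
    using c z by (simp add: dds sum.distrib)
  also have "(\<Sum>l\<in>UNIV. Dt (H k l) z * c l z) =
      2 * (\<Sum>l\<in>UNIV. H k l z * (\<Sum>b\<in>UNIV. Rc l b z * (\<Sum>m\<in>UNIV. H b m z * c m z)))"
    unfolding Dt_H[OF z] sum_distribs by ((rule sum_pull, rule sum.cong[OF refl])+, simp only: mult_ac)
  finally have "2 * Dt (Gam k i j) z = 2 * (\<Sum>l\<in>UNIV. H k l z * (\<Sum>b\<in>UNIV. Rc l b z * (2 * Gam b i j z)))
      + (\<Sum>l\<in>UNIV. H k l z * Dt (c l) z)"
    unfolding G2 .
  moreover have "H k l z * Dt (c l) z = 2 * - (H k l z * (D i (Rc j l) z + D j (Rc i l) z - D l (Rc i j) z))" for l
    unfolding c_def[abs_def] using z by (simp add: dds Dt_D_G algebra_simps)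
  ultimately have "2 * Dt (Gam k i j) z =
      2 * (\<Sum>l\<in>UNIV. H k l z * (\<Sum>b\<in>UNIV. Rc l b z * (2 * Gam b i j z)))
      + 2 * (\<Sum>l\<in>UNIV. - (H k l z * (D i (Rc j l) z + D j (Rc i l) z - D l (Rc i j) z)))"
    by (simp only: sum_distrib_left)
  then have "Dt (Gam k i j) z = (\<Sum>l\<in>UNIV. H k l z * (\<Sum>b\<in>UNIV. Rc l b z * (2 * Gam b i j z))
      + - (H k l z * (D i (Rc j l) z + D j (Rc i l) z - D l (Rc i j) z)))"
    unfolding sum.distrib by linarith
  also have "\<dots> = (\<Sum>l\<in>UNIV. H k l z * (2 * (\<Sum>b\<in>UNIV. Rc l b z * Gam b i j z)
    - D i (Rc j l) z - D j (Rc i l) z + D l (Rc i j) z))"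
    by (intro sum.cong refl) (simp add: algebra_simps sum_distrib_left)
  finally show ?thesis .
qed

lemma Dt_Gam_sym: "z \<in> W \<Longrightarrow> Dt (Gam k i j) z = Dt (Gam k j i) z"
  by (rule dir_deriv_Gam_sym)

text \<open>The trace of \<partial>_t \<Gamma> is the vector dual to dR - 2 div Ric, which vanishes
  by \<open>contracted_bianchi\<close>. This is why \<open>Dt_Lap\<close> contains no first
  derivatives of \<open>f\<close> with curvature coefficients.\<close>

lemma H_Dt_Gam:
  assumes z: "z \<in> W"
  shows "(\<Sum>i\<in>UNIV. \<Sum>j\<in>UNIV. H i j z * Dt (Gam k i j) z) = 0"
proof -
  have R: "dir_deriv v (Rc a b) z = dir_deriv v (Rc b a) z" for v a b
    by (rule dir_deriv_cong[OF z Rc_sym])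
  have inner: "(\<Sum>i\<in>UNIV. \<Sum>j\<in>UNIV. H i j z * (2 * (\<Sum>b\<in>UNIV. Rc l b z * Gam b i j z)
    - D i (Rc j l) z - D j (Rc i l) z + D l (Rc i j) z)) = 0" for l
  proof -
    have 1: "(\<Sum>i\<in>UNIV. \<Sum>j\<in>UNIV. H i j z * D i (Rc j l) z) = (\<Sum>i\<in>UNIV. \<Sum>j\<in>UNIV. H i j z * D j (Rc i l) z)"
      by ((rule sum_pull, rule sum.cong[OF refl])+, use H_sym[OF z] in \<open>simp add: mult_ac\<close>)
    have 2: "(\<Sum>i\<in>UNIV. \<Sum>j\<in>UNIV. \<Sum>b\<in>UNIV. H i j z * (Rc l b z * Gam b i j z)) =
        (\<Sum>i\<in>UNIV. \<Sum>j\<in>UNIV. \<Sum>b\<in>UNIV. H i j z * (Gam b j i z * Rc b l z))"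
      using Rc_sym[OF z, of l] Gam_sym[OF z] by (simp add: mult_ac)
    show ?thesis
      using contracted_bianchi[OF z, of l] 1 2
      by (simp add: distrib_left right_diff_distrib sum.distrib sum_subtractf
          sum_distrib_left[symmetric] mult.left_commute[of _ 2])
  qed
  have "(\<Sum>i\<in>UNIV. \<Sum>j\<in>UNIV. H i j z * Dt (Gam k i j) z) =
    (\<Sum>l\<in>UNIV. H k l z * (\<Sum>i\<in>UNIV. \<Sum>j\<in>UNIV. H i j z * (2 * (\<Sum>b\<in>UNIV. Rc l b z * Gam b i j z)
    - D i (Rc j l) z - D j (Rc i l) z + D l (Rc i j) z)))"
    unfolding Dt_Gam[OF z] sum_distrib_left
    by ((rule sum_pull, rule sum.cong[OF refl])+, simp only: mult_ac)
  then show ?thesis unfolding inner by simp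
qed

text \<open>Conceptually \<Gamma>^k_ik = \<partial>_i ln sqrt(det g), and the logarithm of the
  volume density decreases at the rate R. The proof reads it off \<open>Dt_Gam\<close>: after
  tracing, two of the three derivatives of \<open>Rc\<close> cancel by the symmetry of
  \<open>H\<close>, and the remaining terms make up the derivative of \<open>Rs\<close>.\<close>

lemma Dt_Gam_trace:
  assumes z: "z \<in> W"
  shows "(\<Sum>k\<in>UNIV. Dt (Gam k i k) z) = - D i Rs z"
proof -
  have 1: "(\<Sum>k\<in>UNIV. \<Sum>l\<in>UNIV. H k l z * D k (Rc i l) z) = (\<Sum>k\<in>UNIV. \<Sum>l\<in>UNIV. H k l z * D l (Rc i k) z)"
    by ((rule sum_pull, rule sum.cong[OF refl])+, use H_sym[OF z] in \<open>simp add: mult_ac\<close>)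
  have 2: "(\<Sum>k\<in>UNIV. \<Sum>l\<in>UNIV. \<Sum>p\<in>UNIV. Gam k i p z * H p l z * Rc k l z) =
      (\<Sum>k\<in>UNIV. \<Sum>l\<in>UNIV. \<Sum>b\<in>UNIV. H k l z * (Rc l b z * Gam b i k z))"
    by ((rule sum_pull, rule sum.cong[OF refl])+, use H_sym[OF z] Rc_sym[OF z] in \<open>simp add: mult_ac\<close>)
  have 3: "(\<Sum>k\<in>UNIV. \<Sum>l\<in>UNIV. \<Sum>p\<in>UNIV. Gam l i p z * H p k z * Rc k l z) =
      (\<Sum>k\<in>UNIV. \<Sum>l\<in>UNIV. \<Sum>b\<in>UNIV. H k l z * (Rc l b z * Gam b i k z))"
    by ((rule sum_pull, rule sum.cong[OF refl])+, use H_sym[OF z] Rc_sym[OF z] in \<open>simp add: mult_ac\<close>)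
  have "D i Rs z = (\<Sum>k\<in>UNIV. \<Sum>l\<in>UNIV. D i (H k l) z * Rc k l z + H k l z * D i (Rc k l) z)"
    unfolding Rs_def[abs_def] using z by (simp add: dds)
  also have "\<dots> = (\<Sum>k\<in>UNIV. \<Sum>l\<in>UNIV. H k l z * D i (Rc k l) z)
     - 2 * (\<Sum>k\<in>UNIV. \<Sum>l\<in>UNIV. \<Sum>b\<in>UNIV. H k l z * (Rc l b z * Gam b i k z))"
    unfolding D_H[OF z] using 2 3
    by (simp add: sum.distrib sum_subtractf left_diff_distrib sum_distrib_right sum_negf)
  finally have Rs: "D i Rs z = (\<Sum>k\<in>UNIV. \<Sum>l\<in>UNIV. H k l z * D i (Rc k l) z)
     - 2 * (\<Sum>k\<in>UNIV. \<Sum>l\<in>UNIV. \<Sum>b\<in>UNIV. H k l z * (Rc l b z * Gam b i k z))" .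
  show ?thesis
    unfolding Dt_Gam[OF z] Rs using 1
    by (simp add: distrib_left right_diff_distrib sum.distrib sum_subtractf sum_distrib_left mult_ac)
qed

text \<open>Of the three factors that depend on time, \<open>H\<close> produces the Ricci term,
  \<open>f\<close> the term \<open>Lap (Dt f)\<close>, and the connection nothing, by
  \<open>H_Dt_Gam\<close>.\<close>

lemma Dt_Lap:
  assumes f: "smooth_on W f" and z: "z \<in> W"
  shows "Dt (Lap f) z = Lap (Dt f) z + 2 * inner2 z (\<lambda>i j. Rc i j z) (\<lambda>i j. Hs f i j z)"
proof -
  have 1: "Dt (Hs f i j) z = Hs (Dt f) i j z - (\<Sum>k\<in>UNIV. Dt (Gam k i j) z * D k f z)" for i j
  proof -
    have a: "Dt (D k f) x = D k (Dt f) x" if "x \<in> W" for k x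
      using f that by (intro dir_deriv_commute') auto
    have "Dt (D i (D j f)) z = D i (Dt (D j f)) z"
      using f z by (intro dir_deriv_commute') auto
    also have "\<dots> = D i (D j (Dt f)) z"
      by (rule dir_deriv_cong[OF z a])
    finally show ?thesis
      unfolding Hs_def[abs_def] using f z by (simp add: dds a sum.distrib)
  qed
  have 2: "(\<Sum>i\<in>UNIV. \<Sum>j\<in>UNIV. Dt (H i j) z * Hs f i j z) =
      2 * inner2 z (\<lambda>i j. Rc i j z) (\<lambda>i j. Hs f i j z)"
    unfolding inner2_def Dt_H[OF z] sum_distribs
    by ((rule sum_pull, rule sum.cong[OF refl])+, use H_sym[OF z] in \<open>simp add: mult_ac\<close>)
  have "(\<Sum>i\<in>UNIV. \<Sum>j\<in>UNIV. \<Sum>k\<in>UNIV. H i j z * (Dt (Gam k i j) z * D k f z)) =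
      (\<Sum>k\<in>UNIV. (\<Sum>i\<in>UNIV. \<Sum>j\<in>UNIV. H i j z * Dt (Gam k i j) z) * D k f z)"
    unfolding sum_distribs by ((rule sum_pull, rule sum.cong[OF refl])+, simp only: mult_ac)
  then have 3: "(\<Sum>i\<in>UNIV. \<Sum>j\<in>UNIV. \<Sum>k\<in>UNIV. H i j z * (Dt (Gam k i j) z * D k f z)) = 0"
    by (simp add: H_Dt_Gam[OF z])
  have "Dt (Lap f) z = (\<Sum>i\<in>UNIV. \<Sum>j\<in>UNIV. Dt (H i j) z * Hs f i j z + H i j z * Dt (Hs f i j) z)"
    unfolding Lap_def[abs_def] using f z by (simp add: dds)
  then show ?thesis
    unfolding 1 Lap_def using 2 3
    by (simp add: right_diff_distrib sum.distrib sum_subtractf sum_distrib_left)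
qed

lemma Dt_gsq:
  assumes f: "smooth_on W f" and z: "z \<in> W"
  shows "Dt (gsq f) z = 2 * (\<Sum>i\<in>UNIV. vup f i z * D i (Dt f) z)
    + 2 * (\<Sum>i\<in>UNIV. \<Sum>j\<in>UNIV. Rc i j z * (vup f i z * vup f j z))"
proof -
  have a: "Dt (D k f) z = D k (Dt f) z" for k
    using f z by (intro dir_deriv_commute') auto
  have 1: "(\<Sum>i\<in>UNIV. \<Sum>j\<in>UNIV. Dt (H i j) z * D j f z * D i f z) =
      2 * (\<Sum>i\<in>UNIV. \<Sum>j\<in>UNIV. Rc i j z * (vup f i z * vup f j z))"
    unfolding vup_def Dt_H[OF z] sum_distribs
    by ((rule sum_pull, rule sum.cong[OF refl])+, use H_sym[OF z] in \<open>simp add: mult_ac\<close>)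
  have 2: "(\<Sum>i\<in>UNIV. \<Sum>j\<in>UNIV. H i j z * D j (Dt f) z * D i f z) =
      (\<Sum>i\<in>UNIV. vup f i z * D i (Dt f) z)"
    unfolding vup_def sum_distribs
    by ((rule sum_pull, rule sum.cong[OF refl])+, use H_sym[OF z] in \<open>simp add: mult_ac\<close>)
  have "Dt (gsq f) z = (\<Sum>i\<in>UNIV. (\<Sum>j\<in>UNIV. Dt (H i j) z * D j f z + H i j z * D j (Dt f) z) * D i f z
      + vup f i z * D i (Dt f) z)"
    unfolding gsq_def[abs_def] vup_def[abs_def] using f z by (simp add: dds a)
  also have "\<dots> = (\<Sum>i\<in>UNIV. \<Sum>j\<in>UNIV. Dt (H i j) z * D j f z * D i f z)
      + (\<Sum>i\<in>UNIV. \<Sum>j\<in>UNIV. H i j z * D j (Dt f) z * D i f z) + (\<Sum>i\<in>UNIV. vup f i z * D i (Dt f) z)"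
    by (simp add: distrib_right sum.distrib sum_distrib_right)
  finally show ?thesis unfolding 1 2 by simp
qed

text \<open>With the tensor A = \<partial>_t \<Gamma>, \<partial>_t Ric_ij = \<nabla>_k A^k_ij -
  \<nabla>_j A^k_ik. Tracing kills the first term by \<open>H_Dt_Gam\<close> and turns the second
  into the Laplacian of R by \<open>Dt_Gam_trace\<close>; the norm of Ric comes from the time
  derivative of \<open>H\<close>.\<close>

theorem Dt_Rs:
  assumes z: "z \<in> W"
  shows "Dt Rs z = Lap Rs z + 2 * inner2 z (\<lambda>i j. Rc i j z) (\<lambda>i j. Rc i j z)"
proof -
  define A where "A k i j = Dt (Gam k i j)" for k i j
  have sA [simp]: "smooth_on W (A k i j)" for k i j
    by (simp add: A_def)
  have A_sym: "A k i j z = A k j i z" for k i j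
    unfolding A_def by (rule Dt_Gam_sym[OF z])
  have HA: "(\<Sum>i\<in>UNIV. \<Sum>j\<in>UNIV. H i j x * A k i j x) = 0" if "x \<in> W" for k x
    unfolding A_def by (rule H_Dt_Gam[OF that])
  have trA: "(\<Sum>k\<in>UNIV. A k i k x) = - D i Rs x" if "x \<in> W" for i x
    unfolding A_def by (rule Dt_Gam_trace[OF that])
  have Dt_Rc: "Dt (Rc i j) z = (\<Sum>k\<in>UNIV. D k (A k i j) z) - (\<Sum>k\<in>UNIV. D j (A k i k) z)
      + (\<Sum>k\<in>UNIV. \<Sum>l\<in>UNIV. A k k l z * Gam l i j z) + (\<Sum>k\<in>UNIV. \<Sum>l\<in>UNIV. Gam k k l z * A l i j z)
      - (\<Sum>k\<in>UNIV. \<Sum>l\<in>UNIV. A k j l z * Gam l i k z) - (\<Sum>k\<in>UNIV. \<Sum>l\<in>UNIV. Gam k j l z * A l i k z)" for i j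
  proof -
    have "Dt (D m (Gam k i j)) z = D m (A k i j) z" for m k i j
      unfolding A_def using z by (intro dir_deriv_commute') auto
    then show ?thesis
      unfolding Rc_def[abs_def] using z
      by (simp add: dds sum.distrib sum_subtractf A_def)
  qed
  \<comment> \<open>The connection corrections that do not belong to the Hessian of
    \<open>Rs\<close> are multiples of this sum and add up to zero: \<open>2 * S\<close> from fact
    a, \<open>- S\<close> from the sum in fact e, \<open>- S\<close> from the last sum of
    \<open>Dt_Rc\<close>, and nothing from fact d.\<close>
  define S where "S = (\<Sum>i\<in>UNIV. \<Sum>j\<in>UNIV. \<Sum>k\<in>UNIV. \<Sum>l\<in>UNIV. H i j z * (Gam k j l z * A l i k z))"
  have a: "(\<Sum>i\<in>UNIV. \<Sum>j\<in>UNIV. H i j z * (\<Sum>k\<in>UNIV. D k (A k i j) z)) = 2 * S"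
  proof -
    have S1: "(\<Sum>k\<in>UNIV. \<Sum>i\<in>UNIV. \<Sum>j\<in>UNIV. \<Sum>p\<in>UNIV. Gam i k p z * H p j z * A k i j z) = S"
      unfolding S_def
      by ((rule sum_pull, rule sum.cong[OF refl])+, use H_sym[OF z] Gam_sym[OF z] A_sym in \<open>simp add: mult_ac\<close>)
    have S2: "(\<Sum>k\<in>UNIV. \<Sum>i\<in>UNIV. \<Sum>j\<in>UNIV. \<Sum>p\<in>UNIV. Gam j k p z * H p i z * A k i j z) = S"
      unfolding S_def
      by ((rule sum_pull, rule sum.cong[OF refl])+, use H_sym[OF z] Gam_sym[OF z] A_sym in \<open>simp add: mult_ac\<close>)
    have "D k (\<lambda>z. \<Sum>i\<in>UNIV. \<Sum>j\<in>UNIV. H i j z * A k i j z) z = D k (\<lambda>z. 0) z" for k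
      by (rule dir_deriv_cong[OF z HA])
    then have "0 = D k (\<lambda>z. \<Sum>i\<in>UNIV. \<Sum>j\<in>UNIV. H i j z * A k i j z) z" for k
      by simp
    also have "D k (\<lambda>z. \<Sum>i\<in>UNIV. \<Sum>j\<in>UNIV. H i j z * A k i j z) z =
        (\<Sum>i\<in>UNIV. \<Sum>j\<in>UNIV. H i j z * D k (A k i j) z)
        - (\<Sum>i\<in>UNIV. \<Sum>j\<in>UNIV. \<Sum>p\<in>UNIV. Gam i k p z * H p j z * A k i j z)
        - (\<Sum>i\<in>UNIV. \<Sum>j\<in>UNIV. \<Sum>p\<in>UNIV. Gam j k p z * H p i z * A k i j z)" for k
      using z by (simp add: dds D_H sum.distrib sum_subtractf left_diff_distrib sum_distrib_right sum_negf)
    finally have "(\<Sum>k\<in>UNIV. \<Sum>i\<in>UNIV. \<Sum>j\<in>UNIV. H i j z * D k (A k i j) z) =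
        (\<Sum>k\<in>UNIV. (\<Sum>i\<in>UNIV. \<Sum>j\<in>UNIV. \<Sum>p\<in>UNIV. Gam i k p z * H p j z * A k i j z)
        + (\<Sum>i\<in>UNIV. \<Sum>j\<in>UNIV. \<Sum>p\<in>UNIV. Gam j k p z * H p i z * A k i j z))"
      by (intro sum.cong refl) (simp add: algebra_simps)
    then have "(\<Sum>k\<in>UNIV. \<Sum>i\<in>UNIV. \<Sum>j\<in>UNIV. H i j z * D k (A k i j) z) = 2 * S"
      unfolding sum.distrib S1 S2 by simp
    moreover have "(\<Sum>i\<in>UNIV. \<Sum>j\<in>UNIV. H i j z * (\<Sum>k\<in>UNIV. D k (A k i j) z)) =
        (\<Sum>k\<in>UNIV. \<Sum>i\<in>UNIV. \<Sum>j\<in>UNIV. H i j z * D k (A k i j) z)"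
      unfolding sum_distrib_left by ((rule sum_pull, rule sum.cong[OF refl])+, simp only: mult_ac)
    ultimately show ?thesis by simp
  qed
  have b: "(\<Sum>k\<in>UNIV. D j (A k i k) z) = - D j (D i Rs) z" for i j
  proof -
    have "D j (\<lambda>z. \<Sum>k\<in>UNIV. A k i k z) z = D j (\<lambda>z. - D i Rs z) z"
      by (rule dir_deriv_cong[OF z trA])
    then show ?thesis using z by (simp add: dds)
  qed
  have c: "(\<Sum>k\<in>UNIV. \<Sum>l\<in>UNIV. A k k l z * Gam l i j z) = - (\<Sum>l\<in>UNIV. Gam l j i z * D l Rs z)" for i j
  proof -
    have "(\<Sum>k\<in>UNIV. \<Sum>l\<in>UNIV. A k k l z * Gam l i j z) = (\<Sum>l\<in>UNIV. Gam l j i z * (\<Sum>k\<in>UNIV. A k l k z))"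
      unfolding sum_distribs
      by ((rule sum_pull, rule sum.cong[OF refl])+, use Gam_sym[OF z] A_sym in \<open>simp add: mult_ac\<close>)
    then show ?thesis by (simp add: trA[OF z] sum_negf)
  qed
  have d: "(\<Sum>i\<in>UNIV. \<Sum>j\<in>UNIV. H i j z * (\<Sum>k\<in>UNIV. \<Sum>l\<in>UNIV. Gam k k l z * A l i j z)) = 0"
  proof -
    have "(\<Sum>i\<in>UNIV. \<Sum>j\<in>UNIV. H i j z * (\<Sum>k\<in>UNIV. \<Sum>l\<in>UNIV. Gam k k l z * A l i j z)) =
        (\<Sum>k\<in>UNIV. \<Sum>l\<in>UNIV. Gam k k l z * (\<Sum>i\<in>UNIV. \<Sum>j\<in>UNIV. H i j z * A l i j z))"
      unfolding sum_distribs by ((rule sum_pull, rule sum.cong[OF refl])+, simp only: mult_ac)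
    then show ?thesis by (simp add: HA[OF z])
  qed
  have e: "(\<Sum>i\<in>UNIV. \<Sum>j\<in>UNIV. H i j z * (\<Sum>k\<in>UNIV. \<Sum>l\<in>UNIV. A k j l z * Gam l i k z)) = S"
    unfolding S_def sum_distribs
    by ((rule sum_pull, rule sum.cong[OF refl])+, use H_sym[OF z] Gam_sym[OF z] A_sym in \<open>simp add: mult_ac\<close>)
  have Lap: "(\<Sum>i\<in>UNIV. \<Sum>j\<in>UNIV. H i j z * (D j (D i Rs) z - (\<Sum>l\<in>UNIV. Gam l j i z * D l Rs z))) = Lap Rs z"
    unfolding Lap_def Hs_def
    by ((rule sum_pull, rule sum.cong[OF refl])+, use H_sym[OF z] in \<open>simp add: mult_ac\<close>)
  have "(\<Sum>i\<in>UNIV. \<Sum>j\<in>UNIV. H i j z * Dt (Rc i j) z) =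
      (\<Sum>i\<in>UNIV. \<Sum>j\<in>UNIV. H i j z * (\<Sum>k\<in>UNIV. D k (A k i j) z))
      + (\<Sum>i\<in>UNIV. \<Sum>j\<in>UNIV. H i j z * (D j (D i Rs) z - (\<Sum>l\<in>UNIV. Gam l j i z * D l Rs z)))
      + (\<Sum>i\<in>UNIV. \<Sum>j\<in>UNIV. H i j z * (\<Sum>k\<in>UNIV. \<Sum>l\<in>UNIV. Gam k k l z * A l i j z))
      - (\<Sum>i\<in>UNIV. \<Sum>j\<in>UNIV. H i j z * (\<Sum>k\<in>UNIV. \<Sum>l\<in>UNIV. A k j l z * Gam l i k z))
      - S"
    unfolding Dt_Rc b c S_def sum_distrib_left[symmetric]
    by (simp only: distrib_left right_diff_distrib sum.distrib sum_subtractf)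
       (simp add: sum_negf)
  then have f: "(\<Sum>i\<in>UNIV. \<Sum>j\<in>UNIV. H i j z * Dt (Rc i j) z) = Lap Rs z"
    unfolding a d e Lap by simp
  have g: "(\<Sum>i\<in>UNIV. \<Sum>j\<in>UNIV. Dt (H i j) z * Rc i j z) =
      2 * inner2 z (\<lambda>i j. Rc i j z) (\<lambda>i j. Rc i j z)"
    unfolding inner2_def Dt_H[OF z] sum_distribs
    by ((rule sum_pull, rule sum.cong[OF refl])+, use H_sym[OF z] in \<open>simp add: mult_ac\<close>)
  have "Dt Rs z = (\<Sum>i\<in>UNIV. \<Sum>j\<in>UNIV. Dt (H i j) z * Rc i j z) + (\<Sum>i\<in>UNIV. \<Sum>j\<in>UNIV. H i j z * Dt (Rc i j) z)"
    unfolding Rs_def[abs_def] using z by (simp add: dds sum.distrib)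
  then show ?thesis unfolding f g by simp
qed

end

section \<open>Decomposition of positive semidefinite forms\<close>

text \<open>The Gram form of a semidefinite matrix, by eliminating one variable at a time: split off
  the rank one part through the index \<open>k\<close> and apply the induction hypothesis to the
  Schur complement. For the inverse metric, the columns of \<open>w\<close> will serve as an
  orthonormal frame.\<close>

lemma psd_decomposition:
  fixes h :: "'a \<Rightarrow> 'a \<Rightarrow> real"
  assumes "finite I" "\<And>i j. h i j = h j i"
    and "\<And>x. 0 \<le> (\<Sum>i\<in>I. \<Sum>j\<in>I. x i * x j * h i j)"
  shows "\<exists>w. \<forall>i\<in>I. \<forall>j\<in>I. h i j = (\<Sum>a\<in>I. w i a * w j a)"
  using assms
proof (induction I arbitrary: h rule: finite_induct)
  case empty
  then show ?case by simp
next
  case (insert k I)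
  have expand: "(\<Sum>i\<in>insert k I. \<Sum>j\<in>insert k I. x i * x j * h i j) =
      (\<Sum>i\<in>I. \<Sum>j\<in>I. x i * x j * h i j) + 2 * x k * (\<Sum>i\<in>I. x i * h i k) + x k * x k * h k k" for x
  proof -
    have "(\<Sum>j\<in>I. x k * x j * h k j) = x k * (\<Sum>i\<in>I. x i * h i k)"
      using insert.prems(1)[of k] by (simp add: sum_distrib_left mult_ac)
    moreover have "(\<Sum>i\<in>I. x i * x k * h i k) = x k * (\<Sum>i\<in>I. x i * h i k)"
      by (simp add: sum_distrib_left mult_ac)
    ultimately show ?thesis
      unfolding sum.insert[OF insert.hyps] sum.distrib by (simp only: algebra_simps)
  qed
  note pos = insert.prems(2)[unfolded expand]
  have kk: "0 \<le> h k k"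
  proof -
    have "(\<Sum>i\<in>I. (if i = k then 1 else 0) * c i) = 0" for c :: "'a \<Rightarrow> real"
      using insert.hyps(2) by (intro sum.neutral) auto
    then show ?thesis
      using pos[of "\<lambda>i. if i = k then 1 else 0"] by (simp add: mult.assoc flip: sum_distrib_left)
  qed
  \<comment> \<open>The Schur complement of \<open>h k k\<close>. If \<open>h k k = 0\<close>, the
    quotient is 0 and \<open>h' = h\<close>, which is consistent because the entries
    \<open>h i k\<close> then vanish by fact zero.\<close>
  define h' where "h' i j = h i j - h i k * h j k / h k k" for i j
  have "0 \<le> (\<Sum>i\<in>I. \<Sum>j\<in>I. x i * x j * h' i j)" for x
  proof -
    define s where "s = (\<Sum>i\<in>I. x i * h i k)"
    \<comment> \<open>For nonzero \<open>h k k\<close> this entry minimises the form with the other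
      coordinates fixed, and the minimum is the value of the form of \<open>h'\<close>.\<close>
    define x' where "x' = x(k := - s / h k k)"
    have x': "i \<in> I \<Longrightarrow> x' i = x i" for i
      using insert.hyps(2) by (auto simp: x'_def)
    have "(\<Sum>i\<in>I. \<Sum>j\<in>I. x i * x j * (h i k * h j k / h k k)) = s * s / h k k"
      unfolding s_def sum_product sum_divide_distrib by (intro sum.cong refl) (simp add: mult_ac)
    then have "(\<Sum>i\<in>I. \<Sum>j\<in>I. x i * x j * h' i j) = (\<Sum>i\<in>I. \<Sum>j\<in>I. x i * x j * h i j) - s * s / h k k"
      by (simp add: h'_def right_diff_distrib sum_subtractf)
    moreover have "0 \<le> (\<Sum>i\<in>I. \<Sum>j\<in>I. x i * x j * h i j) + 2 * x' k * s + x' k * x' k * h k k"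
      using pos[of x'] x' by (simp add: s_def cong: sum.cong)
    moreover have "2 * x' k * s + x' k * x' k * h k k = - (s * s / h k k)"
      by (cases "h k k = 0") (simp_all add: x'_def field_simps)
    ultimately show ?thesis by simp
  qed
  then obtain w where w: "\<And>i j. i \<in> I \<Longrightarrow> j \<in> I \<Longrightarrow> h' i j = (\<Sum>a\<in>I. w i a * w j a)"
    using insert.IH[of h'] insert.prems(1) by (auto simp: h'_def mult.commute)
  have zero: "h i k = 0" if "h k k = 0" "i \<in> I" for i
  proof (rule ccontr)
    assume ne: "h i k \<noteq> 0"
    \<comment> \<open>The vector with entry 1 at \<open>i\<close> and \<open>t\<close> at
      \<open>k\<close> gives the form the value -1, since \<open>h k k = 0\<close>.\<close>
    define t where "t = - (h i i + 1) / (2 * h i k)"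
    define x where "x = (\<lambda>j. if j = k then t else if j = i then 1 else (0::real))"
    have ik: "i \<noteq> k" using that insert.hyps(2) by auto
    have "(\<Sum>j\<in>I. x j * c j) = c i" for c
    proof -
      have "(\<Sum>j\<in>I. x j * c j) = (\<Sum>j\<in>I. if j = i then c j else 0)"
        using insert.hyps(2) by (intro sum.cong) (auto simp: x_def)
      then show ?thesis using that insert.hyps(1) by simp
    qed
    then have "(\<Sum>i\<in>I. \<Sum>j\<in>I. x i * x j * h i j) = h i i" "(\<Sum>j\<in>I. x j * h j k) = h i k"
      by (simp_all add: mult.assoc flip: sum_distrib_left)
    then have "0 \<le> h i i + 2 * t * h i k"
      using pos[of x] that by (simp add: x_def)
    moreover have "2 * t * h i k = - (h i i + 1)"
      using ne by (simp add: t_def)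
    ultimately show False by linarith
  qed
  define v where "v i a = (if a = k then h i k / sqrt (h k k) else if i = k then 0 else w i a)" for i a
  have "h i j = (\<Sum>a\<in>insert k I. v i a * v j a)" if "i \<in> insert k I" "j \<in> insert k I" for i j
  proof -
    have "(\<Sum>a\<in>insert k I. v i a * v j a) = h i k * h j k / h k k + (\<Sum>a\<in>I. v i a * v j a)"
      using insert.hyps kk by (simp add: v_def)
    also have "(\<Sum>a\<in>I. v i a * v j a) = (if i = k \<or> j = k then 0 else h' i j)"
    proof -
      have "a \<in> I \<Longrightarrow> a \<noteq> k" for a using insert.hyps(2) by auto
      then show ?thesis using that w[of i j] by (auto simp: v_def intro!: sum.neutral)
    qed
    also have "h i k * h j k / h k k + \<dots> = h i j"
      using that zero[of i] zero[of j] insert.prems(1)[of k j] by (auto simp: h'_def)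
    finally show ?thesis by simp
  qed
  then show ?case by blast
qed

section \<open>The Li-Yau quantity at an interior maximum\<close>

text \<open>Cauchy-Schwarz on the diagonal, with the off-diagonal squares added; the dimension in
  the final estimate has its origin here.\<close>

lemma square_trace_le:
  fixes P :: "'n::finite \<Rightarrow> 'n \<Rightarrow> real"
  shows "(\<Sum>a\<in>UNIV. P a a)\<^sup>2 \<le> real CARD('n) * (\<Sum>a\<in>UNIV. \<Sum>b\<in>UNIV. (P a b)\<^sup>2)"
proof -
  have "(\<Sum>a\<in>UNIV. P a a)\<^sup>2 \<le> (\<Sum>a\<in>(UNIV::'n set). 1\<^sup>2) * (\<Sum>a\<in>UNIV. (P a a)\<^sup>2)"
    using Cauchy_Schwarz_ineq_sum[of "\<lambda>a. 1" "\<lambda>a. P a a" UNIV] by simp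
  also have "\<dots> \<le> real CARD('n) * (\<Sum>a\<in>UNIV. \<Sum>b\<in>UNIV. (P a b)\<^sup>2)"
    by (auto intro!: mult_left_mono sum_mono member_le_sum)
  finally show ?thesis .
qed

text \<open>Completing squares in the reaction terms. Here \<open>P\<close>, \<open>Q\<close>, \<open>y\<close>, \<open>r\<close> are the components of
  \<open>\<nabla>\<^sup>2 f\<close>, \<open>Ric\<close>, \<open>\<nabla>f\<close>, \<open>\<nabla>R\<close> in an orthonormal frame.\<close>

lemma reaction_bound:
  fixes P Q :: "'n::finite \<Rightarrow> 'n \<Rightarrow> real" and y r :: "'n \<Rightarrow> real"
  assumes \<delta>: "1/2 \<le> \<delta>" "\<delta> < 1" and n: "n = real CARD('n)"
    and \<alpha>: "\<alpha> = n / (2 * \<delta> * (1 - \<delta>)^2)" and \<beta>: "\<beta> = \<alpha> * (R1 + 2)^2"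
    and R: "R = (\<Sum>a\<in>UNIV. Q a a)" "-1 \<le> R" "R \<le> R1"
    and X: "X = (\<Sum>a\<in>UNIV. (y a)\<^sup>2)"
    and F: "F = - (\<Sum>a\<in>UNIV. P a a) - (1 - \<delta>) * X - \<alpha> * R + \<beta> / (R + 2)"
    and F_ge: "2 * \<beta> + n * \<beta> / (2 * \<delta> * (1 - \<delta>)) \<le> F"
  shows "2 * (\<alpha> + \<beta> / (R + 2)\<^sup>2) * (\<Sum>a\<in>UNIV. y a * r a) - 2 * \<delta> * (\<Sum>a\<in>UNIV. \<Sum>b\<in>UNIV. P a b * P a b)
      - 2 * (\<Sum>a\<in>UNIV. \<Sum>b\<in>UNIV. Q a b * (y a * y b)) - 2 * (\<Sum>a\<in>UNIV. \<Sum>b\<in>UNIV. Q a b * P a b)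
      - 2 * \<alpha> * (\<Sum>a\<in>UNIV. \<Sum>b\<in>UNIV. Q a b * Q a b)
      - 2 * \<beta> * (\<Sum>a\<in>UNIV. \<Sum>b\<in>UNIV. Q a b * Q a b) / (R + 2)\<^sup>2
      - 2 * \<beta> * (\<Sum>a\<in>UNIV. r a * r a) / (R + 2) ^ 3
    \<le> - (2 * \<delta> / n) * (F - 2 * \<beta>)\<^sup>2"
proof -
  define p2 where "p2 = (\<Sum>a\<in>UNIV. \<Sum>b\<in>UNIV. P a b * P a b)"
  define pq where "pq = (\<Sum>a\<in>UNIV. \<Sum>b\<in>UNIV. Q a b * P a b)"
  define q2 where "q2 = (\<Sum>a\<in>UNIV. \<Sum>b\<in>UNIV. Q a b * Q a b)"
  define qyy where "qyy = (\<Sum>a\<in>UNIV. \<Sum>b\<in>UNIV. Q a b * (y a * y b))"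
  define yr where "yr = (\<Sum>a\<in>UNIV. y a * r a)"
  define r2 where "r2 = (\<Sum>a\<in>UNIV. r a * r a)"
  define trP where "trP = (\<Sum>a\<in>UNIV. P a a)"
  have n1: "1 \<le> n" using n by simp
  have \<delta>0: "0 < \<delta>" "0 < 1 - \<delta>" using \<delta> by auto
  have \<alpha>0: "0 < \<alpha>" unfolding \<alpha> using n1 \<delta>0 by simp
  have R2: "1 \<le> R + 2" using R by simp
  have \<beta>R: "\<alpha> * (R + 2)\<^sup>2 \<le> \<beta>"
    unfolding \<beta> using \<alpha>0 R R2 by (intro mult_left_mono power_mono) auto
  have "\<alpha> * 1 \<le> \<alpha> * (R + 2)\<^sup>2" using \<alpha>0 R2 by (intro mult_left_mono) auto
  then have \<alpha>\<beta>: "\<alpha> \<le> \<beta>" using \<beta>R by simp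
  then have \<beta>0: "0 < \<beta>" using \<alpha>0 by simp
  have X0: "0 \<le> X" unfolding X by (simp add: sum_nonneg)
  have q20: "0 \<le> q2" unfolding q2_def by (simp add: sum_nonneg)
  have \<alpha>\<delta>: "1 / (2 * \<delta>) \<le> \<alpha>"
  proof -
    have "(1 - \<delta>)\<^sup>2 \<le> 1" using \<delta>0 \<delta> by (simp add: power_le_one)
    then have "2 * \<delta> * (1 - \<delta>)\<^sup>2 \<le> n * (2 * \<delta>)"
      using n1 \<delta>0 mult_mono[of 1 n "2 * \<delta> * (1 - \<delta>)\<^sup>2" "2 * \<delta>"] by (simp add: mult_left_le)
    then show ?thesis unfolding \<alpha> using \<delta>0 by (simp add: field_simps)
  qed
  define b where "b = \<beta> / (R + 2)\<^sup>2"
  have \<alpha>b: "\<alpha> \<le> b"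
    unfolding b_def using \<beta>R R2 by (simp add: pos_le_divide_eq)
  have b0: "0 < b" using \<alpha>b \<alpha>0 by simp
  \<comment> \<open>The weight \<open>R + 2\<close> in the two squares makes the |\<nabla>R|^2 part
    equal to the good term 2\<beta>|\<nabla>R|^2/(R+2)^3; the rest is at most 2\<beta>X because R +
    2 \<ge> 1.\<close>
  have yr: "2 * (\<alpha> + b) * yr \<le> 2 * b * r2 / (R + 2) + 2 * \<beta> * X"
  proof -
    have "0 \<le> (\<Sum>a\<in>UNIV. (r a - (R + 2) * y a)\<^sup>2)" "0 \<le> (\<Sum>a\<in>UNIV. (r a + (R + 2) * y a)\<^sup>2)"
      by (simp_all add: sum_nonneg)
    moreover have "(\<Sum>a\<in>UNIV. (r a - (R + 2) * y a)\<^sup>2) = r2 - 2 * (R + 2) * yr + (R + 2)\<^sup>2 * X"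
      "(\<Sum>a\<in>UNIV. (r a + (R + 2) * y a)\<^sup>2) = r2 + 2 * (R + 2) * yr + (R + 2)\<^sup>2 * X"
      unfolding r2_def yr_def X sum_distrib_left sum.distrib[symmetric] sum_subtractf[symmetric]
      by (intro sum.cong refl; simp add: power2_eq_square algebra_simps)+
    ultimately have "2 * (R + 2) * \<bar>yr\<bar> \<le> r2 + (R + 2)\<^sup>2 * X"
      by (simp add: abs_if)
    then have "2 * \<bar>yr\<bar> \<le> (r2 + (R + 2)\<^sup>2 * X) / (R + 2)"
      using R2 by (simp add: field_simps)
    also have "\<dots> = r2 / (R + 2) + (R + 2) * X"
      using R2 by (simp add: field_simps power2_eq_square)
    finally have "2 * b * (2 * \<bar>yr\<bar>) \<le> 2 * b * (r2 / (R + 2) + (R + 2) * X)"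
      using b0 by (intro mult_left_mono) auto
    moreover have "b * (R + 2) \<le> \<beta>"
    proof -
      have "b * (R + 2) = \<beta> / (R + 2)" using R2 by (simp add: b_def power2_eq_square)
      also have "\<dots> \<le> \<beta>" using R2 \<beta>0 by (simp add: divide_le_eq mult_left_le)
      finally show ?thesis .
    qed
    then have "b * (R + 2) * X \<le> \<beta> * X" using X0 by (intro mult_right_mono)
    moreover have "2 * (\<alpha> + b) * yr \<le> 2 * b * (2 * \<bar>yr\<bar>)"
    proof -
      have "(\<alpha> + b) * yr \<le> (\<alpha> + b) * \<bar>yr\<bar>" using \<alpha>0 b0 by (intro mult_left_mono) auto
      also have "\<dots> \<le> (2 * b) * \<bar>yr\<bar>" using \<alpha>b by (intro mult_right_mono) auto
      finally show ?thesis by (simp add: algebra_simps)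
    qed
    ultimately show ?thesis by (simp add: algebra_simps)
  qed
  have pq: "- 2 * \<delta> * p2 - 2 * pq \<le> - (2 * \<delta> / n) * (trP + R / (2 * \<delta>))\<^sup>2 + q2 / (2 * \<delta>)"
  proof -
    have "(\<Sum>a\<in>UNIV. P a a + Q a a / (2 * \<delta>))\<^sup>2 \<le> n * (\<Sum>a\<in>UNIV. \<Sum>b\<in>UNIV. (P a b + Q a b / (2 * \<delta>))\<^sup>2)"
      unfolding n by (rule square_trace_le)
    moreover have "(\<Sum>a\<in>UNIV. P a a + Q a a / (2 * \<delta>)) = trP + R / (2 * \<delta>)"
      by (simp add: trP_def R(1) sum.distrib sum_divide_distrib)
    moreover have "(\<Sum>a\<in>UNIV. \<Sum>b\<in>UNIV. (P a b + Q a b / (2 * \<delta>))\<^sup>2) =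
        p2 + (1 / \<delta>) * pq + (1 / (4 * \<delta>\<^sup>2)) * q2"
      unfolding p2_def pq_def q2_def sum_distrib_left sum.distrib[symmetric]
      using \<delta>0 by (intro sum.cong refl) (simp add: power2_eq_square field_simps)
    ultimately have "(trP + R / (2 * \<delta>))\<^sup>2 \<le> n * (p2 + (1 / \<delta>) * pq + (1 / (4 * \<delta>\<^sup>2)) * q2)"
      by simp
    then have "(2 * \<delta> / n) * (trP + R / (2 * \<delta>))\<^sup>2 \<le>
        (2 * \<delta> / n) * (n * (p2 + (1 / \<delta>) * pq + (1 / (4 * \<delta>\<^sup>2)) * q2))"
      using \<delta>0 n1 by (intro mult_left_mono) auto
    also have "\<dots> = 2 * \<delta> * p2 + 2 * pq + q2 / (2 * \<delta>)"
      using \<delta>0 n1 by (simp add: field_simps power2_eq_square)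
    finally show ?thesis by simp
  qed
  have qyy: "- 2 * qyy \<le> 3 * \<alpha> * q2 + X\<^sup>2 / (3 * \<alpha>)"
  proof -
    have X2: "X\<^sup>2 = (\<Sum>a\<in>UNIV. \<Sum>b\<in>UNIV. (y a * y b)\<^sup>2)"
      unfolding X by (simp add: power2_eq_square sum_product mult_ac)
    have "0 \<le> (\<Sum>a\<in>UNIV. \<Sum>b\<in>UNIV. (3 * \<alpha> * Q a b + y a * y b)\<^sup>2)"
      by (simp add: sum_nonneg)
    also have "\<dots> = (3 * \<alpha>)\<^sup>2 * q2 + (6 * \<alpha>) * qyy + X\<^sup>2"
      unfolding q2_def qyy_def X2 sum_distrib_left sum.distrib[symmetric]
      by (intro sum.cong refl) (simp add: power2_eq_square algebra_simps)
    finally have "0 \<le> ((3 * \<alpha>)\<^sup>2 * q2 + (6 * \<alpha>) * qyy + X\<^sup>2) / (3 * \<alpha>)"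
      using \<alpha>0 by simp
    also have "\<dots> = 3 * \<alpha> * q2 + 2 * qyy + X\<^sup>2 / (3 * \<alpha>)"
      using \<alpha>0 by (simp add: field_simps power2_eq_square)
    finally show ?thesis by simp
  qed
  define G where "G = F - 2 * \<beta>"
  have G: "n * \<beta> / (2 * \<delta> * (1 - \<delta>)) \<le> G" using F_ge by (simp add: G_def)
  have "0 \<le> n * \<beta> / (2 * \<delta> * (1 - \<delta>))" using n1 \<beta>0 \<delta>0 by simp
  then have G0: "0 \<le> G" using G by linarith
  \<comment> \<open>The shift 2\<beta> in \<open>G\<close> pays for the curvature terms of
    \<open>F\<close>: (\<alpha> - 1/(2\<delta>))R \<ge> -\<alpha> because R \<ge> -1, and both
    \<alpha> and \<beta>/(R+2) are at most \<beta>. As the left side is nonnegative, the inequality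
    may be squared.\<close>
  have s: "G + (1 - \<delta>) * X \<le> - (trP + R / (2 * \<delta>))"
  proof -
    define c d where "c = 1 / (2 * \<delta>)" and "d = \<beta> / (R + 2)"
    have "(\<alpha> - c) * (- 1) \<le> (\<alpha> - c) * R"
      using R \<alpha>\<delta> unfolding c_def by (intro mult_left_mono) auto
    moreover have "d \<le> \<beta>" using R2 \<beta>0 by (simp add: d_def divide_le_eq mult_left_le)
    moreover have "0 < c" using \<delta>0 by (simp add: c_def)
    moreover have "R / (2 * \<delta>) = c * R" by (simp add: c_def)
    ultimately show ?thesis
      using \<alpha>\<beta> unfolding G_def F trP_def[symmetric] d_def[symmetric] by (simp add: algebra_simps)
  qed
  have "(G + (1 - \<delta>) * X)\<^sup>2 \<le> (- (trP + R / (2 * \<delta>)))\<^sup>2"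
    using s G0 X0 \<delta>0 by (intro power_mono) auto
  then have "(2 * \<delta> / n) * (G + (1 - \<delta>) * X)\<^sup>2 \<le> (2 * \<delta> / n) * (trP + R / (2 * \<delta>))\<^sup>2"
    unfolding power2_minus using \<delta>0 n1 by (intro mult_left_mono) auto
  moreover have "(2 * \<delta> / n) * (G + (1 - \<delta>) * X)\<^sup>2 =
      (2 * \<delta> / n) * G\<^sup>2 + (4 * \<delta> * (1 - \<delta>) / n) * G * X + (2 * \<delta> / n) * (1 - \<delta>)\<^sup>2 * X\<^sup>2"
    by (simp add: power2_eq_square algebra_simps add_divide_distrib diff_divide_distrib)
  \<comment> \<open>Solving 2\<beta> = (4\<delta>(1-\<delta>)/n)G for \<open>G\<close> gives the
    second summand of the threshold in \<open>F_ge\<close>; the first one is the shift.\<close>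
  moreover have "2 * \<beta> * X \<le> (4 * \<delta> * (1 - \<delta>) / n) * G * X"
  proof -
    have "2 * \<beta> = (4 * \<delta> * (1 - \<delta>) / n) * (n * \<beta> / (2 * \<delta> * (1 - \<delta>)))"
      using \<delta>0 n1 by (simp add: field_simps)
    also have "\<dots> \<le> (4 * \<delta> * (1 - \<delta>) / n) * G"
      using G \<delta>0 n1 by (intro mult_left_mono) auto
    finally show ?thesis using X0 by (intro mult_right_mono)
  qed
  moreover have "X\<^sup>2 / (3 * \<alpha>) \<le> (2 * \<delta> / n) * (1 - \<delta>)\<^sup>2 * X\<^sup>2"
  proof -
    have "(2 * \<delta> / n) * (1 - \<delta>)\<^sup>2 = 1 / \<alpha>" using \<delta>0 n1 by (simp add: \<alpha> field_simps)
    moreover have "X\<^sup>2 / (3 * \<alpha>) \<le> X\<^sup>2 / \<alpha>" using \<alpha>0 by (simp add: frac_le)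
    ultimately show ?thesis by simp
  qed
  moreover have "q2 / (2 * \<delta>) \<le> \<alpha> * q2"
    using mult_right_mono[OF \<alpha>\<delta> q20] by simp
  moreover have "\<alpha> * q2 \<le> b * q2"
    using \<alpha>b q20 by (intro mult_right_mono)
  ultimately have "2 * (\<alpha> + b) * yr - 2 * \<delta> * p2 - 2 * qyy - 2 * pq - 2 * \<alpha> * q2 - 2 * (b * q2)
      - 2 * b * r2 / (R + 2) \<le> - (2 * \<delta> / n) * G\<^sup>2"
    using yr pq qyy by linarith
  moreover have "2 * \<beta> * q2 / (R + 2)\<^sup>2 = 2 * (b * q2)" "2 * \<beta> * r2 / (R + 2) ^ 3 = 2 * b * r2 / (R + 2)"
    by (simp_all add: b_def power2_eq_square power3_eq_cube)
  ultimately show ?thesis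
    unfolding p2_def[symmetric] pq_def[symmetric] q2_def[symmetric] qyy_def[symmetric]
      yr_def[symmetric] r2_def[symmetric] b_def[symmetric] G_def[symmetric] by simp
qed

text \<open>Let a = n/(2\<delta>) and B = n\<beta>/(\<delta>(1-\<delta>)). If the bound failed, then
  F > 4B, so \<open>ineq\<close> applies and gives \<tau>(F - 2\<beta>)^2 \<le> aF; but \<tau>(F -
  2\<beta>) > a + 2\<beta>\<tau> forces the opposite inequality. The horizon T enters through \<tau>
  \<le> T, which turns a threshold for F into one for \<tau>F.\<close>

lemma maximum_value_bound:
  fixes n \<delta> \<beta> T \<tau> F :: real
  assumes n: "1 \<le> n" and \<delta>: "0 < \<delta>" "\<delta> < 1" and \<beta>: "0 \<le> \<beta>" and \<tau>: "0 < \<tau>" "\<tau> \<le> T"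
    and ineq: "2 * \<beta> + n * \<beta> / (2 * \<delta> * (1 - \<delta>)) \<le> F \<Longrightarrow> - F / \<tau> \<le> - (2 * \<delta> / n) * (F - 2 * \<beta>)\<^sup>2"
  shows "\<tau> * F \<le> n / (2 * \<delta>) + 4 * n * \<beta> * T / (\<delta> * (1 - \<delta>))"
proof (rule ccontr)
  define a where "a = n / (2 * \<delta>)"
  define B where "B = n * \<beta> / (\<delta> * (1 - \<delta>))"
  have a0: "0 < a" unfolding a_def using n \<delta> by simp
  \<comment> \<open>Together with n \<ge> 1 this makes B at least 4\<beta>, so that F > 4B clears
    both the shift 2\<beta> and the threshold 2\<beta> + B/2.\<close>
  have \<delta>\<delta>: "\<delta> * (1 - \<delta>) \<le> 1 / 4"
    using zero_le_power2[of "\<delta> - 1/2"] by (simp add: power2_eq_square algebra_simps)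
  have B: "4 * \<beta> \<le> B"
  proof -
    have "4 * \<beta> * (\<delta> * (1 - \<delta>)) \<le> 4 * \<beta> * (1 / 4)" using \<beta> \<delta>\<delta> by (intro mult_left_mono) auto
    also have "\<dots> \<le> n * \<beta>" using n \<beta> by (simp add: mult_right_mono[of 1 n \<beta>, simplified])
    finally show ?thesis unfolding B_def using \<delta> by (simp add: pos_le_divide_eq)
  qed
  assume "\<not> \<tau> * F \<le> n / (2 * \<delta>) + 4 * n * \<beta> * T / (\<delta> * (1 - \<delta>))"
  then have big: "a + 4 * B * T < \<tau> * F" unfolding a_def B_def by (simp add: mult_ac)
  have "4 * B * \<tau> \<le> 4 * B * T" using \<tau> B \<beta> by (intro mult_left_mono) auto
  then have big': "a + 4 * B * \<tau> < \<tau> * F" using big by linarith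
  then have "4 * B * \<tau> < F * \<tau>" using a0 by (simp add: mult.commute)
  then have FB: "4 * B < F" using \<tau> by simp
  have half: "n * \<beta> / (2 * \<delta> * (1 - \<delta>)) = B / 2" unfolding B_def by simp
  have "2 * \<beta> + n * \<beta> / (2 * \<delta> * (1 - \<delta>)) \<le> F"
    unfolding half using FB B \<beta> by linarith
  then have "- F / \<tau> \<le> - (2 * \<delta> / n) * (F - 2 * \<beta>)\<^sup>2" by (rule ineq)
  then have "(2 * \<delta> / n) * (F - 2 * \<beta>)\<^sup>2 \<le> F / \<tau>" by simp
  then have "a * ((2 * \<delta> / n) * (F - 2 * \<beta>)\<^sup>2) \<le> a * (F / \<tau>)"
    using a0 by (intro mult_left_mono) auto
  moreover have "a * ((2 * \<delta> / n) * (F - 2 * \<beta>)\<^sup>2) = (F - 2 * \<beta>)\<^sup>2"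
    unfolding a_def using \<delta> n by simp
  ultimately have "(F - 2 * \<beta>)\<^sup>2 \<le> a * F / \<tau>"
    by simp
  then have key: "\<tau> * (F - 2 * \<beta>)\<^sup>2 \<le> a * F"
    using \<tau> by (simp add: pos_le_divide_eq mult.commute)
  define G where "G = F - 2 * \<beta>"
  have G0: "0 < G" unfolding G_def using FB B \<beta> by linarith
  have "\<beta> * \<tau> \<ge> 0" "4 * \<beta> * \<tau> \<le> B * \<tau>" using \<beta> \<tau> B by (auto intro: mult_right_mono)
  then have G1: "a + 2 * \<beta> * \<tau> \<le> \<tau> * G"
    using big' unfolding G_def by (simp add: algebra_simps)
  have "a + 2 * \<beta> * \<tau> < \<tau> * G"
  proof -
    have "4 * B * \<tau> \<ge> 4 * (4 * \<beta> * \<tau>)" using \<open>4 * \<beta> * \<tau> \<le> B * \<tau>\<close> by simp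
    then show ?thesis using big' \<open>\<beta> * \<tau> \<ge> 0\<close> unfolding G_def by (simp add: algebra_simps)
  qed
  \<comment> \<open>The chain is \<tau>G^2 > aG + 2\<beta>\<tau>G \<ge> aG + 2\<beta>a = aF, where
    the middle step uses \<tau>G \<ge> a + 2\<beta>\<tau> \<ge> a.\<close>
  then have "(a + 2 * \<beta> * \<tau>) * G < \<tau> * G * G" using G0 by (intro mult_strict_right_mono)
  moreover have "2 * \<beta> * (a + 2 * \<beta> * \<tau>) \<le> 2 * \<beta> * (\<tau> * G)"
    using G1 \<beta> by (intro mult_left_mono) auto
  moreover have "0 \<le> \<beta> * (\<beta> * \<tau>)" using \<beta> \<tau> by simp
  moreover have "a * F = a * G + 2 * \<beta> * a" unfolding G_def by (simp add: algebra_simps)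
  ultimately have "a * F < \<tau> * G * G" by (simp add: algebra_simps)
  then show False using key unfolding G_def by (simp add: power2_eq_square mult_ac)
qed

section \<open>Rules for the Laplacian and contractions in a frame\<close>

context metric_chart
begin

lemma Hs_cong:
  assumes z: "z \<in> W" and eq: "\<And>x. x \<in> W \<Longrightarrow> f x = g x"
  shows "Hs f i j z = Hs g i j z"
proof -
  have 1: "D k f x = D k g x" if "x \<in> W" for k x
    by (rule dir_deriv_cong[OF that eq])
  have "D i (D j f) z = D i (D j g) z"
    by (rule dir_deriv_cong[OF z 1])
  then show ?thesis unfolding Hs_def using 1[OF z] by simp
qed

lemma Lap_cong: "z \<in> W \<Longrightarrow> (\<And>x. x \<in> W \<Longrightarrow> f x = g x) \<Longrightarrow> Lap f z = Lap g z"
  unfolding Lap_def using Hs_cong[of z f g] by simp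

lemma Lap_add:
  assumes f: "smooth_on W f" and g: "smooth_on W g" and z: "z \<in> W"
  shows "Lap (\<lambda>x. f x + g x) z = Lap f z + Lap g z"
proof -
  have 1: "D k (\<lambda>x. f x + g x) x = D k f x + D k g x" if "x \<in> W" for k x
    using f g that by (simp add: dds)
  have "D i (D j (\<lambda>x. f x + g x)) z = D i (\<lambda>x. D j f x + D j g x) z" for i j
    by (rule dir_deriv_cong[OF z 1])
  then show ?thesis
    unfolding Lap_def Hs_def using f g z
    by (simp add: 1 dds sum.distrib sum_subtractf algebra_simps)
qed

lemma Lap_cmult:
  assumes f: "smooth_on W f" and z: "z \<in> W"
  shows "Lap (\<lambda>x. c * f x) z = c * Lap f z"
proof -
  have 1: "D k (\<lambda>x. c * f x) x = c * D k f x" if "x \<in> W" for k x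
    using f that by (simp add: dds)
  have "D i (D j (\<lambda>x. c * f x)) z = D i (\<lambda>x. c * D j f x) z" for i j
    by (rule dir_deriv_cong[OF z 1])
  then show ?thesis
    unfolding Lap_def Hs_def using f z
    by (simp add: 1 dds sum_distrib_left right_diff_distrib sum_subtractf mult_ac)
qed

text \<open>The case \<phi>(y) = 1/y of \<Delta>\<phi>(f) = \<phi>'(f)\<Delta>f +
  \<phi>''(f)|\<nabla>f|^2. Applied to R + 2, the convexity term is the source of the good term in
  |\<nabla>R|^2.\<close>

lemma Lap_inverse:
  assumes f: "smooth_on W f" and z: "z \<in> W" and pos: "\<And>x. x \<in> W \<Longrightarrow> f x > 0"
  shows "Lap (\<lambda>x. inverse (f x)) z = - Lap f z / (f z)\<^sup>2 + 2 * gsq f z / (f z) ^ 3"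
proof -
  have s: "smooth_on W (\<lambda>x. inverse (f x))"
    using f pos by (intro smooth_intros) (auto dest: less_imp_neq[symmetric])
  have 0: "D k (\<lambda>x. inverse (f x)) x = - (D k f x * (inverse (f x) * inverse (f x)))" if "x \<in> W" for k x
    using dir_deriv_inverse[OF f that] pos[OF that] by (simp add: power2_eq_square divide_inverse)
  have 1: "D i (D j (\<lambda>x. inverse (f x))) z =
      - (D i (D j f) z / (f z)\<^sup>2) + 2 * (D i f z * D j f z / (f z) ^ 3)" for i j
  proof -
    have "D i (D j (\<lambda>x. inverse (f x))) z = D i (\<lambda>x. - (D j f x * (inverse (f x) * inverse (f x)))) z"
      by (rule dir_deriv_cong[OF z 0])
    then show ?thesis
      using f z s pos[OF z]
      by (simp add: dds 0) (simp add: power2_eq_square power3_eq_cube field_simps)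
  qed
  have 2: "Hs (\<lambda>x. inverse (f x)) i j z = - (Hs f i j z / (f z)\<^sup>2) + 2 * (D i f z * D j f z / (f z) ^ 3)" for i j
    unfolding Hs_def 1 0[OF z] using pos[OF z]
    by (simp add: diff_divide_distrib sum_divide_distrib sum_negf power2_eq_square divide_inverse
        right_diff_distrib sum_distrib_left mult_ac)
  have "(\<Sum>i\<in>UNIV. \<Sum>j\<in>UNIV. H i j z * (D i f z * D j f z)) = gsq f z"
    unfolding gsq_def vup_def sum_distrib_right by (simp add: mult_ac)
  then have gsq: "(\<Sum>i\<in>UNIV. \<Sum>j\<in>UNIV. c * (H i j z * (D i f z * D j f z))) = c * gsq f z" for c
    by (simp flip: sum_distrib_left)
  have Lap: "(\<Sum>i\<in>UNIV. \<Sum>j\<in>UNIV. c * (H i j z * Hs f i j z)) = c * Lap f z" for c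
    by (simp add: Lap_def flip: sum_distrib_left)
  have "Lap (\<lambda>x. inverse (f x)) z = (\<Sum>i\<in>UNIV. \<Sum>j\<in>UNIV.
      (- 1 / (f z)\<^sup>2) * (H i j z * Hs f i j z) + (2 / (f z) ^ 3) * (H i j z * (D i f z * D j f z)))"
    unfolding Lap_def 2 by (intro sum.cong refl) (simp add: divide_inverse algebra_simps)
  also have "\<dots> = (- 1 / (f z)\<^sup>2) * Lap f z + (2 / (f z) ^ 3) * gsq f z"
    unfolding sum.distrib gsq Lap by simp
  finally show ?thesis by simp
qed

text \<open>Only covariant tensors contracted with \<open>H\<close> occur, so the factorization of
  \<open>H\<close> does the work of an orthonormal frame: a trace becomes the sum of the diagonal
  entries of \<open>w^T S w\<close>.\<close>

lemma trace_in_frame: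
  assumes w: "\<And>i j. H i j z = (\<Sum>a\<in>UNIV. w i a * w j a)"
  shows "(\<Sum>i\<in>UNIV. \<Sum>j\<in>UNIV. H i j z * S i j) =
    (\<Sum>a\<in>UNIV. \<Sum>i\<in>UNIV. \<Sum>j\<in>UNIV. w i a * (w j a * S i j))"
  unfolding w sum_distribs by ((rule sum_pull, rule sum.cong[OF refl])+, simp only: mult_ac)

lemma inner2_in_frame:
  assumes w: "\<And>i j. H i j z = (\<Sum>a\<in>UNIV. w i a * w j a)"
  shows "inner2 z S T = (\<Sum>a\<in>UNIV. \<Sum>b\<in>UNIV.
    (\<Sum>i\<in>UNIV. \<Sum>j\<in>UNIV. w i a * (w j b * S i j)) * (\<Sum>i\<in>UNIV. \<Sum>j\<in>UNIV. w i a * (w j b * T i j)))"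
proof -
  have "(\<Sum>a\<in>UNIV. \<Sum>b\<in>UNIV.
      (\<Sum>i\<in>UNIV. \<Sum>j\<in>UNIV. w i a * (w j b * S i j)) * (\<Sum>i\<in>UNIV. \<Sum>j\<in>UNIV. w i a * (w j b * T i j)))
    = (\<Sum>a\<in>UNIV. \<Sum>b\<in>UNIV. \<Sum>i\<in>UNIV. \<Sum>j\<in>UNIV. \<Sum>k\<in>UNIV. \<Sum>l\<in>UNIV.
        (w i a * w k a) * ((w j b * w l b) * (S i j * T k l)))"
    by (intro sum.cong refl) (simp only: sum_distrib_right, simp only: sum_distrib_left mult_ac)
  also have "\<dots> = (\<Sum>i\<in>UNIV. \<Sum>j\<in>UNIV. \<Sum>k\<in>UNIV. \<Sum>l\<in>UNIV. \<Sum>a\<in>UNIV. \<Sum>b\<in>UNIV.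
        (w i a * w k a) * ((w j b * w l b) * (S i j * T k l)))"
    by (rule trans[OF sum_swap3], rule sum.cong[OF refl], rule trans[OF sum_swap3], rule sum.cong[OF refl],
        rule trans[OF sum_swap3], rule sum.cong[OF refl], rule trans[OF sum_swap3], rule refl)
  also have "\<dots> = inner2 z S T"
    unfolding inner2_def w by (simp only: sum_distrib_right, simp only: sum_distrib_left mult_ac)
  finally show ?thesis by simp
qed

lemma vup_in_frame:
  assumes w: "\<And>i j. H i j z = (\<Sum>a\<in>UNIV. w i a * w j a)"
  shows "vup f i z = (\<Sum>a\<in>UNIV. w i a * (\<Sum>j\<in>UNIV. w j a * D j f z))"
  unfolding vup_def w sum_distribs by ((rule sum_pull, rule sum.cong[OF refl])+, simp only: mult_ac)

end

section \<open>The evolution of the Li-Yau quantity and its value at a maximum\<close>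

locale heat_chart = ricci_flow_chart W G H
  for W :: "(real \<times> (real^'n::finite)) set" and G H +
  fixes f :: "real \<times> (real^'n) \<Rightarrow> real" and \<delta> \<alpha> \<beta> :: real
  assumes H_psd: "z \<in> W \<Longrightarrow> 0 \<le> (\<Sum>i\<in>UNIV. \<Sum>j\<in>UNIV. x i * x j * H i j z)"
    and smooth_f [simp]: "smooth_on W f"
    and heat: "z \<in> W \<Longrightarrow> Dt f z = Lap f z + gsq f z"
    and Rs_pos: "z \<in> W \<Longrightarrow> Rs z + 2 > 0"
begin

definition LY :: "real \<times> (real^'n) \<Rightarrow> real" where
  "LY z = \<delta> * gsq f z - Dt f z - \<alpha> * Rs z + \<beta> / (Rs z + 2)"

definition rec :: "real \<times> (real^'n) \<Rightarrow> real" where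
  "rec z = inverse (Rs z + 2)"

lemma smooth_rec [simp]: "smooth_on W rec"
  unfolding rec_def[abs_def] using Rs_pos by (intro smooth_intros) (auto dest: less_imp_neq[symmetric])

text \<open>The heat equation eliminates the time derivative of \<open>f\<close>. What remains is a
  combination with constant coefficients of four functions whose evolution is known.\<close>

lemma LY_eq: "z \<in> W \<Longrightarrow>
    LY z = (- 1) * Lap f z + ((\<delta> - 1) * gsq f z + ((- \<alpha>) * Rs z + \<beta> * rec z))"
  by (simp add: LY_def heat rec_def divide_inverse algebra_simps)

lemma smooth_LY [simp]: "smooth_on W LY"
proof -
  have "smooth_on W (\<lambda>z. (- 1) * Lap f z + ((\<delta> - 1) * gsq f z + ((- \<alpha>) * Rs z + \<beta> * rec z)))"
    by simp
  then show ?thesis using smooth_on_cong[of W LY, OF LY_eq] by simp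
qed

lemma dir_deriv_LY:
  assumes z: "z \<in> W"
  shows "dir_deriv v LY z = (- 1) * dir_deriv v (Lap f) z + ((\<delta> - 1) * dir_deriv v (gsq f) z
    + ((- \<alpha>) * dir_deriv v Rs z + \<beta> * dir_deriv v rec z))"
proof -
  have "dir_deriv v LY z = dir_deriv v (\<lambda>z. (- 1) * Lap f z + ((\<delta> - 1) * gsq f z
      + ((- \<alpha>) * Rs z + \<beta> * rec z))) z"
    by (rule dir_deriv_cong[OF z LY_eq])
  then show ?thesis using z by (simp add: dds)
qed

lemma dir_deriv_rec:
  assumes z: "z \<in> W"
  shows "dir_deriv v rec z = - (dir_deriv v Rs z / (Rs z + 2)\<^sup>2)"
proof -
  have "smooth_on W (\<lambda>z. Rs z + 2)" by simp
  from dir_deriv_inverse[OF this z, of v] show ?thesis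
    using Rs_pos[OF z] z by (simp add: rec_def[abs_def] dds)
qed

lemma Lap_rec:
  assumes z: "z \<in> W"
  shows "Lap rec z = - Lap Rs z / (Rs z + 2)\<^sup>2 + 2 * gsq Rs z / (Rs z + 2) ^ 3"
proof -
  have D: "D k (\<lambda>z. Rs z + 2) x = D k Rs x" if "x \<in> W" for k x
    using that by (simp add: dds)
  have "Lap (\<lambda>z. Rs z + 2) z = Lap Rs z + Lap (\<lambda>z. 2) z"
    using z by (intro Lap_add) auto
  moreover have "Lap (\<lambda>z. 2) z = 0"
    using Lap_cmult[of "\<lambda>z. 1" z 0] Lap_cmult[of "\<lambda>z. 1" z 2] z 
    by (simp add: Lap_def Hs_def dir_deriv_const[abs_def])
  moreover have "gsq (\<lambda>z. Rs z + 2) z = gsq Rs z"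
    using z by (simp add: gsq_def vup_def D)
  ultimately show ?thesis
    unfolding rec_def[abs_def] using Lap_inverse[of "\<lambda>z. Rs z + 2" z] z Rs_pos by simp
qed

lemma Lap_LY:
  assumes z: "z \<in> W"
  shows "Lap LY z = (- 1) * Lap (Lap f) z + ((\<delta> - 1) * Lap (gsq f) z
    + ((- \<alpha>) * Lap Rs z + \<beta> * Lap rec z))"
proof -
  have "Lap LY z = Lap (\<lambda>z. (- 1) * Lap f z + ((\<delta> - 1) * gsq f z
      + ((- \<alpha>) * Rs z + \<beta> * rec z))) z"
    by (rule Lap_cong[OF z LY_eq])
  also have "\<dots> = Lap (\<lambda>z. (- 1) * Lap f z) z + (Lap (\<lambda>z. (\<delta> - 1) * gsq f z) z
      + (Lap (\<lambda>z. (- \<alpha>) * Rs z) z + Lap (\<lambda>z. \<beta> * rec z) z))"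
    using z by (simp only: Lap_add smooths smooth_Lap smooth_gsq smooth_f smooth_Rs smooth_rec)
  finally show ?thesis
    using z by (simp only: Lap_cmult smooth_Lap smooth_gsq smooth_f smooth_Rs smooth_rec)
qed

text \<open>When the heat operator acts on |\<nabla>f|^2, the Ricci terms of the flow and of the
  Bochner formula cancel, so Ric(\<nabla>f,\<nabla>f) comes from -\<Delta>f alone and has the
  coefficient -2 for every \<delta>. The Hessian terms of both parts add up to -2\<delta>, and the
  gradients of \<Delta>f and |\<nabla>f|^2 combine to that of F, up to the terms in
  \<nabla>R.\<close>

theorem LY_evolution:
  assumes z: "z \<in> W"
  defines "S \<equiv> \<lambda>i j. Hs f i j z" and "Q \<equiv> \<lambda>i j. Rc i j z"
  shows "Dt LY z - Lap LY z = 2 * (\<Sum>i\<in>UNIV. vup f i z * D i LY z)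
    + 2 * (\<alpha> + \<beta> / (Rs z + 2)\<^sup>2) * (\<Sum>i\<in>UNIV. vup f i z * D i Rs z)
    - 2 * \<delta> * inner2 z S S - 2 * (\<Sum>i\<in>UNIV. \<Sum>j\<in>UNIV. Q i j * (vup f i z * vup f j z))
    - 2 * inner2 z Q S - 2 * \<alpha> * inner2 z Q Q - 2 * \<beta> * inner2 z Q Q / (Rs z + 2)\<^sup>2
    - 2 * \<beta> * gsq Rs z / (Rs z + 2) ^ 3"
proof -
  define vv where "vv g = (\<Sum>i\<in>UNIV. vup f i z * D i g z)" for g
  define q where "q = (\<Sum>i\<in>UNIV. \<Sum>j\<in>UNIV. Q i j * (vup f i z * vup f j z))"
  have s: "smooth_on W (Lap f)" "smooth_on W (gsq f)" by simp_all
  have DDt: "D k (Dt f) z = D k (Lap f) z + D k (gsq f) z" for k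
  proof -
    have "D k (Dt f) z = D k (\<lambda>z. Lap f z + gsq f z) z"
      by (rule dir_deriv_cong[OF z heat])
    then show ?thesis using z by (simp add: dds)
  qed
  have "Lap (Dt f) z = Lap (Lap f) z + Lap (gsq f) z"
    using Lap_cong[OF z heat] Lap_add[OF s z] by simp
  then have 1: "Dt (Lap f) z = Lap (Lap f) z + (2 * inner2 z S S + 2 * vv (Lap f) + 2 * q) + 2 * inner2 z Q S"
    using Dt_Lap[OF smooth_f z] bochner[OF smooth_f z] by (simp add: S_def Q_def vv_def q_def)
  have 2: "Dt (gsq f) z = 2 * vv (Lap f) + 2 * vv (gsq f) + 2 * q"
    using Dt_gsq[OF smooth_f z]
    by (simp add: DDt vv_def q_def Q_def distrib_left sum.distrib)
  have 3: "Lap (gsq f) z = 2 * inner2 z S S + 2 * vv (Lap f) + 2 * q"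
    using bochner[OF smooth_f z] by (simp add: S_def Q_def vv_def q_def)
  have 4: "Dt Rs z = Lap Rs z + 2 * inner2 z Q Q"
    using Dt_Rs[OF z] by (simp add: Q_def)
  have 5: "vv LY = - vv (Lap f) + (\<delta> - 1) * vv (gsq f) - (\<alpha> + \<beta> / (Rs z + 2)\<^sup>2) * vv Rs"
    unfolding vv_def dir_deriv_LY[OF z] dir_deriv_rec[OF z]
    by (simp add: sum_distrib_left algebra_simps sum.distrib sum_subtractf sum_negf sum_divide_distrib)
  note 6 = dir_deriv_LY[OF z, of "(1, 0)"] and 7 = dir_deriv_rec[OF z, of "(1, 0)"]
  show ?thesis
    unfolding vv_def[symmetric] q_def[symmetric] 5 6 7 Lap_LY[OF z] Lap_rec[OF z] 1 2 3 4
    by (simp add: algebra_simps add_divide_distrib diff_divide_distrib)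
qed

text \<open>At a critical point the covariant Hessian is the coordinate one, so \<open>hess\<close>,
  applied to the columns of the frame, gives \<Delta>F \<le> 0. The hypothesis \<open>time\<close>
  is what a maximum at the end of a time interval provides: there the derivative F + \<tau>
  \<partial>_t F of the weighted quantity is nonnegative.\<close>

theorem LY_at_maximum:
  assumes z: "z \<in> W"
    and \<delta>: "1/2 \<le> \<delta>" "\<delta> < 1" and n: "n = real CARD('n)"
    and \<alpha>: "\<alpha> = n / (2 * \<delta> * (1 - \<delta>)^2)" and \<beta>: "\<beta> = \<alpha> * (R1 + 2)^2"
    and R: "-1 \<le> Rs z" "Rs z \<le> R1"
    and \<tau>: "0 < \<tau>" "\<tau> \<le> T"
    and grad: "\<And>i. D i LY z = 0"
    and hess: "\<And>x. (\<Sum>i\<in>UNIV. \<Sum>j\<in>UNIV. x i * (x j * D i (D j LY) z)) \<le> 0"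
    and time: "0 \<le> LY z + \<tau> * Dt LY z"
  shows "\<tau> * LY z \<le> n / (2 * \<delta>) + 4 * n * \<beta> * T / (\<delta> * (1 - \<delta>))"
proof -
  have "\<exists>w. \<forall>i\<in>UNIV. \<forall>j\<in>UNIV. H i j z = (\<Sum>a\<in>(UNIV::'n set). w i a * w j a)"
    by (rule psd_decomposition[where h = "\<lambda>i j. H i j z"]) (auto intro: H_psd[OF z] H_sym[OF z])
  then obtain w where w: "\<And>i j. H i j z = (\<Sum>a\<in>(UNIV::'n set). w i a * w j a)"
    by blast
  define P where "P a b = (\<Sum>i\<in>UNIV. \<Sum>j\<in>UNIV. w i a * (w j b * Hs f i j z))" for a b
  define Q where "Q a b = (\<Sum>i\<in>UNIV. \<Sum>j\<in>UNIV. w i a * (w j b * Rc i j z))" for a b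
  define y where "y a = (\<Sum>j\<in>UNIV. w j a * D j f z)" for a
  define r where "r a = (\<Sum>j\<in>UNIV. w j a * D j Rs z)" for a
  have vup: "vup f i z = (\<Sum>a\<in>UNIV. w i a * y a)" for i
    unfolding y_def by (rule vup_in_frame[OF w])
  have "(\<Sum>i\<in>UNIV. vup f i z * D i f z) = (\<Sum>a\<in>UNIV. y a * y a)"
    unfolding vup sum_distrib_right y_def[of "_::'n"] sum_distrib_left
    by ((rule sum_pull, rule sum.cong[OF refl])+, simp only: mult_ac)
  then have X: "gsq f z = (\<Sum>a\<in>UNIV. (y a)\<^sup>2)"
    by (simp add: gsq_def power2_eq_square)
  have yr: "(\<Sum>i\<in>UNIV. vup f i z * D i Rs z) = (\<Sum>a\<in>UNIV. y a * r a)"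
    unfolding vup r_def sum_distribs by ((rule sum_pull, rule sum.cong[OF refl])+, simp only: mult_ac)
  have rr: "gsq Rs z = (\<Sum>a\<in>UNIV. r a * r a)"
  proof -
    have "vup Rs i z = (\<Sum>a\<in>UNIV. w i a * r a)" for i
      unfolding r_def by (rule vup_in_frame[OF w])
    then have "gsq Rs z = (\<Sum>i\<in>UNIV. \<Sum>a\<in>UNIV. w i a * r a * D i Rs z)"
      by (simp add: gsq_def sum_distrib_right)
    also have "\<dots> = (\<Sum>a\<in>UNIV. r a * (\<Sum>i\<in>UNIV. w i a * D i Rs z))"
      unfolding sum_distrib_left by ((rule sum_pull, rule sum.cong[OF refl])+, simp only: mult_ac)
    finally show ?thesis by (simp add: r_def)
  qed
  have qyy: "(\<Sum>i\<in>UNIV. \<Sum>j\<in>UNIV. Rc i j z * (vup f i z * vup f j z)) =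
      (\<Sum>a\<in>UNIV. \<Sum>b\<in>UNIV. Q a b * (y a * y b))"
    unfolding vup Q_def sum_distribs by ((rule sum_pull, rule sum.cong[OF refl])+, simp only: mult_ac)
  have tr: "Lap f z = (\<Sum>a\<in>UNIV. P a a)" "Rs z = (\<Sum>a\<in>UNIV. Q a a)"
    unfolding Lap_def Rs_def P_def Q_def by (rule trace_in_frame[OF w])+
  have in2: "inner2 z (\<lambda>i j. Hs f i j z) (\<lambda>i j. Hs f i j z) = (\<Sum>a\<in>UNIV. \<Sum>b\<in>UNIV. P a b * P a b)"
    "inner2 z (\<lambda>i j. Rc i j z) (\<lambda>i j. Hs f i j z) = (\<Sum>a\<in>UNIV. \<Sum>b\<in>UNIV. Q a b * P a b)"
    "inner2 z (\<lambda>i j. Rc i j z) (\<lambda>i j. Rc i j z) = (\<Sum>a\<in>UNIV. \<Sum>b\<in>UNIV. Q a b * Q a b)"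
    unfolding P_def Q_def by (rule inner2_in_frame[OF w])+
  have LapLY: "Lap LY z \<le> 0"
  proof -
    have "Lap LY z = (\<Sum>i\<in>UNIV. \<Sum>j\<in>UNIV. H i j z * D i (D j LY) z)"
      unfolding Lap_def Hs_def grad by simp
    also have "\<dots> = (\<Sum>a\<in>UNIV. \<Sum>i\<in>UNIV. \<Sum>j\<in>UNIV. w i a * (w j a * D i (D j LY) z))"
      by (rule trace_in_frame[OF w])
    also have "\<dots> \<le> 0" by (intro sum_nonpos hess)
    finally show ?thesis .
  qed
  have LY: "LY z = - (\<Sum>a\<in>UNIV. P a a) - (1 - \<delta>) * gsq f z - \<alpha> * Rs z + \<beta> / (Rs z + 2)"
    unfolding LY_def heat[OF z] tr(1) by (simp add: algebra_simps)
  have \<delta>0: "0 < \<delta>" using \<delta> by simp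
  have n1: "1 \<le> n" using n by simp
  have \<beta>0: "0 \<le> \<beta>" unfolding \<beta> \<alpha> using n1 \<delta>0 \<delta> by simp
  show ?thesis
  proof (rule maximum_value_bound[OF n1 \<delta>0 \<delta>(2) \<beta>0 \<tau>])
    assume ge: "2 * \<beta> + n * \<beta> / (2 * \<delta> * (1 - \<delta>)) \<le> LY z"
    have "Dt LY z - Lap LY z \<le> - (2 * \<delta> / n) * (LY z - 2 * \<beta>)\<^sup>2"
      unfolding LY_evolution[OF z] in2 yr rr qyy
      using reaction_bound[where P = P and Q = Q and y = y and r = r, OF \<delta> n \<alpha> \<beta> tr(2) R X LY ge] by (simp add: grad)
    then have "Dt LY z \<le> - (2 * \<delta> / n) * (LY z - 2 * \<beta>)\<^sup>2" using LapLY by simp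
    moreover have "- LY z / \<tau> \<le> Dt LY z"
      unfolding pos_divide_le_eq[OF \<tau>(1)] using time by (simp add: mult.commute)
    ultimately show "- LY z / \<tau> \<le> - (2 * \<delta> / n) * (LY z - 2 * \<beta>)\<^sup>2" by simp
  qed
qed

end

section \<open>Change of coordinates\<close>

lemma smooth_on_slice:
  assumes "smooth_on (I \<times> S) K" "t \<in> I"
  shows "smooth_on S (\<lambda>x. K (t, x))"
proof -
  have "Ck_on k (I \<times> S) K \<Longrightarrow> Ck_on k S (\<lambda>x. K (t, x))" for k
  proof (induction k arbitrary: K)
    case 0
    then show ?case
      using assms(2) by (auto intro!: continuous_on_compose2[of "I \<times> S" K] continuous_intros)
  next
    case (Suc k)
    then obtain K' where K': "\<forall>z\<in>I \<times> S. (K has_derivative K' z) (at z within I \<times> S)"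
        "\<forall>v. Ck_on k (I \<times> S) (\<lambda>z. K' z v)"
      by auto
    have "((\<lambda>x. K (t, x)) has_derivative (\<lambda>h. K' (t, x) (0, h))) (at x within S)" if "x \<in> S" for x
    proof (rule has_derivative_in_compose[where f = "\<lambda>x. (t, x)" and f' = "\<lambda>h. (0, h)"])
      show "((\<lambda>x. (t, x)) has_derivative (\<lambda>h. (0, h))) (at x within S)"
        by (auto intro!: derivative_eq_intros)
      show "(K has_derivative K' (t, x)) (at (t, x) within (\<lambda>x. (t, x)) ` S)"
        using K'(1) that assms(2) by (auto intro: has_derivative_subset[of K _ _ "I \<times> S"])
    qed
    with K'(2) Suc.IH show ?case by (auto intro!: exI[of _ "\<lambda>x h. K' (t, x) (0, h)"])
  qed
  with assms(1) show ?thesis by (simp add: smooth_on_def)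
qed

lemma chain_rule_components:
  fixes \<phi> :: "'a::real_normed_vector \<Rightarrow> real^'n"
  assumes "open S" "smooth_on S K" "open V" "\<And>a. smooth_on V (\<lambda>x. \<phi> x $ a)" "x \<in> V" "\<phi> x \<in> S"
  shows "dir_deriv v (\<lambda>x. K (\<phi> x)) x = (\<Sum>a\<in>UNIV. dir_deriv v (\<lambda>x. \<phi> x $ a) x * dir_deriv (axis a 1) K (\<phi> x))"
    and "((\<lambda>x. K (\<phi> x)) has_derivative (\<lambda>v. dir_deriv v (\<lambda>x. K (\<phi> x)) x)) (at x)"
proof -
  define \<phi>' where "\<phi>' v = (\<chi> a. dir_deriv v (\<lambda>x. \<phi> x $ a) x)" for v
  have "(\<phi> has_derivative \<phi>') (at x)"
    unfolding has_derivative_componentwise_within[of \<phi>]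
    using smooth_on_has_derivative[OF assms(3,4,5)]
    by (auto simp: Basis_vec_def inner_axis \<phi>'_def)
  then have *: "((\<lambda>x. K (\<phi> x)) has_derivative (\<lambda>v. dir_deriv (\<phi>' v) K (\<phi> x))) (at x)"
    by (rule has_derivative_compose) (rule smooth_on_has_derivative[OF assms(1,2,6)])
  then have eq: "dir_deriv v (\<lambda>x. K (\<phi> x)) x = dir_deriv (\<phi>' v) K (\<phi> x)" for v
    by (rule dir_derivI)
  have "\<phi>' v = (\<Sum>a\<in>UNIV. dir_deriv v (\<lambda>x. \<phi> x $ a) x *\<^sub>R axis a 1)"
    using basis_expansion[of "\<phi>' v"] by (simp add: \<phi>'_def scalar_mult_eq_scaleR)
  then show "dir_deriv v (\<lambda>x. K (\<phi> x)) x = (\<Sum>a\<in>UNIV. dir_deriv v (\<lambda>x. \<phi> x $ a) x * dir_deriv (axis a 1) K (\<phi> x))"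
    unfolding eq using assms by (simp add: dir_deriv_sum_dir dir_deriv_scaleR)
  show "((\<lambda>x. K (\<phi> x)) has_derivative (\<lambda>v. dir_deriv v (\<lambda>x. K (\<phi> x)) x)) (at x)"
    using * by (simp add: eq)
qed

text \<open>By the chain rule the derivatives of the composition are sums of products of derivatives
  of the components with compositions of the same kind, so the induction runs over all smooth
  \<open>K\<close> at once.\<close>

lemma smooth_on_compose_components:
  fixes \<phi> :: "'a::real_normed_vector \<Rightarrow> real^'n" and K :: "real^'n \<Rightarrow> real"
  assumes "open S" "smooth_on S K" "open V" "\<And>a. smooth_on V (\<lambda>x. \<phi> x $ a)" "\<And>x. x \<in> V \<Longrightarrow> \<phi> x \<in> S"
  shows "smooth_on V (\<lambda>x. K (\<phi> x))"
proof -
  have "smooth_on S K \<Longrightarrow> Ck_on k V (\<lambda>x. K (\<phi> x))" for k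
  proof (induction k arbitrary: K)
    case 0
    then show ?case
      using chain_rule_components(2)[OF assms(1) 0 assms(3,4)] assms(3,5)
      by (auto simp: continuous_on_eq_continuous_at intro: has_derivative_continuous)
  next
    case (Suc k)
    have "smooth_on V (dir_deriv v (\<lambda>x. \<phi> x $ a))" for v a
      using assms by (intro smooth_on_dir_deriv)
    then have "Ck_on k V (dir_deriv v (\<lambda>x. \<phi> x $ a))" for v a
      by (simp add: smooth_on_def)
    moreover have "Ck_on k V (\<lambda>x. dir_deriv (axis a 1) K (\<phi> x))" for a
      using Suc assms by (intro Suc.IH smooth_on_dir_deriv)
    ultimately have 1: "Ck_on k V (\<lambda>x. dir_deriv v (\<lambda>x. \<phi> x $ a) x * dir_deriv (axis a 1) K (\<phi> x))" for v a
      by (rule Ck_on_mult)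
    have "Ck_on k V (\<lambda>x. \<Sum>a\<in>I. dir_deriv v (\<lambda>x. \<phi> x $ a) x * dir_deriv (axis a 1) K (\<phi> x))" for I v
      by (induction I rule: infinite_finite_induct) (auto intro: Ck_on_add 1)
    then have "Ck_on k V (\<lambda>x. dir_deriv v (\<lambda>x. K (\<phi> x)) x)" for v
      using chain_rule_components(1)[OF assms(1) Suc.prems assms(3,4)] assms(5)
        Ck_on_cong[of V "\<lambda>x. dir_deriv v (\<lambda>x. K (\<phi> x)) x"] by auto
    moreover have "((\<lambda>x. K (\<phi> x)) has_derivative (\<lambda>v. dir_deriv v (\<lambda>x. K (\<phi> x)) x)) (at x within V)"
      if "x \<in> V" for x
      using chain_rule_components(2)[OF assms(1) Suc.prems assms(3,4)] assms(5) that
      by (auto intro: has_derivative_at_withinI)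
    ultimately show ?case
      by (auto intro!: exI[of _ "\<lambda>x v. dir_deriv v (\<lambda>x. K (\<phi> x)) x"])
  qed
  with assms(2) show ?thesis by (simp add: smooth_on_def)
qed

text \<open>The formula of \<open>Gam\<close> without time, as changes of chart are compared at one
  fixed time.\<close>

definition coord_gamma ::
  "('n \<Rightarrow> 'n \<Rightarrow> real^'n \<Rightarrow> real) \<Rightarrow> ('n \<Rightarrow> 'n \<Rightarrow> real^'n \<Rightarrow> real) \<Rightarrow> 'n \<Rightarrow> 'n \<Rightarrow> 'n::finite \<Rightarrow> real^'n \<Rightarrow> real" where
  "coord_gamma G H k i j x = (\<Sum>l\<in>UNIV. H k l x *
    (dir_deriv (axis i 1) (G j l) x + dir_deriv (axis j 1) (G i l) x - dir_deriv (axis l 1) (G i j) x)) / 2"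

definition coord_hessian ::
  "('n \<Rightarrow> 'n \<Rightarrow> real^'n \<Rightarrow> real) \<Rightarrow> ('n \<Rightarrow> 'n \<Rightarrow> real^'n \<Rightarrow> real) \<Rightarrow> (real^'n \<Rightarrow> real) \<Rightarrow> 'n \<Rightarrow> 'n::finite \<Rightarrow> real^'n \<Rightarrow> real" where
  "coord_hessian G H f i j x = dir_deriv (axis i 1) (dir_deriv (axis j 1) f) x
    - (\<Sum>k\<in>UNIV. coord_gamma G H k i j x * dir_deriv (axis k 1) f x)"

text \<open>\<open>h\<close> and \<open>k\<close> are a metric and its inverse on the target of \<open>\<phi>\<close>; \<open>G\<close> is the pullback of \<open>h\<close>.\<close>

locale coordinate_change = smooth_calculus V
  for V :: "(real^'n::finite) set" +
  fixes S :: "(real^'n) set" and \<phi> :: "real^'n \<Rightarrow> real^'n"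
    and h k G H :: "'n \<Rightarrow> 'n \<Rightarrow> real^'n \<Rightarrow> real"
  assumes open_S: "open S" and maps: "x \<in> V \<Longrightarrow> \<phi> x \<in> S"
    and smooth_\<phi>: "smooth_on V (\<lambda>x. \<phi> x $ a)"
    and smooth_h: "smooth_on S (h a b)"
    and h_sym: "y \<in> S \<Longrightarrow> h a b y = h b a y"
    and k_h: "y \<in> S \<Longrightarrow> (\<Sum>b\<in>UNIV. k a b y * h b c y) = (if a = c then 1 else 0)"
    and G_eq: "x \<in> V \<Longrightarrow> G i j x = (\<Sum>a\<in>UNIV. \<Sum>b\<in>UNIV. dir_deriv (axis i 1) (\<lambda>x. \<phi> x $ a) x *
        (dir_deriv (axis j 1) (\<lambda>x. \<phi> x $ b) x * h a b (\<phi> x)))"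
    and k_eq: "x \<in> V \<Longrightarrow> k a b (\<phi> x) = (\<Sum>i\<in>UNIV. \<Sum>j\<in>UNIV. dir_deriv (axis i 1) (\<lambda>x. \<phi> x $ a) x *
        (dir_deriv (axis j 1) (\<lambda>x. \<phi> x $ b) x * H i j x))"
begin

definition J :: "'n \<Rightarrow> 'n \<Rightarrow> real^'n \<Rightarrow> real" where
  "J a i = dir_deriv (axis i 1) (\<lambda>x. \<phi> x $ a)"

lemma smooth_J: "smooth_on V (J a i)"
  unfolding J_def using smooth_\<phi> by (intro smooth_dir_deriv)

lemma smooth_pull:
  fixes K :: "real^'n \<Rightarrow> real"
  assumes "smooth_on S K"
  shows "smooth_on V (\<lambda>x. K (\<phi> x))"
  by (rule smooth_on_compose_components[where \<phi> = \<phi>, OF open_S assms open_W smooth_\<phi> maps])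

lemma D_pull:
  "smooth_on S K \<Longrightarrow> x \<in> V \<Longrightarrow>
    dir_deriv (axis i 1) (\<lambda>x. K (\<phi> x)) x = (\<Sum>a\<in>UNIV. J a i x * dir_deriv (axis a 1) K (\<phi> x))"
  unfolding J_def using chain_rule_components(1)[OF open_S _ open_W smooth_\<phi>] maps by blast

lemma smooth_D: "smooth_on S K \<Longrightarrow> smooth_on S (dir_deriv v K)"
  by (rule smooth_on_dir_deriv[OF open_S])

lemmas smooths [simp] = smooth_on_mult smooth_on_sum smooth_J smooth_pull smooth_h smooth_D smooth_dir_deriv

lemma D_J_commute: "x \<in> V \<Longrightarrow> dir_deriv (axis j 1) (J a i) x = dir_deriv (axis i 1) (J a j) x"
  unfolding J_def using smooth_\<phi> by (intro dir_deriv_commute')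

lemma D_G:
  assumes x: "x \<in> V"
  shows "dir_deriv (axis l 1) (G i j) x =
      (\<Sum>a\<in>UNIV. \<Sum>b\<in>UNIV. dir_deriv (axis l 1) (J a i) x * (J b j x * h a b (\<phi> x)))
    + (\<Sum>a\<in>UNIV. \<Sum>b\<in>UNIV. dir_deriv (axis l 1) (J a j) x * (J b i x * h a b (\<phi> x)))
    + (\<Sum>a\<in>UNIV. \<Sum>b\<in>UNIV. \<Sum>e\<in>UNIV. J a i x * (J b j x * (J e l x * dir_deriv (axis e 1) (h a b) (\<phi> x))))"
proof -
  have "dir_deriv (axis l 1) (G i j) x =
      dir_deriv (axis l 1) (\<lambda>x. \<Sum>a\<in>UNIV. \<Sum>b\<in>UNIV. J a i x * (J b j x * h a b (\<phi> x))) x"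
    by (rule dir_deriv_cong_open[OF open_W x]) (simp add: G_eq J_def)
  also have "\<dots> = (\<Sum>a\<in>UNIV. \<Sum>b\<in>UNIV. dir_deriv (axis l 1) (J a i) x * (J b j x * h a b (\<phi> x)))
    + (\<Sum>a\<in>UNIV. \<Sum>b\<in>UNIV. dir_deriv (axis l 1) (J b j) x * (J a i x * h a b (\<phi> x)))
    + (\<Sum>a\<in>UNIV. \<Sum>b\<in>UNIV. \<Sum>e\<in>UNIV. J a i x * (J b j x * (J e l x * dir_deriv (axis e 1) (h a b) (\<phi> x))))"
    using x by (simp add: dir_deriv_rules dir_deriv_sum D_pull sum.distrib sum_distrib_left distrib_left mult_ac)
  also have "(\<Sum>a\<in>UNIV. \<Sum>b\<in>UNIV. dir_deriv (axis l 1) (J b j) x * (J a i x * h a b (\<phi> x))) =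
      (\<Sum>a\<in>UNIV. \<Sum>b\<in>UNIV. dir_deriv (axis l 1) (J a j) x * (J b i x * h a b (\<phi> x)))"
    by ((rule sum_pull, rule sum.cong[OF refl])+, use h_sym[OF maps[OF x]] in \<open>simp add: mult_ac\<close>)
  finally show ?thesis .
qed

text \<open>The inhomogeneous transformation law of the Christoffel symbols. It is contracted with
  the Jacobian so that \<open>k_eq\<close>, which pushes \<open>H\<close> forward to
  \<open>k\<close>, applies and no inverse Jacobian appears; the second derivatives of \<phi>
  combine by \<open>D_J_commute\<close>.\<close>

lemma J_gamma:
  assumes x: "x \<in> V"
  shows "(\<Sum>p\<in>UNIV. J m p x * coord_gamma G H p i j x) = dir_deriv (axis i 1) (J m j) x
    + (\<Sum>a\<in>UNIV. \<Sum>b\<in>UNIV. J a i x * (J b j x * coord_gamma h k m a b (\<phi> x)))"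
proof -
  define c where "c a b e = dir_deriv (axis a 1) (h b e) (\<phi> x) + dir_deriv (axis b 1) (h a e) (\<phi> x)
      - dir_deriv (axis e 1) (h a b) (\<phi> x)" for a b e
  have low: "dir_deriv (axis i 1) (G j l) x + dir_deriv (axis j 1) (G i l) x - dir_deriv (axis l 1) (G i j) x =
      2 * (\<Sum>a\<in>UNIV. \<Sum>b\<in>UNIV. dir_deriv (axis i 1) (J a j) x * (J b l x * h a b (\<phi> x)))
      + (\<Sum>a\<in>UNIV. \<Sum>b\<in>UNIV. \<Sum>e\<in>UNIV. J a i x * (J b j x * (J e l x * c a b e)))" for l
  proof -
    have 1: "(\<Sum>a\<in>UNIV. \<Sum>b\<in>UNIV. \<Sum>e\<in>UNIV. J a j x * (J b l x * (J e i x * dir_deriv (axis e 1) (h a b) (\<phi> x))))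
        = (\<Sum>a\<in>UNIV. \<Sum>b\<in>UNIV. \<Sum>e\<in>UNIV. J a i x * (J b j x * (J e l x * dir_deriv (axis a 1) (h b e) (\<phi> x))))"
      by ((rule sum_pull, rule sum.cong[OF refl])+, simp only: mult_ac)
    have 2: "(\<Sum>a\<in>UNIV. \<Sum>b\<in>UNIV. \<Sum>e\<in>UNIV. J a i x * (J b l x * (J e j x * dir_deriv (axis e 1) (h a b) (\<phi> x))))
        = (\<Sum>a\<in>UNIV. \<Sum>b\<in>UNIV. \<Sum>e\<in>UNIV. J a i x * (J b j x * (J e l x * dir_deriv (axis b 1) (h a e) (\<phi> x))))"
      by ((rule sum_pull, rule sum.cong[OF refl])+, simp only: mult_ac)
    show ?thesis
      unfolding D_G[OF x] 1 2 c_def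
      using D_J_commute[OF x, of l] D_J_commute[OF x, of j _ i]
      by (simp add: distrib_left right_diff_distrib sum.distrib sum_subtractf)
  qed
  have 1: "(\<Sum>p\<in>UNIV. \<Sum>l\<in>UNIV. \<Sum>a\<in>UNIV. \<Sum>b\<in>UNIV.
        J m p x * (H p l x * (dir_deriv (axis i 1) (J a j) x * (J b l x * h a b (\<phi> x)))))
      = dir_deriv (axis i 1) (J m j) x"
  proof -
    have "(\<Sum>p\<in>UNIV. \<Sum>l\<in>UNIV. \<Sum>a\<in>UNIV. \<Sum>b\<in>UNIV.
        J m p x * (H p l x * (dir_deriv (axis i 1) (J a j) x * (J b l x * h a b (\<phi> x)))))
       = (\<Sum>a\<in>UNIV. dir_deriv (axis i 1) (J a j) x * (\<Sum>b\<in>UNIV. k m b (\<phi> x) * h b a (\<phi> x)))"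
      unfolding k_eq[OF x] J_def[symmetric] sum_distribs
      by ((rule sum_pull, rule sum.cong[OF refl])+, use h_sym[OF maps[OF x]] in \<open>simp add: mult_ac\<close>)
    then show ?thesis by (simp add: k_h[OF maps[OF x]] if_distrib[of "\<lambda>y. _ * y"] cong: if_cong)
  qed
  have 2: "(\<Sum>p\<in>UNIV. \<Sum>l\<in>UNIV. \<Sum>a\<in>UNIV. \<Sum>b\<in>UNIV. \<Sum>e\<in>UNIV.
        J m p x * (H p l x * (J a i x * (J b j x * (J e l x * c a b e)))))
      = (\<Sum>a\<in>UNIV. \<Sum>b\<in>UNIV. \<Sum>e\<in>UNIV. J a i x * (J b j x * (k m e (\<phi> x) * c a b e)))"
    unfolding k_eq[OF x] J_def[symmetric] sum_distribs
    by (rule trans[OF sum_swap3], rule sum.cong[OF refl], rule trans[OF sum_swap3], rule sum.cong[OF refl],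
      rule trans[OF sum_swap3], rule sum.cong[OF refl], (rule sum.cong[OF refl])+, simp only: mult_ac)
  have "(\<Sum>p\<in>UNIV. J m p x * coord_gamma G H p i j x) =
      (\<Sum>p\<in>UNIV. \<Sum>l\<in>UNIV. \<Sum>a\<in>UNIV. \<Sum>b\<in>UNIV.
        J m p x * (H p l x * (dir_deriv (axis i 1) (J a j) x * (J b l x * h a b (\<phi> x)))))
      + (\<Sum>p\<in>UNIV. \<Sum>l\<in>UNIV. \<Sum>a\<in>UNIV. \<Sum>b\<in>UNIV. \<Sum>e\<in>UNIV.
        J m p x * (H p l x * (J a i x * (J b j x * (J e l x * c a b e))))) / 2"
    unfolding coord_gamma_def low
    by (simp add: distrib_left sum.distrib sum_distrib_left sum_divide_distrib add_divide_distrib mult_ac)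
  then show ?thesis
    unfolding 1 2 coord_gamma_def c_def[symmetric]
    by (simp add: sum_distrib_left sum_divide_distrib)
qed

text \<open>The second derivatives of \<phi> produced by the chain rule are exactly the
  inhomogeneous term of \<open>J_gamma\<close>; they cancel, and the Hessian transforms as a
  tensor.\<close>

lemma coord_hessian_pull:
  assumes f: "smooth_on S f" and x: "x \<in> V"
  shows "coord_hessian G H (\<lambda>x. f (\<phi> x)) i j x =
    (\<Sum>a\<in>UNIV. \<Sum>b\<in>UNIV. J a i x * (J b j x * coord_hessian h k f a b (\<phi> x)))"
proof -
  have "dir_deriv (axis i 1) (dir_deriv (axis j 1) (\<lambda>x. f (\<phi> x))) x =
      dir_deriv (axis i 1) (\<lambda>x. \<Sum>b\<in>UNIV. J b j x * dir_deriv (axis b 1) f (\<phi> x)) x"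
    by (rule dir_deriv_cong_open[OF open_W x D_pull[OF f]])
  also have "\<dots> = (\<Sum>b\<in>UNIV. dir_deriv (axis i 1) (J b j) x * dir_deriv (axis b 1) f (\<phi> x))
     + (\<Sum>b\<in>UNIV. \<Sum>a\<in>UNIV. J b j x * (J a i x * dir_deriv (axis a 1) (dir_deriv (axis b 1) f) (\<phi> x)))"
    using f x by (simp add: dir_deriv_rules dir_deriv_sum D_pull[of "dir_deriv _ f"] sum.distrib sum_distrib_left)
  also have "(\<Sum>b\<in>UNIV. \<Sum>a\<in>UNIV. J b j x * (J a i x * dir_deriv (axis a 1) (dir_deriv (axis b 1) f) (\<phi> x))) =
      (\<Sum>a\<in>UNIV. \<Sum>b\<in>UNIV. J a i x * (J b j x * dir_deriv (axis a 1) (dir_deriv (axis b 1) f) (\<phi> x)))"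
    by ((rule sum_pull, rule sum.cong[OF refl])+, simp only: mult_ac)
  finally have 1: "dir_deriv (axis i 1) (dir_deriv (axis j 1) (\<lambda>x. f (\<phi> x))) x =
      (\<Sum>b\<in>UNIV. dir_deriv (axis i 1) (J b j) x * dir_deriv (axis b 1) f (\<phi> x)) +
      (\<Sum>a\<in>UNIV. \<Sum>b\<in>UNIV. J a i x * (J b j x * dir_deriv (axis a 1) (dir_deriv (axis b 1) f) (\<phi> x)))" .
  have "(\<Sum>p\<in>UNIV. coord_gamma G H p i j x * dir_deriv (axis p 1) (\<lambda>x. f (\<phi> x)) x) =
      (\<Sum>m\<in>UNIV. (\<Sum>p\<in>UNIV. J m p x * coord_gamma G H p i j x) * dir_deriv (axis m 1) f (\<phi> x))"
    unfolding D_pull[OF f x] sum_distribs by ((rule sum_pull, rule sum.cong[OF refl])+, simp only: mult_ac)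
  also have "\<dots> = (\<Sum>b\<in>UNIV. dir_deriv (axis i 1) (J b j) x * dir_deriv (axis b 1) f (\<phi> x))
      + (\<Sum>m\<in>UNIV. \<Sum>a\<in>UNIV. \<Sum>b\<in>UNIV. J a i x * (J b j x * coord_gamma h k m a b (\<phi> x)) * dir_deriv (axis m 1) f (\<phi> x))"
    unfolding J_gamma[OF x] by (simp add: distrib_right sum.distrib sum_distrib_right)
  also have "(\<Sum>m\<in>UNIV. \<Sum>a\<in>UNIV. \<Sum>b\<in>UNIV. J a i x * (J b j x * coord_gamma h k m a b (\<phi> x)) * dir_deriv (axis m 1) f (\<phi> x)) =
      (\<Sum>a\<in>UNIV. \<Sum>b\<in>UNIV. \<Sum>m\<in>UNIV. J a i x * (J b j x * (coord_gamma h k m a b (\<phi> x) * dir_deriv (axis m 1) f (\<phi> x))))"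
    by ((rule sum_pull, rule sum.cong[OF refl])+, simp only: mult_ac)
  finally show ?thesis
    unfolding coord_hessian_def 1
    by (simp add: right_diff_distrib sum_subtractf sum_distrib_left)
qed

lemma trace_pull:
  assumes x: "x \<in> V"
  shows "(\<Sum>i\<in>UNIV. \<Sum>j\<in>UNIV. H i j x * (\<Sum>a\<in>UNIV. \<Sum>b\<in>UNIV. J a i x * (J b j x * Q a b))) =
    (\<Sum>a\<in>UNIV. \<Sum>b\<in>UNIV. k a b (\<phi> x) * Q a b)"
  unfolding k_eq[OF x] J_def[symmetric] sum_distribs
  by ((rule sum_pull, rule sum.cong[OF refl])+, simp only: mult_ac)

end

section \<open>The inverse of a positive definite matrix field\<close>

lemma matrix_inv_unique:
  fixes M B :: "real^'n::finite^'n"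
  assumes "B ** M = mat 1"
  shows "matrix_inv M = B"
proof -
  have "M ** matrix_inv M = mat 1 \<and> matrix_inv M ** M = mat 1"
    unfolding matrix_inv_def using assms matrix_left_right_inverse[of M B]
    by (intro someI_ex[of "\<lambda>X. M ** X = mat 1 \<and> X ** M = mat 1"]) blast
  then show ?thesis
    using assms by (metis matrix_mul_assoc matrix_mul_lid matrix_mul_rid)
qed

lemma matrix_inv_mult:
  fixes M :: "real^'n::finite^'n"
  assumes "\<And>v. v \<noteq> 0 \<Longrightarrow> 0 < v \<bullet> (M *v v)"
  shows "matrix_inv M ** M = mat 1" "M ** matrix_inv M = mat 1" "det M \<noteq> 0"
proof -
  have "M *v x = 0 \<Longrightarrow> x = 0" for x
    using assms[of x] by auto
  then obtain B where B: "B ** M = mat 1"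
    using matrix_left_invertible_ker[of M] by blast
  then show 1: "matrix_inv M ** M = mat 1"
    using matrix_inv_unique by blast
  then show "M ** matrix_inv M = mat 1"
    using matrix_left_right_inverse by blast
  show "det M \<noteq> 0"
    using 1 invertible_det_nz invertible_left_inverse by blast
qed

lemma matrix_inv_symmetric:
  fixes M :: "real^'n::finite^'n"
  assumes "transpose M = M" "\<And>v. v \<noteq> 0 \<Longrightarrow> 0 < v \<bullet> (M *v v)"
  shows "matrix_inv M $ i $ j = matrix_inv M $ j $ i"
proof -
  have "transpose (matrix_inv M) ** M = transpose (M ** matrix_inv M)"
    by (simp add: matrix_transpose_mul assms(1))
  also have "\<dots> = mat 1"
    by (simp add: matrix_inv_mult[OF assms(2)] transpose_mat)
  finally have "matrix_inv M = transpose (matrix_inv M)"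
    by (rule matrix_inv_unique)
  then have "matrix_inv M $ i $ j = transpose (matrix_inv M) $ i $ j"
    by simp
  then show ?thesis by (simp add: transpose_def)
qed

text \<open>Substituting v = My, the form of the inverse at \<open>v\<close> is the form of
  \<open>M\<close> at \<open>y\<close>.\<close>

lemma matrix_inv_psd:
  fixes M :: "real^'n::finite^'n"
  assumes "\<And>v. v \<noteq> 0 \<Longrightarrow> 0 < v \<bullet> (M *v v)"
  shows "0 \<le> (\<Sum>i\<in>UNIV. \<Sum>j\<in>UNIV. x i * x j * matrix_inv M $ i $ j)"
proof -
  define v :: "real^'n" where "v = (\<chi> i. x i)"
  define y where "y = matrix_inv M *v v"
  have "M *v y = v"
    by (simp add: y_def matrix_vector_mul_assoc matrix_inv_mult[OF assms])
  moreover have "0 \<le> y \<bullet> (M *v y)"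
    using assms[of y] by (cases "y = 0") (auto intro: less_imp_le)
  ultimately have "0 \<le> v \<bullet> y"
    by (simp add: inner_commute)
  also have "v \<bullet> y = (\<Sum>i\<in>UNIV. \<Sum>j\<in>UNIV. x i * x j * matrix_inv M $ i $ j)"
    by (simp add: inner_vec_def y_def v_def matrix_vector_mult_def sum_distrib_left mult_ac)
  finally show ?thesis .
qed

lemma smooth_on_det:
  fixes M :: "'a::real_normed_vector \<Rightarrow> real^'n::finite^'n"
  assumes "\<And>i j. smooth_on S (\<lambda>z. M z $ i $ j)"
  shows "smooth_on S (\<lambda>z. det (M z))"
  unfolding det_def by (intro smooth_intros assms)

text \<open>Cramer's rule writes each entry as a quotient of determinants, which are polynomials in
  matrix entries, with a nonvanishing denominator.\<close>

lemma smooth_on_matrix_inv: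
  fixes M :: "'a::real_normed_vector \<Rightarrow> real^'n::finite^'n"
  assumes M: "\<And>i j. smooth_on S (\<lambda>z. M z $ i $ j)"
    and pos: "\<And>z v. z \<in> S \<Longrightarrow> v \<noteq> 0 \<Longrightarrow> 0 < v \<bullet> (M z *v v)"
  shows "smooth_on S (\<lambda>z. matrix_inv (M z) $ i $ j)"
proof -
  \<comment> \<open>The numerator matrix for the coordinate \<open>i\<close> of the solution
    \<open>x\<close> of \<open>M z *v x = axis j 1\<close>, that is, of column \<open>j\<close> of
    the inverse.\<close>
  define B where "B z = (\<chi> a b. if b = i then axis j 1 $ a else M z $ a $ b)" for z
  have "smooth_on S (\<lambda>z. B z $ a $ b)" for a b
    using M by (cases "b = i") (simp_all add: B_def)
  then have "smooth_on S (\<lambda>z. det (B z) / det (M z))"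
    using matrix_inv_mult(3)[OF pos] by (intro smooth_intros smooth_on_det M) auto
  moreover have "matrix_inv (M z) $ i $ j = det (B z) / det (M z)" if "z \<in> S" for z
  proof -
    have "M z *v (matrix_inv (M z) *v axis j 1) = axis j 1"
      by (simp add: matrix_vector_mul_assoc matrix_inv_mult[OF pos[OF that]])
    then have "matrix_inv (M z) *v axis j 1 =
        (\<chi> k. det (\<chi> a b. if b = k then axis j 1 $ a else M z $ a $ b) / det (M z))"
      using cramer[OF matrix_inv_mult(3)[OF pos[OF that]]] by blast
    then have "(matrix_inv (M z) *v axis j 1) $ i = det (B z) / det (M z)"
      by (simp add: B_def)
    then show ?thesis
      by (simp add: matrix_vector_mult_basis column_def)
  qed
  ultimately show ?thesis
    using smooth_on_cong[of S "\<lambda>z. matrix_inv (M z) $ i $ j"] by simp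
qed

section \<open>Chart independence\<close>

lemma chart_inv_snd: "is_chart c \<Longrightarrow> q \<in> fst c \<Longrightarrow> chart_inv c (snd c q) = q"
  unfolding is_chart_def using homeomorphism_apply1 by blast

lemma chart_inv_mem: "x \<in> chart_image c \<Longrightarrow> chart_inv c x \<in> fst c"
  by (rule inv_into_into)

lemma snd_chart_inv: "x \<in> chart_image c \<Longrightarrow> snd c (chart_inv c x) = x"
  by (rule f_inv_into_f)

lemma chart_partial_dir_deriv:
  "chart_partial c i f p = dir_deriv (axis i 1) (\<lambda>x. f (chart_inv c x)) (snd c p)"
  by (simp add: chart_partial_def dir_deriv_def o_def)

lemma open_chart_overlap:
  assumes c: "is_chart c" and d: "is_chart d"
  shows "open (snd c ` (fst c \<inter> fst d))"
proof -
  have "snd c ` (fst c \<inter> fst d) = chart_image c \<inter> chart_inv c -` fst d"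
    using c by (force simp: chart_inv_snd)
  moreover have "open (chart_image c \<inter> chart_inv c -` fst d)"
    using c d by (intro continuous_open_preimage) (auto simp: is_chart_def homeomorphism_def)
  ultimately show ?thesis by simp
qed

text \<open>The chart is a parameter here instead of the one picked by \<open>chart_at\<close>, so
  that two charts around the same point can be compared.\<close>

definition lap_in where
  "lap_in c g f p = (\<Sum>i\<in>UNIV. \<Sum>j\<in>UNIV. metric_inv g c p $ i $ j *
    (chart_partial c i (chart_partial c j f) p - (\<Sum>k\<in>UNIV. christoffel g c k i j p * chart_partial c k f p)))"

definition grad_norm_sq_in where
  "grad_norm_sq_in c g f p = (\<Sum>i\<in>UNIV. \<Sum>j\<in>UNIV. metric_inv g c p $ i $ j * chart_partial c i f p * chart_partial c j f p)"

definition scalar_in where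
  "scalar_in c g p = (\<Sum>i\<in>UNIV. \<Sum>j\<in>UNIV. metric_inv g c p $ i $ j * ricci g c i j p)"

lemma invariants_chart_at:
  "laplacian A g f p = lap_in (chart_at A p) g f p"
  "grad_norm_sq A g f p = grad_norm_sq_in (chart_at A p) g f p"
  "scalar_curvature A g p = scalar_in (chart_at A p) g p"
  by (simp_all add: laplacian_def lap_in_def grad_norm_sq_def grad_norm_sq_in_def
      scalar_curvature_def scalar_in_def Let_def)

lemma chart_at_mem:
  assumes "smooth_atlas A"
  shows "chart_at A p \<in> A" "p \<in> fst (chart_at A p)"
proof -
  have "p \<in> (\<Union>c\<in>A. fst c)" using assms by (simp add: smooth_atlas_def)
  then have "\<exists>c. c \<in> A \<and> p \<in> fst c" by blast
  then have "chart_at A p \<in> A \<and> p \<in> fst (chart_at A p)"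
    unfolding chart_at_def by (rule someI_ex)
  then show "chart_at A p \<in> A" "p \<in> fst (chart_at A p)" by auto
qed

text \<open>As \<open>M\<close> is invertible, \<open>matrix_inv M ** transpose J ** N\<close> is a
  left inverse of the square matrix \<open>J\<close>, hence also a right inverse; regrouped, this
  says that \<open>J ** matrix_inv M ** transpose J\<close> inverts \<open>N\<close>.\<close>

lemma inverse_metric_transform:
  fixes M N J :: "real^'n::finite^'n"
  assumes M: "\<And>v. v \<noteq> 0 \<Longrightarrow> 0 < v \<bullet> (M *v v)" and eq: "M = transpose J ** N ** J"
  shows "matrix_inv N = J ** matrix_inv M ** transpose J"
proof -
  have "(matrix_inv M ** transpose J ** N) ** J = mat 1"
    using matrix_inv_mult(1)[OF M] unfolding eq by (simp add: matrix_mul_assoc)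
  then have "J ** (matrix_inv M ** transpose J ** N) = mat 1"
    using matrix_left_right_inverse by blast
  then show ?thesis
    by (intro matrix_inv_unique) (simp add: matrix_mul_assoc)
qed

locale chart_pair =
  fixes A :: "('m::topological_space, 'n::finite) chart set" and g :: "('m, 'n) metric"
    and c d :: "('m, 'n) chart"
  assumes atlas: "smooth_atlas A" and metric: "riemannian_metric A g" and cd: "c \<in> A" "d \<in> A"
begin

abbreviation "overlap \<equiv> snd c ` (fst c \<inter> fst d)"

lemma is_charts: "is_chart c" "is_chart d"
  using atlas cd by (auto simp: smooth_atlas_def)

lemma transition: "x \<in> overlap \<Longrightarrow> chart_inv d (snd d (chart_inv c x)) = chart_inv c x"
  using is_charts by (auto simp: chart_inv_snd)

sublocale coordinate_change overlap "chart_image d" "\<lambda>x. snd d (chart_inv c x)"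
  "\<lambda>a b y. g d (chart_inv d y) $ a $ b" "\<lambda>a b y. metric_inv g d (chart_inv d y) $ a $ b"
  "\<lambda>i j x. g c (chart_inv c x) $ i $ j" "\<lambda>i j x. metric_inv g c (chart_inv c x) $ i $ j"
proof unfold_locales
  show "open overlap" using is_charts by (rule open_chart_overlap)
  show "open (chart_image d)" using is_charts by (simp add: is_chart_def)
  show "snd d (chart_inv c x) \<in> chart_image d" if "x \<in> overlap" for x
    using that is_charts by (auto simp: chart_inv_snd)
  show "smooth_on overlap (\<lambda>x. snd d (chart_inv c x) $ a)" for a
  proof -
    have "smooth_on overlap (snd d \<circ> chart_inv c)"
      using atlas cd unfolding smooth_atlas_def by blast
    from smooth_on_bounded_linear[OF bounded_linear_vec_nth this, of a] show ?thesis
      by (simp add: o_def)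
  qed
  show "smooth_on (chart_image d) (\<lambda>y. g d (chart_inv d y) $ a $ b)" for a b
  proof -
    have "bounded_linear (\<lambda>M::real^'n^'n. M $ a $ b)"
      using bounded_linear_compose[OF bounded_linear_vec_nth bounded_linear_vec_nth] .
    moreover have "smooth_on (chart_image d) (g d \<circ> chart_inv d)"
      using metric cd unfolding riemannian_metric_def by blast
    ultimately have "smooth_on (chart_image d) (\<lambda>y. (g d \<circ> chart_inv d) y $ a $ b)"
      by (rule smooth_on_bounded_linear)
    then show ?thesis by (simp add: o_def)
  qed
  have sym: "transpose (g e q) = g e q" and pos: "v \<noteq> 0 \<Longrightarrow> 0 < v \<bullet> (g e q *v v)"
    if "e \<in> A" "q \<in> fst e" for e q v
    using metric that unfolding riemannian_metric_def by blast+
  show "g d (chart_inv d y) $ a $ b = g d (chart_inv d y) $ b $ a" if "y \<in> chart_image d" for a b y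
  proof -
    have "transpose (g d (chart_inv d y)) $ b $ a = g d (chart_inv d y) $ b $ a"
      using sym[OF cd(2) chart_inv_mem[OF that]] by simp
    then show ?thesis by (simp add: transpose_def)
  qed
  show "(\<Sum>b\<in>UNIV. metric_inv g d (chart_inv d y) $ a $ b * g d (chart_inv d y) $ b $ e)
      = (if a = e then 1 else 0)" if "y \<in> chart_image d" for a e y
  proof -
    have "(metric_inv g d (chart_inv d y) ** g d (chart_inv d y)) $ a $ e = mat 1 $ a $ e"
      using matrix_inv_mult(1)[OF pos[OF cd(2) chart_inv_mem[OF that]]] by simp
    then show ?thesis by (simp add: matrix_matrix_mult_def mat_def)
  qed
  fix x assume x: "x \<in> overlap"
  define q where "q = chart_inv c x"
  have q: "q \<in> fst c" "q \<in> fst d" "snd c q = x"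
    using x is_charts by (auto simp: q_def chart_inv_snd)
  define Jm where "Jm = transition_jacobian c d q"
  have Jm: "Jm $ a $ i = dir_deriv (axis i 1) (\<lambda>x. snd d (chart_inv c x) $ a) x" for a i
    unfolding Jm_def transition_jacobian_def chart_partial_dir_deriv using q by simp
  have G: "g c q = transpose Jm ** g d q ** Jm"
    using metric cd q unfolding Jm_def riemannian_metric_def by blast
  have tr: "chart_inv d (snd d q) = q"
    using transition[OF x] by (simp add: q_def)
  show "g c (chart_inv c x) $ i $ j = (\<Sum>a\<in>UNIV. \<Sum>b\<in>UNIV.
      dir_deriv (axis i 1) (\<lambda>x. snd d (chart_inv c x) $ a) x *
      (dir_deriv (axis j 1) (\<lambda>x. snd d (chart_inv c x) $ b) x *
       g d (chart_inv d (snd d (chart_inv c x))) $ a $ b))" for i j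
  proof -
    have "g c q $ i $ j = (\<Sum>b\<in>UNIV. \<Sum>a\<in>UNIV. Jm $ a $ i * g d q $ a $ b * Jm $ b $ j)"
      unfolding G by (simp add: matrix_matrix_mult_def transpose_def sum_distrib_right)
    also have "\<dots> = (\<Sum>a\<in>UNIV. \<Sum>b\<in>UNIV. Jm $ a $ i * (Jm $ b $ j * g d q $ a $ b))"
      by ((rule sum_pull, rule sum.cong[OF refl])+, simp only: mult_ac)
    finally show ?thesis unfolding Jm[symmetric] q_def[symmetric] tr .
  qed
  show "metric_inv g d (chart_inv d (snd d (chart_inv c x))) $ a $ b = (\<Sum>i\<in>UNIV. \<Sum>j\<in>UNIV.
      dir_deriv (axis i 1) (\<lambda>x. snd d (chart_inv c x) $ a) x *
      (dir_deriv (axis j 1) (\<lambda>x. snd d (chart_inv c x) $ b) x *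
       metric_inv g c (chart_inv c x) $ i $ j))" for a b
  proof -
    have "metric_inv g d q = Jm ** metric_inv g c q ** transpose Jm"
      by (rule inverse_metric_transform[OF _ G]) (rule pos[OF cd(1) q(1)])
    then have "metric_inv g d q $ a $ b = (\<Sum>j\<in>UNIV. \<Sum>i\<in>UNIV. Jm $ a $ i * metric_inv g c q $ i $ j * Jm $ b $ j)"
      by (simp add: matrix_matrix_mult_def transpose_def sum_distrib_right)
    also have "\<dots> = (\<Sum>i\<in>UNIV. \<Sum>j\<in>UNIV. Jm $ a $ i * (Jm $ b $ j * metric_inv g c q $ i $ j))"
      by ((rule sum_pull, rule sum.cong[OF refl])+, simp only: mult_ac)
    finally show ?thesis unfolding Jm[symmetric] q_def[symmetric] tr .
  qed
qed

text \<open>Shows that the Jacobian of the locale does not involve the metric: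
  \<open>scalar_in_change\<close> instantiates \<open>chart_pair\<close> at every time and relies on
  the same Jacobian throughout.\<close>

lemma J_eq: "J = (\<lambda>a i. dir_deriv (axis i 1) (\<lambda>x. snd d (chart_inv c x) $ a))"
  by (simp add: J_def fun_eq_iff)

context
  fixes p assumes p: "p \<in> fst c" "p \<in> fst d"
begin

lemma snd_c_mem: "snd c p \<in> overlap"
  using p by auto

lemma inv_c_p: "chart_inv c (snd c p) = p" and inv_d_p: "chart_inv d (snd d p) = p"
  using p is_charts by (simp_all add: chart_inv_snd)

lemma trace_change:
  assumes "\<And>i j. P i j = (\<Sum>a\<in>UNIV. \<Sum>b\<in>UNIV. J a i (snd c p) * (J b j (snd c p) * Q a b))"
  shows "(\<Sum>i\<in>UNIV. \<Sum>j\<in>UNIV. metric_inv g c p $ i $ j * P i j) =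
    (\<Sum>a\<in>UNIV. \<Sum>b\<in>UNIV. metric_inv g d p $ a $ b * Q a b)"
  using trace_pull[OF snd_c_mem, of Q] unfolding assms by (simp add: inv_c_p inv_d_p)

lemma metric_change:
  "g c p $ i $ j = (\<Sum>a\<in>UNIV. \<Sum>b\<in>UNIV. J a i (snd c p) * (J b j (snd c p) * g d p $ a $ b))"
  using G_eq[OF snd_c_mem, of i j] by (simp add: inv_c_p inv_d_p J_def)

lemma pull_eq: "x \<in> overlap \<Longrightarrow> f (chart_inv c x) = f (chart_inv d (snd d (chart_inv c x)))"
  by (simp add: transition)

context
  fixes f :: "'m \<Rightarrow> real" assumes f: "smooth_on (chart_image d) (\<lambda>y. f (chart_inv d y))"
begin

lemma chart_partial_change:
  "chart_partial c i f p = (\<Sum>a\<in>UNIV. J a i (snd c p) * chart_partial d a f p)"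
proof -
  have "chart_partial c i f p =
      dir_deriv (axis i 1) (\<lambda>x. f (chart_inv d (snd d (chart_inv c x)))) (snd c p)"
    unfolding chart_partial_dir_deriv by (rule dir_deriv_cong_open[OF open_W snd_c_mem pull_eq])
  then show ?thesis
    using D_pull[OF f snd_c_mem, of i] by (simp add: inv_c_p chart_partial_dir_deriv)
qed

lemma grad_norm_sq_in_change: "grad_norm_sq_in c g f p = grad_norm_sq_in d g f p"
proof -
  have "chart_partial c i f p * chart_partial c j f p = (\<Sum>a\<in>UNIV. \<Sum>b\<in>UNIV.
      J a i (snd c p) * (J b j (snd c p) * (chart_partial d a f p * chart_partial d b f p)))" for i j
    unfolding chart_partial_change sum_product by (simp add: mult_ac)
  from trace_change[OF this] show ?thesis
    by (simp add: grad_norm_sq_in_def mult.assoc)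
qed

lemma lap_in_change:
  assumes fc: "smooth_on (chart_image c) (\<lambda>x. f (chart_inv c x))"
  shows "lap_in c g f p = lap_in d g f p"
proof -
  have hess: "chart_partial e i (chart_partial e j f) p - (\<Sum>k\<in>UNIV. christoffel g e k i j p * chart_partial e k f p)
      = coord_hessian (\<lambda>i j x. g e (chart_inv e x) $ i $ j) (\<lambda>i j x. metric_inv g e (chart_inv e x) $ i $ j)
          (\<lambda>x. f (chart_inv e x)) i j (snd e p)"
    if e: "is_chart e" "p \<in> fst e" for e i j
  proof -
    have "chart_partial e i (chart_partial e j f) p =
        dir_deriv (axis i 1) (dir_deriv (axis j 1) (\<lambda>x. f (chart_inv e x))) (snd e p)"
      unfolding chart_partial_dir_deriv[of e i]
      by (rule dir_deriv_cong_open[of "chart_image e"])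
        (use e in \<open>auto simp: is_chart_def chart_partial_dir_deriv snd_chart_inv\<close>)
    then show ?thesis
      using e by (simp add: coord_hessian_def christoffel_def coord_gamma_def chart_partial_dir_deriv chart_inv_snd)
  qed
  have "chart_partial c i (chart_partial c j f) p - (\<Sum>k\<in>UNIV. christoffel g c k i j p * chart_partial c k f p) =
      (\<Sum>a\<in>UNIV. \<Sum>b\<in>UNIV. J a i (snd c p) * (J b j (snd c p) *
      (chart_partial d a (chart_partial d b f) p - (\<Sum>k\<in>UNIV. christoffel g d k a b p * chart_partial d k f p))))" for i j
  proof -
    have 1: "dir_deriv v (\<lambda>x. f (chart_inv c x)) x = dir_deriv v (\<lambda>x. f (chart_inv d (snd d (chart_inv c x)))) x"
      if "x \<in> overlap" for v x
      by (rule dir_deriv_cong_open[OF open_W that pull_eq])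
    have 2: "dir_deriv w (dir_deriv v (\<lambda>x. f (chart_inv c x))) (snd c p) =
        dir_deriv w (dir_deriv v (\<lambda>x. f (chart_inv d (snd d (chart_inv c x))))) (snd c p)" for v w
      by (rule dir_deriv_cong_open[OF open_W snd_c_mem 1])
    show ?thesis
      unfolding hess[OF is_charts(1) p(1)] hess[OF is_charts(2) p(2)]
      using coord_hessian_pull[OF f snd_c_mem, of i j]
      by (simp add: coord_hessian_def 2 1[OF snd_c_mem] inv_c_p)
  qed
  from trace_change[OF this] show ?thesis
    by (simp add: lap_in_def)
qed

end

end

end

section \<open>The Ricci flow seen in a chart\<close>

text \<open>Passes from a coordinate derivative on a time slice to a space-time derivative of an
  extension \<open>K\<close>. The time is interior so that the cylinder is open and \<open>K\<close>
  is differentiable there.\<close>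

lemma chart_partial_eq:
  fixes T :: real
  assumes c: "is_chart c" and p: "p \<in> fst c" and t: "t \<in> {0<..<T}"
    and K: "smooth_on ({0<..<T} \<times> chart_image c) K"
    and eq: "\<And>q. q \<in> fst c \<Longrightarrow> F q = K (t, snd c q)"
  shows "chart_partial c i F p = dir_deriv (0, axis i 1) K (t, snd c p)"
proof -
  have o: "open (chart_image c)" using c by (simp add: is_chart_def)
  have "chart_partial c i F p = dir_deriv (axis i 1) (\<lambda>x. K (t, x)) (snd c p)"
    unfolding chart_partial_dir_deriv
  proof (rule dir_deriv_cong_open[OF o])
    show "snd c p \<in> chart_image c" using p by simp
    show "F (chart_inv c x) = K (t, x)" if "x \<in> chart_image c" for x
      using eq[OF chart_inv_mem[OF that]] snd_chart_inv[OF that] by simp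
  qed
  also have "((\<lambda>x. K (t, x)) has_derivative (\<lambda>h. dir_deriv (0, h) K (t, snd c p))) (at (snd c p))"
  proof (rule has_derivative_compose[where f = "\<lambda>x. (t, x)" and f' = "\<lambda>h. (0, h)"])
    show "((\<lambda>x. (t, x)) has_derivative (\<lambda>h. (0, h))) (at (snd c p))"
      by (auto intro!: derivative_eq_intros)
    show "(K has_derivative (\<lambda>v. dir_deriv v K (t, snd c p))) (at (t, snd c p))"
    proof (rule smooth_on_has_derivative[OF _ K])
      show "open ({0<..<T} \<times> chart_image c)" using o by (simp add: open_Times)
      show "(t, snd c p) \<in> {0<..<T} \<times> chart_image c" using t p by simp
    qed
  qed
  then have "dir_deriv (axis i 1) (\<lambda>x. K (t, x)) (snd c p) = dir_deriv (0, axis i 1) K (t, snd c p)"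
    by (rule dir_derivI)
  finally show ?thesis .
qed

lemma has_time_derivative:
  fixes K :: "real \<times> 'a::real_normed_vector \<Rightarrow> real"
  assumes "open U" "t \<in> {0<..<T}" "x \<in> U" "smooth_on ({0<..<T} \<times> U) K"
  shows "((\<lambda>s. K (s, x)) has_real_derivative dir_deriv (1, 0) K (t, x)) (at t)"
proof -
  have "((\<lambda>s. K ((0, x) + s *\<^sub>R (1, 0))) has_real_derivative dir_deriv (1, 0) K ((0, x) + t *\<^sub>R (1, 0))) (at t)"
    using assms by (intro has_real_derivative_dir_deriv) (auto intro: open_Times)
  then show ?thesis by simp
qed

text \<open>At an interior time the derivative within [0,T) is the two-sided one; in this way the
  flow and the heat equation become statements about \<open>dir_deriv (1, 0)\<close>.\<close>

lemma time_derivative_unique: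
  fixes K :: "real \<times> 'a::real_normed_vector \<Rightarrow> real"
  assumes "open U" "t \<in> {0<..<T}" "x \<in> U" "smooth_on ({0<..<T} \<times> U) K"
    and "((\<lambda>s. K (s, x)) has_real_derivative D) (at t within {0..<T})"
  shows "dir_deriv (1, 0) K (t, x) = D"
proof -
  have "at t within {0..<T} = at t"
    using assms(2) by (intro at_within_nhd[of _ "{0<..<T}"]) auto
  then show ?thesis
    using DERIV_unique[OF has_time_derivative[OF assms(1-4)]] assms(5) by simp
qed

section \<open>The flow in one chart as an instance of the local theory\<close>

locale flow_on_manifold =
  fixes A :: "('m::{t2_space, second_countable_topology}, 'n::finite) chart set"
    and g :: "real \<Rightarrow> ('m, 'n) metric" and T :: real
  assumes atlas: "smooth_atlas A" and ricci_flow: "ricci_flow A T g"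

locale flow_in_chart = flow_on_manifold A g T
  for A :: "('m::{t2_space, second_countable_topology}, 'n::finite) chart set" and g T +
  fixes c :: "('m, 'n) chart"
  assumes c: "c \<in> A"
begin

abbreviation "cW \<equiv> {0<..<T} \<times> chart_image c"

definition cG :: "'n \<Rightarrow> 'n \<Rightarrow> real \<times> (real^'n) \<Rightarrow> real" where
  "cG i j = (\<lambda>(t, x). g t c (chart_inv c x) $ i $ j)"

definition cH :: "'n \<Rightarrow> 'n \<Rightarrow> real \<times> (real^'n) \<Rightarrow> real" where
  "cH i j = (\<lambda>(t, x). metric_inv (g t) c (chart_inv c x) $ i $ j)"

lemma chart: "is_chart c"
  using atlas c by (simp add: smooth_atlas_def)

lemma open_image: "open (chart_image c)"
  using chart by (simp add: is_chart_def)

lemma metric: "t \<in> {0..<T} \<Longrightarrow> riemannian_metric A (g t)"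
  using ricci_flow by (simp add: ricci_flow_def)

lemma g_sym: "t \<in> {0..<T} \<Longrightarrow> q \<in> fst c \<Longrightarrow> transpose (g t c q) = g t c q"
  using metric c unfolding riemannian_metric_def by blast

lemma g_pos: "t \<in> {0..<T} \<Longrightarrow> q \<in> fst c \<Longrightarrow> v \<noteq> 0 \<Longrightarrow> 0 < v \<bullet> (g t c q *v v)"
  using metric c unfolding riemannian_metric_def by blast

lemma smooth_cG: "smooth_on cW (cG i j)"
proof -
  have "smooth_on ({0..<T} \<times> chart_image c) (\<lambda>(t, x). g t c (chart_inv c x))"
    using ricci_flow c unfolding ricci_flow_def by blast
  moreover have "bounded_linear (\<lambda>M::real^'n^'n. M $ i $ j)"
    using bounded_linear_compose[OF bounded_linear_vec_nth bounded_linear_vec_nth] .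
  ultimately have "smooth_on ({0..<T} \<times> chart_image c) (\<lambda>z. (\<lambda>(t, x). g t c (chart_inv c x)) z $ i $ j)"
    by (intro smooth_on_bounded_linear[of "\<lambda>M. M $ i $ j"])
  then have "smooth_on ({0..<T} \<times> chart_image c) (cG i j)"
    by (simp add: cG_def case_prod_unfold)
  then show ?thesis by (rule smooth_on_subset) auto
qed

sublocale metric_chart cW cG cH
proof unfold_locales
  show "open cW" using open_image by (intro open_Times) auto
  show "smooth_on cW (cG i j)" for i j by (rule smooth_cG)
  show "smooth_on cW (cH i j)" for i j
  proof -
    define M where "M = (\<lambda>(t, x). g t c (chart_inv c x))"
    have "smooth_on cW (\<lambda>z. M z $ i $ j)" for i j
      using smooth_cG by (simp add: cG_def M_def case_prod_unfold)
    moreover have "0 < v \<bullet> (M z *v v)" if "z \<in> cW" "v \<noteq> 0" for z v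
    proof -
      obtain t x where z: "z = (t, x)" by (cases z)
      then have x: "x \<in> chart_image c" and "t \<in> {0..<T}"
        using that(1) by (simp_all add: mem_Times_iff)
      with g_pos[OF _ chart_inv_mem[OF x] that(2)] show ?thesis by (simp add: M_def z)
    qed
    ultimately have "smooth_on cW (\<lambda>z. matrix_inv (M z) $ i $ j)"
      by (rule smooth_on_matrix_inv)
    then show ?thesis by (simp add: cH_def M_def case_prod_unfold)
  qed
  fix z i j assume zW: "z \<in> cW"
  obtain t x where zx: "z = (t, x)" by (cases z)
  then have z: "z = (t, x)" "t \<in> {0..<T}" "chart_inv c x \<in> fst c"
    using zW chart_inv_mem[of x c] by (simp_all add: mem_Times_iff)
  have "transpose (g t c (chart_inv c x)) $ i $ j = g t c (chart_inv c x) $ i $ j"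
    using g_sym[OF z(2,3)] by simp
  then show "cG i j z = cG j i z" by (simp add: cG_def z transpose_def)
  show "cH i j z = cH j i z"
    using matrix_inv_symmetric[OF g_sym g_pos] z by (simp add: cH_def)
  have "(g t c (chart_inv c x) ** matrix_inv (g t c (chart_inv c x))) $ i $ j = mat 1 $ i $ j"
    using matrix_inv_mult(2)[OF g_pos[OF z(2,3)]] by simp
  then show "(\<Sum>l\<in>UNIV. cG i l z * cH l j z) = (if i = j then 1 else 0)"
    by (simp add: cG_def cH_def z matrix_matrix_mult_def mat_def)
qed

context
  fixes t assumes t: "t \<in> {0<..<T}"
begin

lemma mem_cW: "q \<in> fst c \<Longrightarrow> (t, snd c q) \<in> cW"
  using t by auto

lemma cH_eq: "q \<in> fst c \<Longrightarrow> metric_inv (g t) c q $ i $ j = cH i j (t, snd c q)"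
  by (simp add: cH_def chart_inv_snd[OF chart])

lemma cG_eq: "q \<in> fst c \<Longrightarrow> g t c q $ i $ j = cG i j (t, snd c q)"
  by (simp add: cG_def chart_inv_snd[OF chart])

lemmas partial = chart_partial_eq[OF chart _ t]

lemma christoffel_eq: "q \<in> fst c \<Longrightarrow> christoffel (g t) c k i j q = Gam k i j (t, snd c q)"
  unfolding christoffel_def Gam_def
  by (simp add: cH_eq partial[OF _ smooth_cG cG_eq])

lemma ricci_eq: "q \<in> fst c \<Longrightarrow> ricci (g t) c i j q = Rc i j (t, snd c q)"
  unfolding ricci_def Rc_def
  by (simp add: christoffel_eq partial[OF _ smooth_Gam christoffel_eq])

lemma scalar_in_eq: "q \<in> fst c \<Longrightarrow> scalar_in c (g t) q = Rs (t, snd c q)"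
  by (simp add: scalar_in_def Rs_def ricci_eq cH_eq)

lemma lap_in_eq:
  assumes K: "smooth_on cW K" and f: "\<And>q. q \<in> fst c \<Longrightarrow> f q = K (t, snd c q)" and q: "q \<in> fst c"
  shows "lap_in c (g t) f q = Lap K (t, snd c q)"
proof -
  have 1: "chart_partial c i f q = D i K (t, snd c q)" if "q \<in> fst c" for i q
    using partial[OF that K] f by blast
  have 2: "chart_partial c i (chart_partial c j f) q = D i (D j K) (t, snd c q)" for i j
    using partial[OF q smooth_dir_deriv[OF K]] 1 by blast
  show ?thesis
    unfolding lap_in_def Lap_def Hs_def using q by (simp add: 1 2 christoffel_eq cH_eq)
qed

lemma grad_norm_sq_in_eq:
  assumes K: "smooth_on cW K" and f: "\<And>q. q \<in> fst c \<Longrightarrow> f q = K (t, snd c q)" and q: "q \<in> fst c"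
  shows "grad_norm_sq_in c (g t) f q = gsq K (t, snd c q)"
proof -
  have 1: "chart_partial c i f q = D i K (t, snd c q)" for i
    using partial[OF q K] f by blast
  show ?thesis
    unfolding grad_norm_sq_in_def gsq_def vup_def sum_distribs
    by ((rule sum_pull, rule sum.cong[OF refl])+, use H_sym[OF mem_cW[OF q]] in \<open>simp add: 1 cH_eq q mult_ac\<close>)
qed

end

sublocale ricci_flow_chart cW cG cH
proof unfold_locales
  fix z i j assume zW: "z \<in> cW"
  obtain t x where z: "z = (t, x)" by (cases z)
  then have t: "t \<in> {0<..<T}" and x: "x \<in> chart_image c"
    using zW by (simp_all add: mem_Times_iff)
  have q: "chart_inv c x \<in> fst c" "snd c (chart_inv c x) = x"
    using chart_inv_mem[OF x] snd_chart_inv[OF x] by auto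
  have "((\<lambda>s. g s c (chart_inv c x) $ i $ j) has_real_derivative - 2 * ricci (g t) c i j (chart_inv c x)) (at t within {0..<T})"
    using ricci_flow c q t unfolding ricci_flow_def by simp
  then have "((\<lambda>s. cG i j (s, x)) has_real_derivative - 2 * ricci (g t) c i j (chart_inv c x)) (at t within {0..<T})"
    by (simp add: cG_def)
  then have "Dt (cG i j) (t, x) = - 2 * ricci (g t) c i j (chart_inv c x)"
    by (rule time_derivative_unique[OF open_image t x smooth_cG])
  then show "Dt (cG i j) z = - 2 * Rc i j z"
    using ricci_eq[OF t q(1)] q(2) z by simp
qed

end

lemma (in flow_on_manifold) scalar_in_change:
  assumes c: "c \<in> A" "p \<in> fst c" and d: "d \<in> A" "p \<in> fst d" and t: "t \<in> {0<..<T}"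
  shows "scalar_in c (g t) p = scalar_in d (g t) p"
proof -
  have tr: "((\<lambda>s. g s e p $ i $ j) has_real_derivative - 2 * ricci (g t) e i j p) (at t)"
    if "e \<in> A" "p \<in> fst e" for e i j
  proof -
    have "((\<lambda>s. g s e p $ i $ j) has_real_derivative - 2 * ricci (g t) e i j p) (at t within {0..<T})"
      using ricci_flow that t unfolding ricci_flow_def by simp
    moreover have "at t within {0..<T} = at t"
      using t by (intro at_within_nhd[of _ "{0<..<T}"]) auto
    ultimately show ?thesis by simp
  qed
  have cp: "chart_pair A (g s) c d" if "s \<in> {0<..<T}" for s
    using atlas ricci_flow c d that by unfold_locales (auto simp: ricci_flow_def)
  \<comment> \<open>Independent of the time, so it acts as a constant when the transformation law of
    the metric is differentiated in time.\<close>
  define Jm where "Jm a i = dir_deriv (axis i 1) (\<lambda>x. snd d (chart_inv c x) $ a) (snd c p)" for a i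
  have g_eq: "g s c p $ i $ j = (\<Sum>a\<in>UNIV. \<Sum>b\<in>UNIV. Jm a i * (Jm b j * g s d p $ a $ b))"
    if "s \<in> {0<..<T}" for s i j
    using chart_pair.metric_change[OF cp[OF that] c(2) d(2), of i j]
    by (simp add: Jm_def chart_pair.J_eq[OF cp[OF that]])
  have "ricci (g t) c i j p = (\<Sum>a\<in>UNIV. \<Sum>b\<in>UNIV. Jm a i * (Jm b j * ricci (g t) d a b p))" for i j
  proof -
    have "((\<lambda>s. \<Sum>a\<in>UNIV. \<Sum>b\<in>UNIV. Jm a i * (Jm b j * g s d p $ a $ b)) has_real_derivative
        (\<Sum>a\<in>UNIV. \<Sum>b\<in>UNIV. Jm a i * (Jm b j * (- 2 * ricci (g t) d a b p)))) (at t)"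
      by (intro DERIV_sum DERIV_cmult tr d)
    then have "((\<lambda>s. g s c p $ i $ j) has_real_derivative
        (\<Sum>a\<in>UNIV. \<Sum>b\<in>UNIV. Jm a i * (Jm b j * (- 2 * ricci (g t) d a b p)))) (at t)"
      by (rule has_field_derivative_transform_within_open[of _ _ _ "{0<..<T}"]) (use t g_eq in auto)
    then have "(\<Sum>a\<in>UNIV. \<Sum>b\<in>UNIV. Jm a i * (Jm b j * (- 2 * ricci (g t) d a b p))) = - 2 * ricci (g t) c i j p"
      using tr[OF c] DERIV_unique by blast
    moreover have "(\<Sum>a\<in>UNIV. \<Sum>b\<in>UNIV. Jm a i * (Jm b j * (- 2 * ricci (g t) d a b p))) =
        - 2 * (\<Sum>a\<in>UNIV. \<Sum>b\<in>UNIV. Jm a i * (Jm b j * ricci (g t) d a b p))"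
      unfolding sum_distrib_left by (intro sum.cong refl) simp
    ultimately show ?thesis by simp
  qed
  then show ?thesis
    unfolding scalar_in_def
    using chart_pair.trace_change[OF cp[OF t] c(2) d(2), of "\<lambda>i j. ricci (g t) c i j p" "\<lambda>i j. ricci (g t) d i j p"]
    by (simp add: Jm_def chart_pair.J_eq[OF cp[OF t]])
qed

section \<open>The heat equation and the maximum principle\<close>

context metric_chart
begin

text \<open>The two identities add up to \<Delta>ln u + |\<nabla>ln u|^2 = (\<Delta>u)/u, by which
  the heat equation for u becomes the equation assumed in \<open>heat_chart\<close>.\<close>

lemma
  assumes u: "smooth_on W u" "\<And>x. x \<in> W \<Longrightarrow> 0 < u x" and z: "z \<in> W"
  shows gsq_ln: "gsq (\<lambda>x. ln (u x)) z = gsq u z / (u z)\<^sup>2"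
    and Lap_ln: "Lap (\<lambda>x. ln (u x)) z = Lap u z / u z - gsq u z / (u z)\<^sup>2"
proof -
  have 1: "D k (\<lambda>x. ln (u x)) x = D k u x * inverse (u x)" if "x \<in> W" for k x
    using dir_deriv_ln[OF u(1) that u(2)[OF that]] by (simp add: divide_inverse)
  have s: "smooth_on W (\<lambda>x. inverse (u x))"
    using u by (intro smooth_intros) (auto dest: less_imp_neq[symmetric])
  have uz: "u z \<noteq> 0" using u(2)[OF z] by simp
  have vup: "vup (\<lambda>x. ln (u x)) i z = vup u i z / u z" for i
    unfolding vup_def using z by (simp add: 1 divide_inverse sum_distrib_left mult_ac)
  show "gsq (\<lambda>x. ln (u x)) z = gsq u z / (u z)\<^sup>2"
    unfolding gsq_def vup 1[OF z] by (simp add: divide_inverse power2_eq_square sum_distrib_left mult_ac)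
  have 2: "D i (D j (\<lambda>x. ln (u x))) z = D i (D j u) z * inverse (u z) - D i u z * D j u z * inverse ((u z)\<^sup>2)" for i j
  proof -
    have "D i (D j (\<lambda>x. ln (u x))) z = D i (\<lambda>x. D j u x * inverse (u x)) z"
      by (rule dir_deriv_cong[OF z 1])
    then show ?thesis
      using u z s dir_deriv_inverse[OF u(1) z uz] by (simp add: dds divide_inverse)
  qed
  have 3: "Hs (\<lambda>x. ln (u x)) i j z = inverse (u z) * Hs u i j z - inverse ((u z)\<^sup>2) * (D i u z * D j u z)" for i j
    unfolding Hs_def 2 1[OF z] by (simp add: algebra_simps sum_distrib_left)
  have "Lap (\<lambda>x. ln (u x)) z = (\<Sum>i\<in>UNIV. \<Sum>j\<in>UNIV. inverse (u z) * (H i j z * Hs u i j z))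
      - (\<Sum>i\<in>UNIV. \<Sum>j\<in>UNIV. inverse ((u z)\<^sup>2) * (H i j z * D j u z * D i u z))"
    unfolding Lap_def 3 sum_subtractf[symmetric]
    by (intro sum.cong refl) (simp add: algebra_simps)
  also have "\<dots> = inverse (u z) * Lap u z - inverse ((u z)\<^sup>2) * gsq u z"
    unfolding sum_distrib_left[symmetric] Lap_def gsq_def vup_def sum_distrib_right ..
  finally show "Lap (\<lambda>x. ln (u x)) z = Lap u z / u z - gsq u z / (u z)\<^sup>2"
    by (simp add: divide_inverse mult.commute)
qed

end

text \<open>A positive second derivative along the line, with the first one zero, makes the first
  derivative positive just after 0, and the mean value theorem then contradicts the maximum.\<close>

lemma second_derivative_test:
  assumes S: "open S" "smooth_on S F" "z \<in> S" and e: "0 < e"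
    and loc_max: "\<And>s. \<bar>s\<bar> < e \<Longrightarrow> z + s *\<^sub>R v \<in> S \<and> F (z + s *\<^sub>R v) \<le> F z"
  shows "dir_deriv v F z = 0" "dir_deriv v (dir_deriv v F) z \<le> 0"
proof -
  have d1: "((\<lambda>s. F (z + s *\<^sub>R v)) has_real_derivative dir_deriv v F (z + s *\<^sub>R v)) (at s)"
    if "\<bar>s\<bar> < e" for s
    using loc_max[OF that] by (intro has_real_derivative_dir_deriv[OF S(1,2)]) simp
  show grad: "dir_deriv v F z = 0"
    using DERIV_local_max[OF d1[of 0] e] loc_max e by simp
  show "dir_deriv v (dir_deriv v F) z \<le> 0"
  proof (rule ccontr)
    assume "\<not> dir_deriv v (dir_deriv v F) z \<le> 0"
    then have pos: "0 < dir_deriv v (dir_deriv v F) (z + 0 *\<^sub>R v)" by simp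
    have "((\<lambda>s. dir_deriv v F (z + s *\<^sub>R v)) has_real_derivative
        dir_deriv v (dir_deriv v F) (z + 0 *\<^sub>R v)) (at 0)"
      using S by (intro has_real_derivative_dir_deriv[OF S(1)] smooth_on_dir_deriv) auto
    from DERIV_pos_inc_right[OF this pos] grad obtain d where d: "d > 0"
      "\<And>h. 0 < h \<Longrightarrow> h < d \<Longrightarrow> 0 < dir_deriv v F (z + h *\<^sub>R v)"
      by auto
    define s where "s = min d e / 2"
    have s: "0 < s" "s < d" "s < e" using d e by (auto simp: s_def)
    from MVT2[OF s(1), of "\<lambda>s. F (z + s *\<^sub>R v)" "\<lambda>s. dir_deriv v F (z + s *\<^sub>R v)"] d1 s
    obtain \<xi> where "0 < \<xi>" "\<xi> < s"
      "F (z + s *\<^sub>R v) - F z = s * dir_deriv v F (z + \<xi> *\<^sub>R v)"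
      by auto
    then have "0 < F (z + s *\<^sub>R v) - F z" using d(2)[of \<xi>] s by simp
    then show False using loc_max[of s] s by simp
  qed
qed

text \<open>Maxima are tested along lines, whereas \<open>LY_at_maximum\<close> asks for the matrix
  of second derivatives; bilinearity connects the two.\<close>

lemma spatial_second_derivative:
  fixes F :: "real \<times> (real^'n::finite) \<Rightarrow> real"
  assumes S: "open S" "smooth_on S F" and z: "z \<in> S"
  shows "dir_deriv (0, \<chi> i. x i) (dir_deriv (0, \<chi> i. x i) F) z =
    (\<Sum>i\<in>UNIV. \<Sum>j\<in>UNIV. x i * (x j * dir_deriv (0, axis i 1) (dir_deriv (0, axis j 1) F) z))"
proof -
  have v: "(0, \<chi> i. x i) = (\<Sum>i\<in>UNIV. x i *\<^sub>R (0::real, axis i 1 :: real^'n))"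
    using basis_expansion[of "\<chi> i. x i"]
    by (simp add: sum_prod scalar_mult_eq_scaleR prod_eq_iff fst_sum snd_sum)
  have 1: "dir_deriv (0, \<chi> i. x i) K y = (\<Sum>i\<in>UNIV. x i * dir_deriv (0, axis i 1) K y)"
    if "y \<in> S" "smooth_on S K" for K y
    unfolding v using S that by (simp only: dir_deriv_sum_dir[OF S(1) that(2,1)] dir_deriv_scaleR[OF S(1) that(2,1)])
  interpret smooth_calculus S using S by unfold_locales
  have "dir_deriv (0, \<chi> i. x i) (dir_deriv (0, \<chi> i. x i) F) z =
      dir_deriv (0, \<chi> i. x i) (\<lambda>y. \<Sum>j\<in>UNIV. x j * dir_deriv (0, axis j 1) F y) z"
    by (rule dir_deriv_cong_open[OF S(1) z 1[OF _ S(2)]])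
  also have "\<dots> = (\<Sum>i\<in>UNIV. x i * (\<Sum>j\<in>UNIV. x j * dir_deriv (0, axis i 1) (dir_deriv (0, axis j 1) F) z))"
    using S(2) z
    by (subst 1) (simp_all add: dir_deriv_sum dir_deriv_rules smooth_on_sum smooth_on_mult smooth_dir_deriv)
  finally show ?thesis by (simp add: sum_distrib_left)
qed

section \<open>The Li-Yau quantity on the manifold and the maximum principle\<close>

locale heat_on_manifold = flow_on_manifold A g T
  for A :: "('m::{t2_space, second_countable_topology}, 'n::finite) chart set" and g T +
  fixes u :: "real \<Rightarrow> 'm \<Rightarrow> real" and R1 \<delta> \<alpha> \<beta> :: real
  assumes R_bounds: "t \<in> {0..<T} \<Longrightarrow> - 1 \<le> scalar_curvature A (g t) p \<and> scalar_curvature A (g t) p \<le> R1"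
    and heat_solution: "heat_solution A T g u"
    and u_pos: "t \<in> {0..<T} \<Longrightarrow> 0 < u t p"
begin

definition LiYau :: "real \<Rightarrow> 'm \<Rightarrow> real" where
  "LiYau t p = \<delta> * (grad_norm_sq A (g t) (u t) p / (u t p)^2) - time_deriv u t p / u t p
    - \<alpha> * scalar_curvature A (g t) p + \<beta> / (scalar_curvature A (g t) p + 2)"

lemma smooth_u_slice:
  assumes "c \<in> A" "t \<in> {0<..<T}"
  shows "smooth_on (chart_image c) (\<lambda>x. u t (chart_inv c x))"
  using smooth_on_slice[of "{0..<T}" "chart_image c" "\<lambda>(t, x). u t (chart_inv c x)" t] heat_solution assms
  unfolding heat_solution_def by auto

text \<open>\<open>chart_at\<close> may jump from point to point, so the invariants become functions
  that can be differentiated near a point only after all of them are moved to one fixed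
  chart.\<close>

lemma invariants_in_chart:
  assumes "c \<in> A" "p \<in> fst c" "t \<in> {0<..<T}"
  shows "laplacian A (g t) (u t) p = lap_in c (g t) (u t) p"
    "grad_norm_sq A (g t) (u t) p = grad_norm_sq_in c (g t) (u t) p"
    "scalar_curvature A (g t) p = scalar_in c (g t) p"
proof -
  note d = chart_at_mem[OF atlas, of p]
  interpret chart_pair A "g t" "chart_at A p" c
    using atlas ricci_flow assms d by unfold_locales (auto simp: ricci_flow_def)
  show "laplacian A (g t) (u t) p = lap_in c (g t) (u t) p"
    "grad_norm_sq A (g t) (u t) p = grad_norm_sq_in c (g t) (u t) p"
    "scalar_curvature A (g t) p = scalar_in c (g t) p"
    unfolding invariants_chart_at
    using lap_in_change grad_norm_sq_in_change scalar_in_change smooth_u_slice assms d by blast+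
qed

end

locale heat_in_chart = heat_on_manifold A g T u R1 \<delta> \<alpha> \<beta> + flow_in_chart A g T c
  for A :: "('m::{t2_space, second_countable_topology}, 'n::finite) chart set"
    and g T u R1 \<delta> \<alpha> \<beta> and c :: "('m, 'n) chart"
begin

definition cu :: "real \<times> (real^'n) \<Rightarrow> real" where
  "cu = (\<lambda>(t, x). u t (chart_inv c x))"

lemma cu_eq: "q \<in> fst c \<Longrightarrow> u t q = cu (t, snd c q)"
  by (simp add: cu_def chart_inv_snd[OF chart])

lemma smooth_cu: "smooth_on cW cu"
proof -
  have "smooth_on ({0..<T} \<times> chart_image c) cu"
    using heat_solution c unfolding heat_solution_def cu_def by blast
  then show ?thesis by (rule smooth_on_subset) auto
qed

lemma cu_pos: "z \<in> cW \<Longrightarrow> 0 < cu z"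
  using u_pos by (auto simp: cu_def)

lemma Dt_cu:
  assumes t: "t \<in> {0<..<T}" and q: "q \<in> fst c"
  shows "Dt cu (t, snd c q) = Lap cu (t, snd c q)" "time_deriv u t q = Dt cu (t, snd c q)"
proof -
  have "((\<lambda>s. u s q) has_real_derivative laplacian A (g t) (u t) q) (at t within {0..<T})"
    using heat_solution t unfolding heat_solution_def by simp
  then have "((\<lambda>s. cu (s, snd c q)) has_real_derivative laplacian A (g t) (u t) q) (at t within {0..<T})"
    by (simp only: cu_eq[OF q])
  then have "Dt cu (t, snd c q) = laplacian A (g t) (u t) q"
    using q by (intro time_derivative_unique[OF open_image t _ smooth_cu]) auto
  then show "Dt cu (t, snd c q) = Lap cu (t, snd c q)"
    using lap_in_eq[OF t smooth_cu cu_eq q] invariants_in_chart(1)[OF c q t] by simp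
  have "((\<lambda>s. cu (s, snd c q)) has_real_derivative Dt cu (t, snd c q)) (at t)"
    using q by (intro has_time_derivative[OF open_image t _ smooth_cu]) auto
  then show "time_deriv u t q = Dt cu (t, snd c q)"
    unfolding cu_eq[OF q] by (rule DERIV_imp_deriv)
qed

lemma Rs_eq: "t \<in> {0<..<T} \<Longrightarrow> q \<in> fst c \<Longrightarrow> scalar_curvature A (g t) q = Rs (t, snd c q)"
  using scalar_in_eq invariants_in_chart(3) c by simp

lemma cW_cases:
  assumes "z \<in> cW"
  obtains t q where "z = (t, snd c q)" "t \<in> {0<..<T}" "q \<in> fst c"
  using assms by auto

sublocale heat_chart cW cG cH "\<lambda>z. ln (cu z)" \<delta> \<alpha> \<beta>
proof unfold_locales
  fix z assume zW: "z \<in> cW"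
  obtain t q where z: "z = (t, snd c q)" and t: "t \<in> {0<..<T}" and q: "q \<in> fst c"
    using zW by (rule cW_cases)
  show "0 \<le> (\<Sum>i\<in>UNIV. \<Sum>j\<in>UNIV. x i * x j * cH i j z)" for x
    using matrix_inv_psd[OF g_pos[OF _ q], of t x] t by (simp add: z cH_eq[OF t q, symmetric])
  show "0 < Rs z + 2"
    using R_bounds[of t q] t Rs_eq[OF t q] z by simp
  show "Dt (\<lambda>z. ln (cu z)) z = Lap (\<lambda>z. ln (cu z)) z + gsq (\<lambda>z. ln (cu z)) z"
  proof -
    have "Lap (\<lambda>z. ln (cu z)) z = Lap cu z / cu z - gsq cu z / (cu z)\<^sup>2"
      by (rule Lap_ln[OF smooth_cu cu_pos zW])
    moreover have "gsq (\<lambda>z. ln (cu z)) z = gsq cu z / (cu z)\<^sup>2"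
      by (rule gsq_ln[OF smooth_cu cu_pos zW])
    ultimately show ?thesis
      using Dt_cu(1)[OF t q] dir_deriv_ln[OF smooth_cu zW cu_pos[OF zW]] by (simp add: z)
  qed
next
  show "smooth_on cW (\<lambda>z. ln (cu z))"
    using smooth_cu cu_pos by (rule smooth_on_ln)
qed

lemma LiYau_eq:
  assumes t: "t \<in> {0<..<T}" and q: "q \<in> fst c"
  shows "LiYau t q = LY (t, snd c q)"
proof -
  define z where "z = (t, snd c q)"
  have zW: "z \<in> cW" using t q by (simp add: z_def)
  have gsq: "grad_norm_sq A (g t) (u t) q = gsq cu z"
    unfolding z_def invariants_in_chart(2)[OF c q t]
    by (rule grad_norm_sq_in_eq[OF t smooth_cu cu_eq q])
  have "gsq (\<lambda>z. ln (cu z)) z = gsq cu z / (cu z)\<^sup>2"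
    by (rule gsq_ln[OF smooth_cu cu_pos zW])
  then show ?thesis
    unfolding LiYau_def LY_def z_def[symmetric]
      dir_deriv_ln[OF smooth_cu zW cu_pos[OF zW]] gsq Dt_cu(2)[OF t q] Rs_eq[OF t q] cu_eq[OF q, of t] by simp
qed

lemma continuous_on_LiYau: "continuous_on ({0<..<T} \<times> fst c) (\<lambda>(t, q). LiYau t q)"
proof -
  have "continuous_on (fst c) (snd c)"
    using chart by (simp add: is_chart_def homeomorphism_def)
  then have "continuous_on ({0<..<T} \<times> fst c) (\<lambda>y. snd c (snd y))"
    by (rule continuous_on_compose2[OF _ continuous_on_snd[OF continuous_on_id]]) auto
  then have "continuous_on ({0<..<T} \<times> fst c) (\<lambda>y. (fst y, snd c (snd y)))"
    by (intro continuous_on_Pair continuous_on_fst continuous_on_id)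
  then have "continuous_on ({0<..<T} \<times> fst c) (\<lambda>y. LY (fst y, snd c (snd y)))"
    by (rule continuous_on_compose2[OF smooth_on_imp_continuous_on[OF smooth_LY]]) auto
  then show ?thesis
    by (rule continuous_on_eq) (auto simp: LiYau_eq)
qed

text \<open>The maximum in space gives a vanishing gradient and a semidefinite Hessian along
  straight lines of the chart. In time only earlier instants are compared, as \<open>t\<close> may
  be the end of the interval, so just the sign of the derivative of (s - \<epsilon>)F is
  obtained.\<close>

lemma LiYau_at_maximum:
  assumes \<delta>: "1/2 \<le> \<delta>" "\<delta> < 1" and n: "n = real CARD('n)"
    and \<alpha>: "\<alpha> = n / (2 * \<delta> * (1 - \<delta>)^2)" and \<beta>: "\<beta> = \<alpha> * (R1 + 2)^2"
    and t: "0 < \<epsilon>" "\<epsilon> < t" "t < T" and q: "q \<in> fst c"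
    and space_max: "\<And>p. LiYau t p \<le> LiYau t q"
    and time_max: "\<And>s. s \<in> {\<epsilon>..t} \<Longrightarrow> (s - \<epsilon>) * LiYau s q \<le> (t - \<epsilon>) * LiYau t q"
  shows "(t - \<epsilon>) * LiYau t q \<le> n / (2 * \<delta>) + 4 * n * \<beta> * T / (\<delta> * (1 - \<delta>))"
proof -
  define z where "z = (t, snd c q)"
  have tT: "t \<in> {0<..<T}" using t by simp
  have zW: "z \<in> cW" using tT q by (simp add: z_def)
  have test: "dir_deriv (0, x) LY z = 0 \<and> dir_deriv (0, x) (dir_deriv (0, x) LY) z \<le> 0" for x
  proof -
    have "((\<lambda>s. snd c q + s *\<^sub>R x) \<longlongrightarrow> snd c q + 0 *\<^sub>R x) (at 0)"
      by (intro tendsto_intros)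
    then have "\<forall>\<^sub>F s in at 0. snd c q + s *\<^sub>R x \<in> chart_image c"
      using q by (intro topological_tendstoD[OF _ open_image]) auto
    then obtain e where e: "0 < e" "\<And>s. s \<noteq> 0 \<Longrightarrow> \<bar>s\<bar> < e \<Longrightarrow> snd c q + s *\<^sub>R x \<in> chart_image c"
      unfolding eventually_at by (auto simp: dist_real_def)
    have mem: "snd c q + s *\<^sub>R x \<in> chart_image c" if "\<bar>s\<bar> < e" for s
      using e(2)[of s] that q by (cases "s = 0") auto
    have "z + s *\<^sub>R (0, x) \<in> cW \<and> LY (z + s *\<^sub>R (0, x)) \<le> LY z" if s: "\<bar>s\<bar> < e" for s
    proof -
      obtain p where p: "p \<in> fst c" "snd c q + s *\<^sub>R x = snd c p"
        using mem[OF s] by blast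
      then have "z + s *\<^sub>R (0, x) = (t, snd c p)" by (simp add: z_def)
      then show ?thesis
        using space_max[of p] LiYau_eq[OF tT p(1)] LiYau_eq[OF tT q] tT p(1) by (simp add: z_def)
    qed
    from second_derivative_test[OF open_W smooth_LY zW e(1) this] show ?thesis by blast
  qed
  have Rs: "- 1 \<le> Rs z" "Rs z \<le> R1"
    using R_bounds[of t q] tT Rs_eq[OF tT q] by (simp_all add: z_def)
  have "0 \<le> LY z + (t - \<epsilon>) * Dt LY z"
  proof (rule ccontr)
    assume neg: "\<not> 0 \<le> LY z + (t - \<epsilon>) * Dt LY z"
    have "((\<lambda>s. LY (s, snd c q)) has_real_derivative Dt LY (t, snd c q)) (at t)"
      using q by (intro has_time_derivative[OF open_image tT _ smooth_LY]) auto
    then have "((\<lambda>s. (s - \<epsilon>) * LY (s, snd c q)) has_real_derivative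
        LY (t, snd c q) + (t - \<epsilon>) * Dt LY (t, snd c q)) (at t)"
      by (auto intro!: derivative_eq_intros)
    from DERIV_neg_dec_left[OF this] neg obtain d where d: "0 < d"
      "\<And>h. 0 < h \<Longrightarrow> h < d \<Longrightarrow> (t - \<epsilon>) * LY (t, snd c q) < (t - h - \<epsilon>) * LY (t - h, snd c q)"
      by (auto simp: z_def)
    define h where "h = min d (t - \<epsilon>) / 2"
    have h: "0 < h" "h < d" "h < t - \<epsilon>" using d t by (auto simp: h_def)
    then have "(t - h - \<epsilon>) * LiYau (t - h) q \<le> (t - \<epsilon>) * LiYau t q"
      by (intro time_max) auto
    moreover have "LiYau (t - h) q = LY (t - h, snd c q)"
      using h t q by (intro LiYau_eq) auto
    ultimately show False using d(2)[OF h(1,2)] LiYau_eq[OF tT q] by simp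
  qed
  moreover have "(\<Sum>i\<in>UNIV. \<Sum>j\<in>UNIV. x i * (x j * D i (D j LY) z)) \<le> 0" for x
    using test[of "\<chi> i. x i"] spatial_second_derivative[OF open_W smooth_LY zW, of x] by simp
  ultimately show ?thesis
    unfolding LiYau_eq[OF tT q] z_def[symmetric] using test t
    by (intro LY_at_maximum[OF zW \<delta> n \<alpha> \<beta> Rs]) auto
qed

end

theorem (in heat_on_manifold) LiYau_bound:
  assumes compact: "compact (UNIV :: 'm set)"
    and \<delta>: "1/2 \<le> \<delta>" "\<delta> < 1" and n: "n = real CARD('n)"
    and \<alpha>: "\<alpha> = n / (2 * \<delta> * (1 - \<delta>)^2)" and \<beta>: "\<beta> = \<alpha> * (R1 + 2)^2"
    and t: "0 < t" "t < T"
  shows "t * LiYau t p \<le> n / (2 * \<delta>) + 4 * n * \<beta> * T / (\<delta> * (1 - \<delta>))" (is "_ \<le> ?B")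
proof (rule ccontr)
  assume neg: "\<not> t * LiYau t p \<le> ?B"
  have n0: "0 < n" using n by simp
  then have \<beta>0: "0 \<le> \<beta>" unfolding \<beta> \<alpha> using \<delta> by simp
  have B0: "0 \<le> ?B"
    using n0 \<beta>0 \<delta> t by (intro add_nonneg_nonneg divide_nonneg_nonneg mult_nonneg_nonneg) auto
  have E: "0 < LiYau t p"
    using neg B0 t zero_less_mult_pos[of t "LiYau t p"] by simp
  \<comment> \<open>The excess of tF over the bound, divided by F: every \<epsilon> below
    \<open>r\<close> leaves (t - \<epsilon>)F above the bound, so one fixed \<epsilon> takes the
    place of the limit.\<close>
  define r where "r = (t * LiYau t p - ?B) / LiYau t p"
  have r: "0 < r" using E neg unfolding r_def by (intro divide_pos_pos) auto
  define \<epsilon> where "\<epsilon> = min t r / 2"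
  have \<epsilon>: "0 < \<epsilon>" "\<epsilon> < t" "\<epsilon> < r" using r t by (auto simp: \<epsilon>_def)
  then have "\<epsilon> * LiYau t p < t * LiYau t p - ?B"
    using E unfolding r_def by (simp only: pos_less_divide_eq)
  then have big: "?B < (t - \<epsilon>) * LiYau t p"
    unfolding left_diff_distrib by linarith
  have "continuous_on (\<Union>c\<in>A. {0<..<T} \<times> fst c) (\<lambda>(t, q). LiYau t q)"
  proof (rule continuous_on_open_UN)
    fix c assume c: "c \<in> A"
    then interpret heat_in_chart A g T u R1 \<delta> \<alpha> \<beta> c by unfold_locales
    show "open ({0<..<T} \<times> fst c)" using chart by (simp add: is_chart_def open_Times)
    show "continuous_on ({0<..<T} \<times> fst c) (\<lambda>(t, q). LiYau t q)" by (rule continuous_on_LiYau)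
  qed
  moreover have "(\<Union>c\<in>A. {0<..<T} \<times> fst c) = {0<..<T} \<times> UNIV"
    using atlas by (auto simp: smooth_atlas_def)
  ultimately have "continuous_on ({\<epsilon>..t} \<times> UNIV) (\<lambda>(t, q). LiYau t q)"
    using \<epsilon> t by (auto elim!: continuous_on_subset)
  then have cont: "continuous_on ({\<epsilon>..t} \<times> UNIV) (\<lambda>y. (fst y - \<epsilon>) * LiYau (fst y) (snd y))"
    by (intro continuous_intros) (simp add: case_prod_unfold)
  have "compact ({\<epsilon>..t} \<times> (UNIV :: 'm set))" "{\<epsilon>..t} \<times> (UNIV :: 'm set) \<noteq> {}"
    using compact \<epsilon> by (auto intro: compact_Times)
  from continuous_attains_sup[OF this cont]
  obtain y where y: "y \<in> {\<epsilon>..t} \<times> (UNIV :: 'm set)"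
    "\<And>x. x \<in> {\<epsilon>..t} \<times> UNIV \<Longrightarrow> (fst x - \<epsilon>) * LiYau (fst x) (snd x) \<le> (fst y - \<epsilon>) * LiYau (fst y) (snd y)"
    by blast
  obtain s q where sq: "y = (s, q)" by (cases y)
  have max: "(s' - \<epsilon>) * LiYau s' q' \<le> (s - \<epsilon>) * LiYau s q" if "s' \<in> {\<epsilon>..t}" for s' q'
    using y(2)[of "(s', q')"] that sq by simp
  have s: "\<epsilon> \<le> s" "s \<le> t" using y(1) sq by auto
  have "?B < (s - \<epsilon>) * LiYau s q"
    using big max[of t p] \<epsilon> by simp
  \<comment> \<open>Either the weight vanishes at s = \<epsilon>, where it suffices that the bound
    is nonnegative, or the maximum lies at a later time and the pointwise estimate applies in a
    chart around \<open>q\<close>.\<close>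
  moreover have "(s - \<epsilon>) * LiYau s q \<le> ?B"
  proof (cases "s = \<epsilon>")
    case True
    then show ?thesis using B0 by simp
  next
    case False
    with s have "\<epsilon> < s" by simp
    interpret heat_in_chart A g T u R1 \<delta> \<alpha> \<beta> "chart_at A q"
      using chart_at_mem[OF atlas] by unfold_locales
    show ?thesis
    proof (rule LiYau_at_maximum[OF \<delta> n \<alpha> \<beta> \<epsilon>(1) \<open>\<epsilon> < s\<close> _ chart_at_mem(2)[OF atlas]])
      show "s < T" using s t by simp
      show "LiYau s p \<le> LiYau s q" for p
        using max[of s p] s \<open>\<epsilon> < s\<close> by simp
      show "(s' - \<epsilon>) * LiYau s' q \<le> (s - \<epsilon>) * LiYau s q" if "s' \<in> {\<epsilon>..s}" for s'
        using that s by (intro max) auto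
    qed
  qed
  ultimately show False by simp
qed

theorem theorem1p4:
  fixes A :: "('m::{t2_space, second_countable_topology}, 'n::finite) chart set"
    and g :: "real \<Rightarrow> ('m, 'n) metric"
    and u :: "real \<Rightarrow> 'm \<Rightarrow> real"
    and T R1 \<delta> \<alpha> \<beta> n :: real
  assumes "smooth_atlas A"
    and "compact (UNIV :: 'm set)"
    and "ricci_flow A T g"
    and "R1 > 0"
    and "\<And>p t. t \<in> {0..<T} \<Longrightarrow>
      - 1 \<le> scalar_curvature A (g t) p \<and> scalar_curvature A (g t) p \<le> R1"
    and "heat_solution A T g u"
    and "\<And>p t. t \<in> {0..<T} \<Longrightarrow> 0 < u t p"
    and "\<delta> \<in> {1/2..<1}"
    and "n = real CARD('n)"
    and "\<alpha> = n / (2 * \<delta> * (1 - \<delta>)^2)"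
    and "\<beta> = \<alpha> * (R1 + 2)^2"
  shows "\<forall>p. \<forall>t\<in>{0<..<T}.
    \<delta> * (grad_norm_sq A (g t) (u t) p / (u t p)^2) - time_deriv u t p / u t p
      \<le> \<delta> * (grad_norm_sq A (g t) (u t) p / (u t p)^2) - time_deriv u t p / u t p
          - \<alpha> * scalar_curvature A (g t) p + \<beta> / (scalar_curvature A (g t) p + 2)
    \<and> \<delta> * (grad_norm_sq A (g t) (u t) p / (u t p)^2) - time_deriv u t p / u t p
          - \<alpha> * scalar_curvature A (g t) p + \<beta> / (scalar_curvature A (g t) p + 2)
      \<le> 1 / t * (n / (2 * \<delta>) + 4 * n * \<beta> * T / (\<delta> * (1 - \<delta>)))"
proof (intro allI ballI conjI)
  fix p t assume t: "t \<in> {0<..<T}"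
  interpret heat_on_manifold A g T u R1 \<delta> \<alpha> \<beta>
    using assms by unfold_locales auto
  have \<delta>: "1/2 \<le> \<delta>" "\<delta> < 1" using assms(8) by auto
  define R where "R = scalar_curvature A (g t) p"
  have R: "- 1 \<le> R" "R \<le> R1" using assms(5)[of t p] t by (auto simp: R_def)
  have \<alpha>0: "0 \<le> \<alpha>" using assms(9,10) \<delta> by simp
  \<comment> \<open>As R + 2 \<ge> 1, R(R+2) \<le> (R+2)^2 \<le> (R1+2)^2. Multiplied by \<alpha>
    and divided by R + 2, this is \<alpha>R \<le> \<beta>/(R+2), that is, the first
    inequality.\<close>
  have "R * (R + 2) \<le> (R1 + 2)\<^sup>2"
    using R mult_mono[of "R + 2" "R1 + 2" "R + 2" "R1 + 2"] by (simp add: power2_eq_square algebra_simps)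
  then have "\<alpha> * (R * (R + 2)) \<le> \<beta>"
    unfolding assms(11) using \<alpha>0 by (intro mult_left_mono)
  then have "\<alpha> * R \<le> \<beta> / (R + 2)"
    using R by (simp add: pos_le_divide_eq mult.assoc)
  then show "\<delta> * (grad_norm_sq A (g t) (u t) p / (u t p)^2) - time_deriv u t p / u t p
      \<le> \<delta> * (grad_norm_sq A (g t) (u t) p / (u t p)^2) - time_deriv u t p / u t p
          - \<alpha> * scalar_curvature A (g t) p + \<beta> / (scalar_curvature A (g t) p + 2)"
    by (simp add: R_def)
  have "t * LiYau t p \<le> n / (2 * \<delta>) + 4 * n * \<beta> * T / (\<delta> * (1 - \<delta>))"
    using t by (intro LiYau_bound[OF assms(2) \<delta> assms(9-11)]) auto
  then have "LiYau t p \<le> 1 / t * (n / (2 * \<delta>) + 4 * n * \<beta> * T / (\<delta> * (1 - \<delta>)))"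
    using t by (simp add: pos_le_divide_eq mult.commute)
  then show "\<delta> * (grad_norm_sq A (g t) (u t) p / (u t p)^2) - time_deriv u t p / u t p
          - \<alpha> * scalar_curvature A (g t) p + \<beta> / (scalar_curvature A (g t) p + 2)
      \<le> 1 / t * (n / (2 * \<delta>) + 4 * n * \<beta> * T / (\<delta> * (1 - \<delta>)))"
    by (simp add: LiYau_def)
qed

end
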